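(* Let $\Lambda$ be a lattice in $\mathbb{R}^{2d}$ and let $v$ be a GRS-weight. Then a standard module frame $\{g_1,\dots,g_n\}$ for ${}_\Lambda V$ is a tight multi-window Gabor frame $\mathcal{G}(g_1,\dots,g_n;\Lambda)$ for $L^2(\mathbb{R}^d)$.
   Context: Time-frequency shifts: for $x,\omega\in\mathbb{R}^d$, $T_xf(t)=f(t-x)$, $M_\omega f(t)=e^{2\pi i\omega\cdot t}f(t)$, $\pi(x,\omega)=M_\omega T_x$. One has $\pi(\lambda)\pi(\mu)=c(\lambda,\mu)\pi(\lambda+\mu)$ with $c((x,\omega),(y,\eta))=e^{-2\pi i x\cdot\eta}$. $\langle f,g\rangle=\int f\overline{g}$. A lattice in $\mathbb{R}^{2d}$ is a discrete cocompact subgroup. A weight $v$ is a measurable $v:\mathbb{R}^{2d}\to[0,\infty)$ with $v(z+w)\le v(z)v(w)$, $v(z)\ge1$, $v(-z)=v(z)$ for all $z,w$; it is a GRS-weight if $\lim_{n\to\infty}v(n\lambda)^{1/n}=1$ for all $\lambda\in\Lambda$. $M^1_v(\mathbb{R}^d)=\{f\in L^2(\mathbb{R}^d):\int_{\mathbb{R}^{2d}}|\langle f,\pi(z)\varphi\rangle|v(z)\,dz<\infty\}$ with $\varphi(t)=e^{-\pi t\cdot t}$. $C^*(\Lambda,c)$, the noncommutative torus (twisted group $C^*$-algebra), is realized as the operator norm closure in $\mathcal{B}(L^2(\mathbb{R}^d))$ of the span of $\{\pi(\lambda):\lambda\in\Lambda\}$. ${}_\Lambda V$ is the left Hilbert $C^*(\Lambda,c)$-module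 obtained by completing $M^1_v(\mathbb{R}^d)$ in the norm ${}_\Lambda\|f\|=\|{}_\Lambda\langle f,f\rangle\|_{\mathrm{op}}^{1/2}$, where ${}_\Lambda\langle f,g\rangle=\sum_{\lambda\in\Lambda}\langle f,\pi(\lambda)g\rangle\pi(\lambda)$ and the action is $A\cdot f=Af$ (both extended by continuity). Since $\|f\|_2\le{}_\Lambda\|f\|$, the inclusion $M^1_v(\mathbb{R}^d)\subset L^2(\mathbb{R}^d)$ extends to an injection by which ${}_\Lambda V$ is regarded as a subspace of $L^2(\mathbb{R}^d)$. A finite set $\{g_1,\dots,g_n\}\subset{}_\Lambda V$ is a standard (tight) module frame for ${}_\Lambda V$ if for all $f\in{}_\Lambda V$ $${}_\Lambda\langle f,f\rangle=\sum_{i=1}^n{}_\Lambda\langle f,g_i\rangle\,{}_\Lambda\langle g_i,f\rangle,$$ equivalently $f=\sum_{i=1}^n{}_\Lambda\langle f,g_i\rangle\cdot g_i$ for all $f\in{}_\Lambda V$. $\mathcal{G}(g_1,\dots,g_n;\Lambda)=\{\pi(\lambda)g_i:\lambda\in\Lambda,1\le i\le n\}$ is a tight multi-window Gabor frame for $L^2(\mathbb{R}^d)$ if $\|f\|_2^2=\sum_{i=1}^n\sum_{\lambda\in\Lambda}|\langle f,\pi(\lambda)g_i\rangle|^2$ for all $f\in L^2(\mathbb{R}^d)$. *)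

theory Defs
  imports "HOL-Analysis.Analysis" "HOL-Probability.Sinc_Integral"
begin

definition sq_integrable :: "('a::euclidean_space \<Rightarrow> complex) \<Rightarrow> bool" where
  "sq_integrable f \<longleftrightarrow>
     f \<in> borel_measurable lborel \<and> integrable lborel (\<lambda>t. (cmod (f t))\<^sup>2)"

definition l2_rel :: "('a::euclidean_space \<Rightarrow> complex) \<Rightarrow> ('a \<Rightarrow> complex) \<Rightarrow> bool" where
  "l2_rel f g \<longleftrightarrow> sq_integrable f \<and> sq_integrable g \<and> (AE t in lborel. f t = g t)"

lemma sq_integrable_zero: "sq_integrable (\<lambda>_. 0)"
  by (simp add: sq_integrable_def)

lemma part_equivp_l2_rel: "part_equivp l2_rel"
proof (rule part_equivpI)
  show "\<exists>f. l2_rel f (f :: 'a \<Rightarrow> complex)"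
    by (rule exI[of _ "\<lambda>_. 0"]) (simp add: l2_rel_def sq_integrable_zero)
  show "symp (l2_rel :: ('a \<Rightarrow> complex) \<Rightarrow> _)"
    by (rule sympI) (auto simp: l2_rel_def)
  show "transp (l2_rel :: ('a \<Rightarrow> complex) \<Rightarrow> _)"
    by (rule transpI) (auto simp: l2_rel_def)
qed

text \<open>Square-integrable complex functions modulo equality almost everywhere.  Every Lebesgue
  measurable function agrees almost everywhere with a Borel one, so nothing is lost by using
  \<^const>\<open>lborel\<close>.\<close>

quotient_type (overloaded) 'a l2 = "'a::euclidean_space \<Rightarrow> complex" / partial: l2_rel
  by (rule part_equivp_l2_rel)

lemma sq_integrable_add:
  assumes "sq_integrable f" "sq_integrable g"
  shows "sq_integrable (\<lambda>t. f t + g t)"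
proof -
  have [measurable]: "f \<in> borel_measurable borel" "g \<in> borel_measurable borel"
    using assms by (auto simp: sq_integrable_def)
  have bd: "(cmod (f t + g t))\<^sup>2 \<le> 2 * (cmod (f t))\<^sup>2 + 2 * (cmod (g t))\<^sup>2" for t
  proof -
    have "(cmod (f t + g t))\<^sup>2 \<le> (cmod (f t) + cmod (g t))\<^sup>2"
      by (intro power_mono norm_triangle_ineq) auto
    also have "\<dots> \<le> 2 * (cmod (f t))\<^sup>2 + 2 * (cmod (g t))\<^sup>2"
      using zero_le_power2[of "cmod (f t) - cmod (g t)"]
      by (simp add: power2_eq_square algebra_simps)
    finally show ?thesis .
  qed
  have "integrable lborel (\<lambda>t. 2 * (cmod (f t))\<^sup>2 + 2 * (cmod (g t))\<^sup>2)"
    using assms by (simp add: sq_integrable_def)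
  then have "integrable lborel (\<lambda>t. (cmod (f t + g t))\<^sup>2)"
    by (rule Bochner_Integration.integrable_bound) (auto intro!: AE_I2 order_trans[OF bd])
  then show ?thesis
    by (simp add: sq_integrable_def)
qed

lemma sq_integrable_mult:
  assumes "sq_integrable f"
  shows "sq_integrable (\<lambda>t. c * f t)"
  using assms by (auto simp: sq_integrable_def norm_mult power_mult_distrib)

lemma borel_measurable_cnj [measurable]: "cnj \<in> borel_measurable borel"
  by (intro borel_measurable_continuous_onI continuous_intros)

lemma integrable_mult_cnj:
  assumes "sq_integrable f" "sq_integrable g"
  shows "integrable lborel (\<lambda>t. f t * cnj (g t))"
proof -
  have [measurable]: "f \<in> borel_measurable borel" "g \<in> borel_measurable borel"
    using assms by (auto simp: sq_integrable_def)
  have bd: "cmod (f t) * cmod (g t) \<le> (cmod (f t))\<^sup>2 + (cmod (g t))\<^sup>2" for t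
    using zero_le_power2[of "cmod (f t) - cmod (g t)"] zero_le_power2[of "cmod (f t)"]
      zero_le_power2[of "cmod (g t)"]
    unfolding power2_diff by linarith
  have "integrable lborel (\<lambda>t. (cmod (f t))\<^sup>2 + (cmod (g t))\<^sup>2)"
    using assms by (simp add: sq_integrable_def)
  then show ?thesis
    by (rule Bochner_Integration.integrable_bound)
       (auto intro!: AE_I2 simp: norm_mult bd)
qed

lift_definition cinner_l2 :: "'a::euclidean_space l2 \<Rightarrow> 'a l2 \<Rightarrow> complex"
  is "\<lambda>f g. \<integral>t. f t * cnj (g t) \<partial>lborel"
proof -
  fix f f' g g' :: "'a \<Rightarrow> complex"
  assume *: "l2_rel f f'" "l2_rel g g'"
  then have [measurable]: "f \<in> borel_measurable borel" "f' \<in> borel_measurable borel"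
      "g \<in> borel_measurable borel" "g' \<in> borel_measurable borel"
    by (auto simp: l2_rel_def sq_integrable_def)
  show "(\<integral>t. f t * cnj (g t) \<partial>lborel) = (\<integral>t. f' t * cnj (g' t) \<partial>lborel)"
    using * by (intro integral_cong_AE) (auto simp: l2_rel_def)
qed

lift_definition cscale_l2 :: "complex \<Rightarrow> 'a::euclidean_space l2 \<Rightarrow> 'a l2"
  is "\<lambda>c f t. c * f t"
  by (auto simp: l2_rel_def intro: sq_integrable_mult)

lemma Re_integral_mult_cnj:
  "Re (\<integral>t. F t * cnj (F t) \<partial>M) = (\<integral>t. (cmod (F t))\<^sup>2 \<partial>M)"
proof -
  have "F t * cnj (F t) = complex_of_real ((cmod (F t))\<^sup>2)" for t
    by (rule complex_norm_square[symmetric])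
  then have "(\<integral>t. F t * cnj (F t) \<partial>M) = complex_of_real (\<integral>t. (cmod (F t))\<^sup>2 \<partial>M)"
    by (simp only: integral_complex_of_real)
  then show ?thesis by simp
qed

instantiation l2 :: (euclidean_space) real_vector
begin

lift_definition zero_l2 :: "'a l2" is "\<lambda>_. 0"
  by (simp add: l2_rel_def sq_integrable_zero)

lift_definition plus_l2 :: "'a l2 \<Rightarrow> 'a l2 \<Rightarrow> 'a l2" is "\<lambda>f g t. f t + g t"
  by (auto simp: l2_rel_def intro: sq_integrable_add)

lift_definition uminus_l2 :: "'a l2 \<Rightarrow> 'a l2" is "\<lambda>f t. - f t"
  by (auto simp: l2_rel_def dest: sq_integrable_mult[where c = "-1"])

definition minus_l2 :: "'a l2 \<Rightarrow> 'a l2 \<Rightarrow> 'a l2" where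
  "minus_l2 f g = f + (- g)"

definition scaleR_l2 :: "real \<Rightarrow> 'a l2 \<Rightarrow> 'a l2" where
  "scaleR_l2 r f = cscale_l2 (complex_of_real r) f"

instance
proof
  fix f g h :: "'a l2" and r s :: real
  show "f + g + h = f + (g + h)"
    by transfer (auto simp: l2_rel_def add.assoc intro!: sq_integrable_add)
  show "f + g = g + f"
    by transfer (auto simp: l2_rel_def add.commute intro!: sq_integrable_add)
  show "0 + f = f"
    by transfer (auto simp: l2_rel_def)
  show "- f + f = 0"
    by transfer (auto simp: l2_rel_def sq_integrable_zero)
  show "f - g = f + - g"
    by (simp add: minus_l2_def)
  show "r *\<^sub>R (f + g) = r *\<^sub>R f + r *\<^sub>R g"
    unfolding scaleR_l2_def
    by transfer (auto simp: l2_rel_def distrib_left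
        intro!: sq_integrable_add sq_integrable_mult)
  show "(r + s) *\<^sub>R f = r *\<^sub>R f + s *\<^sub>R f"
    unfolding scaleR_l2_def
    by transfer (auto simp: l2_rel_def distrib_right
        intro!: sq_integrable_add sq_integrable_mult)
  show "r *\<^sub>R s *\<^sub>R f = (r * s) *\<^sub>R f"
    unfolding scaleR_l2_def
    by transfer (auto simp: l2_rel_def mult.assoc simp del: of_real_mult
        intro!: sq_integrable_mult, auto)
  show "1 *\<^sub>R f = f"
    unfolding scaleR_l2_def by transfer (auto simp: l2_rel_def)
qed

end

instantiation l2 :: (euclidean_space) real_inner
begin

definition inner_l2 :: "'a l2 \<Rightarrow> 'a l2 \<Rightarrow> real" where
  "inner_l2 f g = Re (cinner_l2 f g)"

definition norm_l2 :: "'a l2 \<Rightarrow> real" where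
  "norm_l2 f = sqrt (inner f f)"

definition dist_l2 :: "'a l2 \<Rightarrow> 'a l2 \<Rightarrow> real" where
  "dist_l2 f g = norm (f - g)"

definition sgn_l2 :: "'a l2 \<Rightarrow> 'a l2" where
  "sgn_l2 f = f /\<^sub>R norm f"

definition uniformity_l2 :: "('a l2 \<times> 'a l2) filter" where
  "uniformity_l2 = (INF e\<in>{0<..}. principal {(x, y). dist x y < e})"

definition open_l2 :: "'a l2 set \<Rightarrow> bool" where
  "open_l2 U \<longleftrightarrow> (\<forall>x\<in>U. \<forall>\<^sub>F (x', y) in uniformity. x' = x \<longrightarrow> y \<in> U)"

instance
proof
  fix f g h :: "'a l2" and r :: real and U :: "'a l2 set"
  show "dist f g = norm (f - g)" by (fact dist_l2_def)
  show "sgn f = f /\<^sub>R norm f" by (fact sgn_l2_def)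
  show "uniformity = (INF e\<in>{0<..}. principal {(x, y :: 'a l2). dist x y < e})"
    by (fact uniformity_l2_def)
  show "open U \<longleftrightarrow> (\<forall>x\<in>U. \<forall>\<^sub>F (x', y) in uniformity. x' = x \<longrightarrow> y \<in> U)"
    by (fact open_l2_def)
  show "norm f = sqrt (inner f f)" by (fact norm_l2_def)
  show "inner f g = inner g f"
    unfolding inner_l2_def
  proof transfer
    fix f g :: "'a \<Rightarrow> complex"
    have "(\<integral>t. g t * cnj (f t) \<partial>lborel) = (\<integral>t. cnj (f t * cnj (g t)) \<partial>lborel)"
      by (simp add: mult.commute)
    also have "\<dots> = cnj (\<integral>t. f t * cnj (g t) \<partial>lborel)"
      by (rule Bochner_Integration.integral_cnj)
    finally show "Re (\<integral>t. f t * cnj (g t) \<partial>lborel) = Re (\<integral>t. g t * cnj (f t) \<partial>lborel)"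
      by simp
  qed
  show "inner (f + g) h = inner f h + inner g h"
    unfolding inner_l2_def
    by transfer (auto simp: l2_rel_def distrib_right integrable_mult_cnj)
  show "inner (r *\<^sub>R f) g = r * inner f g"
    unfolding inner_l2_def scaleR_l2_def
    by transfer (simp add: mult.assoc)
  show "0 \<le> inner f f"
    unfolding inner_l2_def by transfer (simp add: Re_integral_mult_cnj)
  show "inner f f = 0 \<longleftrightarrow> f = 0"
    unfolding inner_l2_def
  proof transfer
    fix F :: "'a \<Rightarrow> complex"
    assume "l2_rel F F"
    then have F: "sq_integrable F" by (simp add: l2_rel_def)
    then have "(\<integral>t. (cmod (F t))\<^sup>2 \<partial>lborel) = 0 \<longleftrightarrow> (AE t in lborel. (cmod (F t))\<^sup>2 = 0)"
      by (intro integral_nonneg_eq_0_iff_AE) (auto simp: sq_integrable_def)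
    with F show "Re (\<integral>t. F t * cnj (F t) \<partial>lborel) = 0 \<longleftrightarrow> l2_rel F (\<lambda>_. 0)"
      unfolding Re_integral_mult_cnj by (simp add: l2_rel_def sq_integrable_zero)
  qed
qed

end

lemma norm_cscale_l2: "norm (cscale_l2 c f) = cmod c * norm f"
proof -
  have "inner (cscale_l2 c f) (cscale_l2 c f) = (cmod c)\<^sup>2 * inner f f"
    unfolding inner_l2_def
  proof transfer
    fix c and F :: "'a \<Rightarrow> complex"
    show "Re (\<integral>t. c * F t * cnj (c * F t) \<partial>lborel) =
        (cmod c)\<^sup>2 * Re (\<integral>t. F t * cnj (F t) \<partial>lborel)"
      unfolding Re_integral_mult_cnj by (simp add: norm_mult power_mult_distrib)
  qed
  then show ?thesis
    by (simp add: norm_l2_def real_sqrt_mult)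
qed

text \<open>Operators on \<open>L\<^sup>2\<close> are elements of \<^typ>\<open>'a::euclidean_space l2 \<Rightarrow>\<^sub>L 'a l2\<close>, which carries the operator
  norm.  This type contains all bounded real-linear operators; those used below are complex-linear.
  The complex multiple \<open>c A\<close> of an operator \<open>A\<close> is \<open>cmult_op c o\<^sub>L A\<close>.\<close>

lift_definition cmult_op :: "complex \<Rightarrow> 'a::euclidean_space l2 \<Rightarrow>\<^sub>L 'a l2" is cscale_l2
proof
  fix c :: complex and f g :: "'a l2" and r :: real
  show "cscale_l2 c (f + g) = cscale_l2 c f + cscale_l2 c g"
    by transfer (auto simp: l2_rel_def distrib_left
        intro!: sq_integrable_add sq_integrable_mult)
  show "cscale_l2 c (r *\<^sub>R f) = r *\<^sub>R cscale_l2 c f"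
    unfolding scaleR_l2_def
    by transfer (auto simp: l2_rel_def mult.left_commute intro!: sq_integrable_mult)
  show "\<exists>K. \<forall>f :: 'a l2. norm (cscale_l2 c f) \<le> norm f * K"
    by (rule exI[of _ "cmod c"]) (simp add: norm_cscale_l2 mult.commute)
qed

text \<open>Points \<open>z = (x, \<omega>)\<close> of phase space \<open>\<real>\<^sup>d \<times> \<real>\<^sup>d\<close> are pairs.\<close>

definition tf_fun :: "'a::euclidean_space \<times> 'a \<Rightarrow> ('a \<Rightarrow> complex) \<Rightarrow> 'a \<Rightarrow> complex" where
  "tf_fun z f t = exp (2 * pi * \<i> * (snd z \<bullet> t)) * f (t - fst z)"

lemma cmod_tf_fun: "cmod (tf_fun z f t) = cmod (f (t - fst z))"
proof -
  have "cmod (exp (2 * pi * \<i> * (snd z \<bullet> t))) = 1"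
    by (simp add: norm_exp_eq_Re)
  then show ?thesis by (simp add: tf_fun_def norm_mult)
qed

lemma lborel_distr_minus: "distr lborel borel (\<lambda>t. t - x) = (lborel :: 'a::euclidean_space measure)"
proof -
  have "(+) (- x) = (\<lambda>t. t - x)" by (simp add: fun_eq_iff)
  then show ?thesis using lborel_distr_plus[of "- x"] by simp
qed

lemma integral_tf_fun_sq:
  assumes "f \<in> borel_measurable lborel"
  shows "(\<integral>t. (cmod (tf_fun z f t))\<^sup>2 \<partial>lborel) = (\<integral>t. (cmod (f t))\<^sup>2 \<partial>lborel)"
proof -
  have "(\<integral>t. (cmod (f t))\<^sup>2 \<partial>lborel) =
      (\<integral>t. (cmod (f t))\<^sup>2 \<partial>distr lborel borel (\<lambda>t. t - fst z))"
    by (simp add: lborel_distr_minus)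
  also have "\<dots> = (\<integral>t. (cmod (f (t - fst z)))\<^sup>2 \<partial>lborel)"
    using assms by (subst integral_distr) auto
  finally show ?thesis by (simp add: cmod_tf_fun)
qed

lemma sq_integrable_tf_fun:
  assumes "sq_integrable f"
  shows "sq_integrable (tf_fun z f)"
proof -
  have m [measurable]: "f \<in> borel_measurable borel" using assms by (simp add: sq_integrable_def)
  have "integrable (distr lborel borel (\<lambda>t. t - fst z)) (\<lambda>t. (cmod (f t))\<^sup>2)"
    using assms by (simp add: lborel_distr_minus sq_integrable_def)
  then have "integrable lborel (\<lambda>t. (cmod (f (t - fst z)))\<^sup>2)"
    by (subst (asm) integrable_distr_eq) auto
  moreover have "tf_fun z f \<in> borel_measurable borel"
    unfolding tf_fun_def [abs_def] by measurable
  ultimately show ?thesis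
    by (simp add: sq_integrable_def cmod_tf_fun)
qed

lift_definition tf_l2 :: "'a::euclidean_space \<times> 'a \<Rightarrow> 'a l2 \<Rightarrow> 'a l2" is tf_fun
proof -
  fix z :: "'a \<times> 'a" and f g :: "'a \<Rightarrow> complex"
  assume fg: "l2_rel f g"
  then have [measurable]: "f \<in> borel_measurable borel" "g \<in> borel_measurable borel"
    by (auto simp: l2_rel_def sq_integrable_def)
  have "AE t in distr lborel borel (\<lambda>t. t - fst z). f t = g t"
    using fg unfolding lborel_distr_minus l2_rel_def by blast
  then have "AE t in lborel. f (t - fst z) = g (t - fst z)"
    by (subst (asm) AE_distr_iff) auto
  then have "AE t in lborel. tf_fun z f t = tf_fun z g t"
    by (auto simp: tf_fun_def)
  with fg show "l2_rel (tf_fun z f) (tf_fun z g)"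
    by (auto simp: l2_rel_def sq_integrable_tf_fun)
qed

lemma norm_tf_l2: "norm (tf_l2 z f) = norm f"
proof -
  have "inner (tf_l2 z f) (tf_l2 z f) = inner f f"
    unfolding inner_l2_def
  proof transfer
    fix z and F :: "'a \<Rightarrow> complex"
    assume "l2_rel F F"
    then have "F \<in> borel_measurable lborel" by (simp add: l2_rel_def sq_integrable_def)
    from integral_tf_fun_sq[OF this, of z]
    show "Re (\<integral>t. tf_fun z F t * cnj (tf_fun z F t) \<partial>lborel) =
        Re (\<integral>t. F t * cnj (F t) \<partial>lborel)"
      unfolding Re_integral_mult_cnj .
  qed
  then show ?thesis by (simp add: norm_l2_def)
qed

lift_definition tf_shift :: "'a::euclidean_space \<times> 'a \<Rightarrow> 'a l2 \<Rightarrow>\<^sub>L 'a l2" is tf_l2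
proof
  fix z :: "'a \<times> 'a" and f g :: "'a l2" and r :: real
  show "tf_l2 z (f + g) = tf_l2 z f + tf_l2 z g"
  proof transfer
    fix z and F G :: "'a \<Rightarrow> complex"
    assume "l2_rel F F" "l2_rel G G"
    then have FG: "sq_integrable F" "sq_integrable G" by (auto simp: l2_rel_def)
    have "tf_fun z (\<lambda>t. F t + G t) = (\<lambda>t. tf_fun z F t + tf_fun z G t)"
      by (simp add: fun_eq_iff tf_fun_def distrib_left)
    with FG show "l2_rel (tf_fun z (\<lambda>t. F t + G t)) (\<lambda>t. tf_fun z F t + tf_fun z G t)"
      by (simp add: l2_rel_def sq_integrable_add sq_integrable_tf_fun)
  qed
  show "tf_l2 z (r *\<^sub>R f) = r *\<^sub>R tf_l2 z f"
    unfolding scaleR_l2_def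
  proof transfer
    fix z and r :: real and F :: "'a \<Rightarrow> complex"
    assume "l2_rel F F"
    then have F: "sq_integrable F" by (auto simp: l2_rel_def)
    have "tf_fun z (\<lambda>t. complex_of_real r * F t) = (\<lambda>t. complex_of_real r * tf_fun z F t)"
      by (simp add: fun_eq_iff tf_fun_def)
    with F show "l2_rel (tf_fun z (\<lambda>t. complex_of_real r * F t))
        (\<lambda>t. complex_of_real r * tf_fun z F t)"
      by (simp add: l2_rel_def sq_integrable_mult sq_integrable_tf_fun)
  qed
  show "\<exists>K. \<forall>f :: 'a l2. norm (tf_l2 z f) \<le> norm f * K"
    by (rule exI[of _ 1]) (simp add: norm_tf_l2)
qed

text \<open>The last conjunct says that the quotient group is compact: a compact set meets all cosets.\<close>

definition lattice_subgroup :: "'b::euclidean_space set \<Rightarrow> bool" where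
  "lattice_subgroup \<Lambda> \<longleftrightarrow>
     0 \<in> \<Lambda> \<and> (\<forall>x\<in>\<Lambda>. \<forall>y\<in>\<Lambda>. x + y \<in> \<Lambda>) \<and> (\<forall>x\<in>\<Lambda>. - x \<in> \<Lambda>) \<and>
     discrete \<Lambda> \<and>
     (\<exists>K. compact K \<and> (\<forall>z. \<exists>l\<in>\<Lambda>. \<exists>k\<in>K. z = l + k))"

definition weight :: "('b::euclidean_space \<Rightarrow> real) \<Rightarrow> bool" where
  "weight v \<longleftrightarrow>
     v \<in> borel_measurable lebesgue \<and>
     (\<forall>z w. v (z + w) \<le> v z * v w) \<and> (\<forall>z. 1 \<le> v z) \<and> (\<forall>z. v (- z) = v z)"

definition GRS_weight :: "'b::euclidean_space set \<Rightarrow> ('b \<Rightarrow> real) \<Rightarrow> bool" where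
  "GRS_weight \<Lambda> v \<longleftrightarrow>
     weight v \<and> (\<forall>l\<in>\<Lambda>. (\<lambda>n. v (real n *\<^sub>R l) powr (1 / real n)) \<longlonglongrightarrow> 1)"

lemma nn_integral_gaussian_1d: "(\<integral>\<^sup>+x. ennreal (exp (- 2 * pi * x\<^sup>2)) \<partial>lborel) < \<infinity>"
proof -
  have le: "exp (- 2 * pi * x\<^sup>2) \<le> inverse (1 + x\<^sup>2)" for x :: real
  proof -
    have "1 + x\<^sup>2 \<le> 1 + 2 * pi * x\<^sup>2"
      using pi_gt3 by (simp add: mult_right_mono[of 1 "2 * pi" "x\<^sup>2", simplified])
    also have "\<dots> \<le> exp (2 * pi * x\<^sup>2)" by (rule exp_ge_add_one_self)
    finally have "inverse (exp (2 * pi * x\<^sup>2)) \<le> inverse (1 + x\<^sup>2)"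
      by (intro le_imp_inverse_le) (auto intro: add_pos_nonneg)
    then show ?thesis by (simp add: exp_minus)
  qed
  have "einterval (- \<infinity>) \<infinity> = (UNIV :: real set)"
    by (auto simp: einterval_def)
  then have "integrable lborel (\<lambda>x::real. inverse (1 + x\<^sup>2))"
    using integrable_inverse_1_plus_square by (simp add: set_integrable_def)
  then have "integrable lborel (\<lambda>x::real. exp (- 2 * pi * x\<^sup>2))"
    by (rule Bochner_Integration.integrable_bound) (use le in auto)
  then show ?thesis by (simp add: integrable_iff_bounded)
qed

lemma sq_integrable_gaussian:
  "sq_integrable (\<lambda>t :: 'a::euclidean_space. complex_of_real (exp (- pi * (t \<bullet> t))))"
proof -
  have eq: "(cmod (complex_of_real (exp (- pi * (t \<bullet> t)))))\<^sup>2 =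
      (\<Prod>b\<in>Basis. exp (- 2 * pi * (t \<bullet> b)\<^sup>2))" for t :: 'a
  proof -
    have "(exp (- pi * (t \<bullet> t)))\<^sup>2 = exp (- 2 * pi * (t \<bullet> t))"
      by (simp flip: exp_double add: mult.assoc)
    also have "\<dots> = exp (- 2 * pi * (\<Sum>b\<in>Basis. (t \<bullet> b)\<^sup>2))"
      by (subst euclidean_inner) (simp add: power2_eq_square)
    also have "\<dots> = (\<Prod>b\<in>Basis. exp (- 2 * pi * (t \<bullet> b)\<^sup>2))"
      by (simp only: sum_distrib_left exp_sum finite_Basis)
    finally show ?thesis by simp
  qed
  have "(\<integral>\<^sup>+t. (\<Prod>b\<in>Basis. ennreal (exp (- 2 * pi * (t \<bullet> b)\<^sup>2))) \<partial>(lborel :: 'a measure)) =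
      (\<Prod>b\<in>(Basis :: 'a set). \<integral>\<^sup>+x. ennreal (exp (- 2 * pi * x\<^sup>2)) \<partial>lborel)"
    by (rule nn_integral_lborel_prod) auto
  also have "\<dots> < \<infinity>"
    using nn_integral_gaussian_1d by (simp add: power_less_top_ennreal)
  finally have "integrable lborel (\<lambda>t :: 'a. \<Prod>b\<in>Basis. exp (- 2 * pi * (t \<bullet> b)\<^sup>2))"
    by (intro integrableI_nonneg) (auto intro!: AE_I2 prod_nonneg simp flip: prod_ennreal)
  then show ?thesis
    unfolding sq_integrable_def eq by auto
qed

lift_definition gaussian :: "'a::euclidean_space l2"
  is "\<lambda>t. complex_of_real (exp (- pi * (t \<bullet> t)))"
  unfolding l2_rel_def using sq_integrable_gaussian by blast

definition M1 :: "('a::euclidean_space \<times> 'a \<Rightarrow> real) \<Rightarrow> 'a l2 set" where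
  "M1 v = {f. (\<integral>\<^sup>+z. ennreal (cmod (cinner_l2 f (tf_shift z gaussian)) * v z) \<partial>lebesgue) < \<infinity>}"

text \<open>The twisted group \<open>C\<^sup>*\<close>-algebra \<open>C\<^sup>*(\<Lambda>, c)\<close>, as the operator norm closure of the complex span of
  the time-frequency shifts.  Its action on \<open>L\<^sup>2\<close> is operator application.\<close>

definition nc_torus :: "('a::euclidean_space \<times> 'a) set \<Rightarrow> ('a l2 \<Rightarrow>\<^sub>L 'a l2) set" where
  "nc_torus \<Lambda> =
     closure {(\<Sum>l\<in>F. cmult_op (a l) o\<^sub>L tf_shift l) | F a. finite F \<and> F \<subseteq> \<Lambda>}"

definition pre_ip :: "('a::euclidean_space \<times> 'a) set \<Rightarrow> 'a l2 \<Rightarrow> 'a l2 \<Rightarrow> 'a l2 \<Rightarrow>\<^sub>L 'a l2" where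
  "pre_ip \<Lambda> f g = (\<Sum>\<^sub>\<infinity>l\<in>\<Lambda>. cmult_op (cinner_l2 f (tf_shift l g)) o\<^sub>L tf_shift l)"

definition pre_norm :: "('a::euclidean_space \<times> 'a) set \<Rightarrow> 'a l2 \<Rightarrow> real" where
  "pre_norm \<Lambda> f = sqrt (norm (pre_ip \<Lambda> f f))"

text \<open>\<open>mod_approx \<Lambda> v F f\<close>: the sequence \<open>F\<close> in \<open>M\<^sup>1\<^sub>v\<close> is Cauchy for the module norm, so that it
  represents an element of the completion, and \<open>f\<close> is the image of this element under the extension
  to the completion of the inclusion \<open>M\<^sup>1\<^sub>v \<subseteq> L\<^sup>2\<close>.\<close>

definition mod_approx ::
  "('a::euclidean_space \<times> 'a) set \<Rightarrow> ('a \<times> 'a \<Rightarrow> real) \<Rightarrow> (nat \<Rightarrow> 'a l2) \<Rightarrow> 'a l2 \<Rightarrow> bool" where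
  "mod_approx \<Lambda> v F f \<longleftrightarrow>
     (\<forall>n. F n \<in> M1 v) \<and>
     (\<forall>e>0. \<exists>N. \<forall>m\<ge>N. \<forall>n\<ge>N. pre_norm \<Lambda> (F m - F n) < e) \<and>
     F \<longlonglongrightarrow> f"

definition mod_V :: "('a::euclidean_space \<times> 'a) set \<Rightarrow> ('a \<times> 'a \<Rightarrow> real) \<Rightarrow> 'a l2 set" where
  "mod_V \<Lambda> v = {f. \<exists>F. mod_approx \<Lambda> v F f}"

text \<open>Extension of \<^const>\<open>pre_ip\<close> from \<open>M\<^sup>1\<^sub>v\<close> to \<^const>\<open>mod_V\<close> by continuity; the description is
  meaningful only for \<open>f, g \<in> mod_V \<Lambda> v\<close>.\<close>

definition mod_ip ::
  "('a::euclidean_space \<times> 'a) set \<Rightarrow> ('a \<times> 'a \<Rightarrow> real) \<Rightarrow> 'a l2 \<Rightarrow> 'a l2 \<Rightarrow> 'a l2 \<Rightarrow>\<^sub>L 'a l2" where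
  "mod_ip \<Lambda> v f g = (THE A. A \<in> nc_torus \<Lambda> \<and>
     (\<forall>F G. mod_approx \<Lambda> v F f \<longrightarrow> mod_approx \<Lambda> v G g \<longrightarrow>
        (\<lambda>n. pre_ip \<Lambda> (F n) (G n)) \<longlonglongrightarrow> A))"

definition standard_module_frame ::
  "('a::euclidean_space \<times> 'a) set \<Rightarrow> ('a \<times> 'a \<Rightarrow> real) \<Rightarrow> nat \<Rightarrow> (nat \<Rightarrow> 'a l2) \<Rightarrow> bool" where
  "standard_module_frame \<Lambda> v n g \<longleftrightarrow>
     (\<forall>i\<in>{1..n}. g i \<in> mod_V \<Lambda> v) \<and>
     (\<forall>f\<in>mod_V \<Lambda> v. mod_ip \<Lambda> v f f =
        (\<Sum>i=1..n. mod_ip \<Lambda> v f (g i) o\<^sub>L mod_ip \<Lambda> v (g i) f))"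

text \<open>Summability is stated separately because \<^const>\<open>infsum\<close> is \<open>0\<close> on non-summable families.\<close>

definition tight_gabor_frame ::
  "('a::euclidean_space \<times> 'a) set \<Rightarrow> nat \<Rightarrow> (nat \<Rightarrow> 'a l2) \<Rightarrow> bool" where
  "tight_gabor_frame \<Lambda> n g \<longleftrightarrow>
     (\<forall>f. (\<forall>i\<in>{1..n}. (\<lambda>l. (cmod (cinner_l2 f (tf_shift l (g i))))\<^sup>2) summable_on \<Lambda>) \<and>
        (norm f)\<^sup>2 = (\<Sum>i=1..n. \<Sum>\<^sub>\<infinity>l\<in>\<Lambda>. (cmod (cinner_l2 f (tf_shift l (g i))))\<^sup>2))"

end

theory Submission
  imports Defs "HOL-Probability.Characteristic_Functions"
begin

text \<open>The trace \<open>\<Sum> a\<^sub>l \<pi>(l) \<mapsto> a\<^sub>0\<close> is norm-decreasing for the operator norm, since conjugating by suitable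
  \<open>\<pi>(z)\<close> and averaging removes any finite set of nonconstant terms.  For \<open>f\<close> in \<open>M\<^sup>1\<^sub>v\<close>, applying it to
  both sides of the module frame identity turns \<open>\<langle>f,f\<rangle>\<close> into \<open>\<parallel>f\<parallel>\<^sup>2\<close> and \<open>\<langle>f,g\<^sub>i\<rangle>\<langle>g\<^sub>i,f\<rangle>\<close> into
  \<open>\<Sum>\<^sub>l \<bar>\<langle>f,\<pi>(l)g\<^sub>i\<rangle>\<bar>\<^sup>2\<close>, which is the tight frame identity on a dense subspace; it extends to \<open>L\<^sup>2\<close> because
  both sides are squares of continuous seminorms.

  The work lies in giving the module inner product a meaning.  Sampling \<open>\<langle>f,\<pi>(l)g\<rangle>\<close> on the lattice is
  summable for \<open>f, g\<close> in \<open>M\<^sup>1\<^sub>v\<close> by the reproducing formula of the Gaussian window.  The module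
  Cauchy-Schwarz inequality follows from positivity of the form \<open>\<Sum>\<^sub>l \<langle>f,\<pi>(l)g\<rangle>\<langle>\<pi>(l)k,k'\<rangle>\<close>, a sum of a
  positive definite function over an amenable group.  Limits of inner products do not depend on the
  approximating sequences because they are determined by their matrix coefficients on \<open>M\<^sup>1\<^sub>v\<close>.\<close>

text \<open>The trace is never constructed as a function. Only a closed subspace of pairs (operator,
  trace value) is kept, with the value bounded by the operator norm. The bound makes the value
  unique, and closedness lets a pair pass to the limit as soon as both entries converge. Positivity
  is obtained for scalar forms only, from Gram matrices and lattice averages, so no order on
  operators is involved.

  Elements of the completion need not have summable coefficients. Facts about them are read off from
  approximating sequences, and the module norm controls the square sums of coefficients through the
  trace bound.

  Density of \<open>M1 v\<close> in \<open>l2\<close> rests on three facts: completeness of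
  \<open>l2\<close>, injectivity of the transform with Gaussian window, and membership of every
  shifted Gaussian in \<open>M1 v\<close>. The last holds because a measurable submultiplicative
  weight grows at most exponentially, which Gaussian decay absorbs.\<close>

abbreviation ei :: "real \<Rightarrow> complex" where
  "ei x \<equiv> exp (2 * pi * \<i> * x)"

abbreviation gauss_exp :: "real \<Rightarrow> 'a::real_inner \<Rightarrow> real" where
  "gauss_exp c x \<equiv> exp (- (pi * c * (x \<bullet> x)))"

section \<open>The Hilbert space structure and time-frequency shifts\<close>

lemma cinner_l2_add_left: "cinner_l2 (f + g) h = cinner_l2 f h + cinner_l2 g h"
  by transfer (auto simp: l2_rel_def distrib_right integrable_mult_cnj)

lemma cinner_l2_cnj: "cnj (cinner_l2 f g) = cinner_l2 g f"
  by transfer (simp flip: Bochner_Integration.integral_cnj add: mult.commute)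

lemma cinner_l2_add_right: "cinner_l2 h (f + g) = cinner_l2 h f + cinner_l2 h g"
  by (metis cinner_l2_add_left cinner_l2_cnj complex_cnj_add)

lemma cinner_l2_cscale_left: "cinner_l2 (cscale_l2 c f) g = c * cinner_l2 f g"
  by transfer (simp add: mult.assoc)

lemma cinner_l2_cscale_right: "cinner_l2 f (cscale_l2 c g) = cnj c * cinner_l2 f g"
  by (metis cinner_l2_cscale_left cinner_l2_cnj complex_cnj_mult)

lemma uminus_eq_cscale_l2: "- f = cscale_l2 (-1) f"
  by (metis scaleR_l2_def scaleR_minus1_left of_real_1 of_real_minus)

lemma cinner_l2_minus_left: "cinner_l2 (- f) g = - cinner_l2 f g"
  by (simp add: uminus_eq_cscale_l2 cinner_l2_cscale_left)

lemma cinner_l2_minus_right: "cinner_l2 f (- g) = - cinner_l2 f g"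
  by (simp add: uminus_eq_cscale_l2 cinner_l2_cscale_right)

lemma cinner_l2_diff_left: "cinner_l2 (f - g) h = cinner_l2 f h - cinner_l2 g h"
  by (simp only: diff_conv_add_uminus cinner_l2_add_left cinner_l2_minus_left)

lemma cinner_l2_diff_right: "cinner_l2 h (f - g) = cinner_l2 h f - cinner_l2 h g"
  by (simp only: diff_conv_add_uminus cinner_l2_add_right cinner_l2_minus_right)

lemma cinner_l2_zero_left [simp]: "cinner_l2 0 g = 0"
  by (metis cinner_l2_add_left add_cancel_right_right)

lemma cinner_l2_self: "cinner_l2 f f = complex_of_real ((norm f)\<^sup>2)"
proof -
  have "Im (cinner_l2 f f) = 0"
    using arg_cong[OF cinner_l2_cnj[of f f], of Im] by simp
  moreover have "Re (cinner_l2 f f) = (norm f)\<^sup>2"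
    by (metis inner_l2_def power2_norm_eq_inner)
  ultimately show ?thesis by (simp add: complex_eq_iff)
qed

text \<open>Multiplying \<open>f\<close> by a phase makes the complex inner product real and
  nonnegative, so Cauchy-Schwarz for the real inner product suffices. The phase \<open>u\<close>
  degenerates to 0 when the inner product vanishes, hence \<open>cmod u\<close> is only bounded by
  1.\<close>

lemma norm_cinner_l2_le: "cmod (cinner_l2 f g) \<le> norm f * norm g"
proof -
  define u where "u = cnj (sgn (cinner_l2 f g))"
  have eq: "u * cinner_l2 f g = complex_of_real (cmod (cinner_l2 f g))"
    unfolding u_def sgn_eq by (cases "cinner_l2 f g = 0")
      (simp_all add: field_simps complex_norm_square[symmetric] power2_eq_square)
  have "cmod u \<le> 1" by (simp add: u_def norm_sgn)
  have "cmod (cinner_l2 f g) = inner (cscale_l2 u f) g"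
    by (simp add: inner_l2_def cinner_l2_cscale_left eq)
  also have "\<dots> \<le> norm (cscale_l2 u f) * norm g" by (rule norm_cauchy_schwarz)
  also have "\<dots> \<le> norm f * norm g"
    using \<open>cmod u \<le> 1\<close> by (simp add: norm_cscale_l2 mult_right_mono mult_left_le_one_le)
  finally show ?thesis .
qed

lemma bounded_linear_cinner_l2_left: "bounded_linear (\<lambda>f. cinner_l2 f g)"
proof
  show "\<exists>K. \<forall>f. cmod (cinner_l2 f g) \<le> norm f * K"
    using norm_cinner_l2_le by blast
qed (simp_all add: cinner_l2_add_left scaleR_l2_def cinner_l2_cscale_left scaleR_conv_of_real)

lemma bounded_linear_cinner_l2_right: "bounded_linear (\<lambda>f. cinner_l2 g f)"
proof
  show "\<exists>K. \<forall>f. cmod (cinner_l2 g f) \<le> norm f * K"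
    using norm_cinner_l2_le by (metis mult.commute)
qed (simp_all add: cinner_l2_add_right scaleR_l2_def cinner_l2_cscale_right scaleR_conv_of_real)

lemma tendsto_cinner_l2:
  fixes F G :: "'a \<Rightarrow> 'b::euclidean_space l2"
  assumes "(F \<longlongrightarrow> f) N" "(G \<longlongrightarrow> g) N"
  shows "((\<lambda>n. cinner_l2 (F n) (G n)) \<longlongrightarrow> cinner_l2 f g) N"
proof -
  have "bounded_bilinear (cinner_l2 :: 'b l2 \<Rightarrow> _)"
  proof
    show "\<exists>K. \<forall>f g :: 'b l2. cmod (cinner_l2 f g) \<le> norm f * norm g * K"
      by (rule exI[of _ 1]) (simp add: norm_cinner_l2_le)
  qed (simp_all add: cinner_l2_add_right cinner_l2_add_left scaleR_l2_def cinner_l2_cscale_right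
      cinner_l2_cscale_left scaleR_conv_of_real)
  from bounded_bilinear.tendsto[OF this assms] show ?thesis .
qed

lemma l2_eqI: "(\<And>h. cinner_l2 f h = cinner_l2 g h) \<Longrightarrow> f = g"
  by (metis cinner_l2_diff_left cinner_l2_self eq_iff_diff_eq_0 norm_eq_zero of_real_eq_0_iff zero_eq_power2)

lemma cscale_l2_cscale_l2: "cscale_l2 a (cscale_l2 b f) = cscale_l2 (a * b) f"
  by (rule l2_eqI) (simp add: cinner_l2_cscale_left)

lemma cscale_l2_one [simp]: "cscale_l2 1 f = f"
  by (rule l2_eqI) (simp add: cinner_l2_cscale_left)

lemma cscale_l2_add: "cscale_l2 c (f + g) = cscale_l2 c f + cscale_l2 c g"
  by (rule l2_eqI) (simp add: cinner_l2_cscale_left cinner_l2_add_left distrib_left)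

lemma cscale_l2_add_left: "cscale_l2 (a + b) f = cscale_l2 a f + cscale_l2 b f"
  by (rule l2_eqI) (simp add: cinner_l2_cscale_left cinner_l2_add_left distrib_right)

lemma cinner_l2_sum_left: "cinner_l2 (\<Sum>i\<in>I. f i) g = (\<Sum>i\<in>I. cinner_l2 (f i) g)"
  using linear_sum[OF bounded_linear.linear[OF bounded_linear_cinner_l2_left]] .

lemma cinner_l2_sum_right: "cinner_l2 g (\<Sum>i\<in>I. f i) = (\<Sum>i\<in>I. cinner_l2 g (f i))"
  using linear_sum[OF bounded_linear.linear[OF bounded_linear_cinner_l2_right]] .

lemma cmult_op_apply [simp]: "blinfun_apply (cmult_op c) f = cscale_l2 c f"
  by transfer simp

lemma tf_shift_apply [simp]: "blinfun_apply (tf_shift z) f = tf_l2 z f"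
  by transfer simp

text \<open>The 2-cocycle \<open>c\<close> of the twisted group algebra, that is, the phase in
  \<pi>(z)\<pi>(w) = c(z,w)\<pi>(z+w).\<close>

definition twist :: "'a::euclidean_space \<times> 'a \<Rightarrow> 'a \<times> 'a \<Rightarrow> complex" where
  "twist z w = exp (- (2 * pi * \<i> * (fst z \<bullet> snd w)))"

lemma norm_twist [simp]: "cmod (twist z w) = 1"
  by (simp add: twist_def norm_exp_eq_Re)

lemma twist_mult_cnj [simp]: "twist z w * cnj (twist z w) = 1"
  by (simp flip: complex_norm_square)

lemma tf_l2_tf_l2: "tf_l2 z (tf_l2 w f) = cscale_l2 (twist z w) (tf_l2 (z + w) f)"
proof transfer
  fix z w :: "'a \<times> 'a" and F :: "'a \<Rightarrow> complex"
  assume "l2_rel F F"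
  then have F: "sq_integrable F" by (auto simp: l2_rel_def)
  have "tf_fun z (tf_fun w F) = (\<lambda>t. twist z w * tf_fun (z + w) F t)"
    by (auto simp: fun_eq_iff tf_fun_def twist_def algebra_simps inner_commute[of "fst z"] simp flip: exp_add)
  with F show "l2_rel (tf_fun z (tf_fun w F)) (\<lambda>t. twist z w * tf_fun (z + w) F t)"
    by (simp add: l2_rel_def sq_integrable_mult sq_integrable_tf_fun)
qed

lemma tf_l2_zero_index [simp]: "tf_l2 0 f = f"
  by transfer (simp add: tf_fun_def [abs_def])

lemma tf_l2_cscale_l2: "tf_l2 z (cscale_l2 c f) = cscale_l2 c (tf_l2 z f)"
proof transfer
  fix z and c and F :: "'a \<Rightarrow> complex"
  assume "l2_rel F F"
  then have F: "sq_integrable F" by (auto simp: l2_rel_def)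
  have "tf_fun z (\<lambda>t. c * F t) = (\<lambda>t. c * tf_fun z F t)"
    by (simp add: fun_eq_iff tf_fun_def)
  with F show "l2_rel (tf_fun z (\<lambda>t. c * F t)) (\<lambda>t. c * tf_fun z F t)"
    by (simp add: l2_rel_def sq_integrable_mult sq_integrable_tf_fun)
qed

lemma tf_l2_add: "tf_l2 z (f + g) = tf_l2 z f + tf_l2 z g"
  using blinfun.add_right[of "tf_shift z" f g] by simp

lemma tf_l2_diff: "tf_l2 z (f - g) = tf_l2 z f - tf_l2 z g"
  using blinfun.diff_right[of "tf_shift z" f g] by simp

lemma cinner_tf_l2_tf_l2: "cinner_l2 (tf_l2 z f) (tf_l2 z g) = cinner_l2 f g"
proof -
  \<comment> \<open>polarization of the isometry property\<close>
  have re: "Re (cinner_l2 (tf_l2 z f) (tf_l2 z g)) = Re (cinner_l2 f g)" for f g :: "'a l2"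
  proof -
    have "inner (tf_l2 z f) (tf_l2 z g) = ((norm (tf_l2 z (f + g)))\<^sup>2 - (norm (tf_l2 z f))\<^sup>2 - (norm (tf_l2 z g))\<^sup>2) / 2"
      unfolding tf_l2_add by (rule dot_norm)
    also have "\<dots> = inner f g" by (simp add: norm_tf_l2 dot_norm)
    finally show ?thesis by (simp add: inner_l2_def)
  qed
  moreover have "Im (cinner_l2 (tf_l2 z f) (tf_l2 z g)) = Im (cinner_l2 f g)"
    using re[of f "cscale_l2 \<i> g"] by (simp add: tf_l2_cscale_l2 cinner_l2_cscale_right)
  ultimately show ?thesis by (simp add: complex_eq_iff)
qed

text \<open>The adjoint of the unitary \<pi>(z) is its inverse, and \<pi>(z)\<pi>(-z) is the scalar
  \<open>twist z (- z)\<close>.\<close>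

lemma cinner_tf_l2_right: "cinner_l2 f (tf_l2 z g) = cnj (twist z (- z)) * cinner_l2 (tf_l2 (- z) f) g"
proof -
  have "cinner_l2 f (tf_l2 z g) = cinner_l2 (tf_l2 (-z) f) (tf_l2 (-z) (tf_l2 z g))"
    by (simp add: cinner_tf_l2_tf_l2)
  also have "\<dots> = cnj (twist (- z) z) * cinner_l2 (tf_l2 (- z) f) g"
    by (simp add: tf_l2_tf_l2 cinner_l2_cscale_right)
  also have "twist (- z) z = twist z (- z)"
    by (simp add: twist_def)
  finally show ?thesis .
qed

text \<open>Up to a phase, inner products of shifted vectors depend only on the difference of the
  shifts. Two such inner products, one of them conjugated, carry cancelling phases; this yields
  functions of \<open>w - z\<close> alone.\<close>

lemma cinner_tf_l2_tf_l2_diff: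
  "cinner_l2 (tf_l2 w f) (tf_l2 z g) = cnj (twist z (w - z)) * cinner_l2 (tf_l2 (w - z) f) g"
proof -
  have "tf_l2 w f = cscale_l2 (cnj (twist z (w - z))) (tf_l2 z (tf_l2 (w - z) f))"
    by (simp add: tf_l2_tf_l2 cscale_l2_cscale_l2 mult.commute[of "cnj _"])
  then show ?thesis by (simp add: cinner_l2_cscale_left cinner_tf_l2_tf_l2)
qed

section \<open>Completeness of the space of square-integrable functions\<close>

lemma l2_obtain:
  obtains F where "sq_integrable F" "f = abs_l2 F"
proof -
  obtain F where "l2_rel F F" "f = abs_l2 F"
    by (metis Quotient_l2 Quotient_rep_reflp Quotient_abs_rep)
  then show ?thesis using that by (auto simp: l2_rel_def)
qed

lemma l2_rel_refl: "sq_integrable F \<Longrightarrow> l2_rel F F"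
  by (simp add: l2_rel_def)

lemma cinner_l2_abs:
  assumes "sq_integrable F" "sq_integrable G"
  shows "cinner_l2 (abs_l2 F) (abs_l2 G) = (\<integral>t. F t * cnj (G t) \<partial>lborel)"
  using cinner_l2.abs_eq[OF assms[THEN l2_rel_refl]] .

lemma norm_abs_l2:
  assumes "sq_integrable F"
  shows "(norm (abs_l2 F))\<^sup>2 = (\<integral>t. (cmod (F t))\<^sup>2 \<partial>lborel)"
  by (simp add: norm_l2_def inner_l2_def cinner_l2_abs[OF assms assms] Re_integral_mult_cnj)

lemma sq_integrable_diff:
  assumes "sq_integrable f" "sq_integrable g"
  shows "sq_integrable (\<lambda>t. f t - g t)"
  using sq_integrable_add[OF assms(1) sq_integrable_mult[OF assms(2), of "-1"]] by simp

lemma abs_l2_diff: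
  assumes "sq_integrable F" "sq_integrable G"
  shows "abs_l2 F - abs_l2 G = abs_l2 (\<lambda>t. F t - G t)"
proof -
  have G: "l2_rel (\<lambda>t. - G t) (\<lambda>t. - G t)"
    using sq_integrable_mult[OF assms(2), of "-1"] by (simp add: l2_rel_refl)
  show ?thesis
    using assms G by (simp add: minus_l2_def uminus_l2.abs_eq plus_l2.abs_eq l2_rel_refl)
qed

lemma nn_integral_norm_abs_l2:
  assumes "sq_integrable F"
  shows "(\<integral>\<^sup>+t. ennreal ((cmod (F t))\<^sup>2) \<partial>lborel) = ennreal ((norm (abs_l2 F))\<^sup>2)"
  using assms by (subst norm_abs_l2) (auto simp: sq_integrable_def intro!: nn_integral_eq_integral)

lemma sq_integrable_iff:
  "sq_integrable F \<longleftrightarrow> F \<in> borel_measurable lborel \<and> (\<integral>\<^sup>+t. ennreal ((cmod (F t))\<^sup>2) \<partial>lborel) < \<infinity>"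
  by (auto simp: sq_integrable_def integrable_iff_bounded)

text \<open>The hypothesis bounds the increments by \<open>sqrt C * (1/2) ^ k\<close>, so the
  telescoping series converges absolutely.\<close>

lemma cmod_le_geometric_imp_convergent:
  fixes x :: "nat \<Rightarrow> complex"
  assumes "\<And>k. 4 ^ k * (cmod (x (Suc k) - x k))\<^sup>2 \<le> C"
  shows "convergent x"
proof -
  have "cmod (x (Suc k) - x k) \<le> sqrt C * (1/2) ^ k" for k
  proof -
    have "(2 ^ k * cmod (x (Suc k) - x k))\<^sup>2 \<le> C"
      using assms[of k] by (simp add: power_mult_distrib power_mult[symmetric] mult.commute[of k] power_mult)
    then have "2 ^ k * cmod (x (Suc k) - x k) \<le> sqrt C" by (rule real_le_rsqrt)
    then show ?thesis by (simp add: field_simps power_one_over)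
  qed
  moreover have "summable (\<lambda>k. sqrt C * (1/2) ^ k)"
    by (rule summable_mult) (simp add: summable_geometric)
  ultimately have "summable (\<lambda>k. x (Suc k) - x k)"
    by (metis (no_types, lifting) summable_comparison_test)
  then have "convergent (\<lambda>n. (x n - x 0) + x 0)"
    by (intro convergent_add convergent_const) (simp add: summable_iff_convergent sum_lessThan_telescope)
  then show ?thesis by simp
qed

text \<open>Riesz-Fischer. Along a subsequence with increments of norm below
  \<open>(1/4) ^ k\<close>, the squared increments remain summable in mean after multiplication by
  \<open>4 ^ k\<close>, since \<open>4 ^ k * ((1/4) ^ k)\<^sup>2 = (1/4) ^ k\<close>. The spare
  factor gives pointwise convergence almost everywhere.\<close>

instance l2 :: (euclidean_space) banach
proof
  fix X :: "nat \<Rightarrow> 'a l2"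
  assume X: "Cauchy X"
  define Y where "Y k = (SOME N. \<forall>m\<ge>N. \<forall>n\<ge>N. norm (X m - X n) < (1/4) ^ k)" for k :: nat
  have Y: "norm (X m - X n) < (1/4) ^ k" if "m \<ge> Y k" "n \<ge> Y k" for m n k
  proof -
    have "\<exists>N. \<forall>m\<ge>N. \<forall>n\<ge>N. norm (X m - X n) < (1/4) ^ k"
      using CauchyD[OF X, of "(1/4) ^ k"] by simp
    from someI_ex[OF this] show ?thesis using that by (simp add: Y_def)
  qed
  \<comment> \<open>Summing all earlier thresholds and adding \<open>k\<close> makes the indices
    strictly increasing and at least \<open>Y k\<close>.\<close>
  define r where "r k = (\<Sum>j\<le>k. Y j) + k" for k
  have r: "strict_mono r" by (rule strict_monoI_Suc) (simp add: r_def)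
  have rY: "r m \<ge> Y k" if "m \<ge> k" for m k
  proof -
    have "Y k \<le> (\<Sum>j\<le>m. Y j)" using that by (intro member_le_sum) auto
    then show ?thesis by (simp add: r_def)
  qed
  have dist_r: "norm (X (r m) - X (r n)) < (1/4) ^ k" if "m \<ge> k" "n \<ge> k" for m n k
    using that rY by (intro Y) auto
  have "\<exists>F. \<forall>k. sq_integrable (F k) \<and> X (r k) = abs_l2 (F k)"
    by (intro choice allI) (metis l2_obtain)
  then obtain F where F: "\<And>k. sq_integrable (F k)" "\<And>k. X (r k) = abs_l2 (F k)" by blast
  have [measurable]: "F k \<in> borel_measurable borel" for k using F(1)[of k] by (simp add: sq_integrable_def)
  have nnd: "(\<integral>\<^sup>+t. ennreal ((cmod (F m t - F n t))\<^sup>2) \<partial>lborel) = ennreal ((norm (X (r m) - X (r n)))\<^sup>2)" for m n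
    using nn_integral_norm_abs_l2[OF sq_integrable_diff[OF F(1)[of m] F(1)[of n]]]
    by (simp add: F(2) abs_l2_diff F(1))
  have "(\<integral>\<^sup>+t. (\<Sum>k. ennreal (4 ^ k * (cmod (F (Suc k) t - F k t))\<^sup>2)) \<partial>lborel)
      = (\<Sum>k. ennreal (4 ^ k * (norm (X (r (Suc k)) - X (r k)))\<^sup>2))"
    by (simp add: nn_integral_suminf ennreal_mult nn_integral_cmult nnd)
  also have "\<dots> \<le> (\<Sum>k. ennreal ((1/4) ^ k))"
  proof (intro suminf_le allI)
    fix k
    have "(norm (X (r (Suc k)) - X (r k)))\<^sup>2 \<le> ((1/4) ^ k)\<^sup>2"
      using dist_r[of k "Suc k" k] by (intro power_mono) auto
    then have "4 ^ k * (norm (X (r (Suc k)) - X (r k)))\<^sup>2 \<le> 4 ^ k * ((1/4) ^ k)\<^sup>2"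
      by (rule mult_left_mono) simp
    also have "4 ^ k * ((1/4::real) ^ k)\<^sup>2 = (1/4) ^ k"
      by (simp add: power2_eq_square power_one_over)
    finally show "ennreal (4 ^ k * (norm (X (r (Suc k)) - X (r k)))\<^sup>2) \<le> ennreal ((1/4) ^ k)"
      by (rule ennreal_leI)
  qed auto
  also have "\<dots> < \<infinity>"
    by (subst suminf_ennreal2) (auto intro: summable_geometric)
  finally have "AE t in lborel. (\<Sum>k. ennreal (4 ^ k * (cmod (F (Suc k) t - F k t))\<^sup>2)) \<noteq> \<infinity>"
    by (intro nn_integral_PInf_AE) auto
  then have conv: "AE t in lborel. convergent (\<lambda>k. F k t)"
  proof eventually_elim
    case (elim t)
    define S where "S = (\<Sum>k. ennreal (4 ^ k * (cmod (F (Suc k) t - F k t))\<^sup>2))"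
    have C: "S = ennreal (enn2real S)"
      using elim by (simp add: S_def less_top)
    have "4 ^ k * (cmod (F (Suc k) t - F k t))\<^sup>2 \<le> enn2real S" for k
    proof -
      have "(\<Sum>j\<in>{k}. ennreal (4 ^ j * (cmod (F (Suc j) t - F j t))\<^sup>2)) \<le> S"
        unfolding S_def by (rule sum_le_suminf) auto
      then have "ennreal (4 ^ k * (cmod (F (Suc k) t - F k t))\<^sup>2) \<le> ennreal (enn2real S)"
        using C by simp
      then show ?thesis by (simp add: ennreal_le_iff)
    qed
    then show "convergent (\<lambda>k. F k t)"
      by (rule cmod_le_geometric_imp_convergent)
  qed
  define f where "f t = lim (\<lambda>k. F k t)" for t
  have [measurable]: "f \<in> borel_measurable borel"
    unfolding f_def [abs_def] by measurable
  have lim: "AE t in lborel. (\<lambda>k. F k t) \<longlonglongrightarrow> f t"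
    using conv by eventually_elim (simp add: f_def convergent_LIMSEQ_iff)
  \<comment> \<open>Fatou's lemma, applied to the differences with the \<open>m\<close>-th term as
    \<open>m\<close> grows, upgrades the pointwise limit to a limit in norm with an explicit
    rate.\<close>
  have fatou: "(\<integral>\<^sup>+t. ennreal ((cmod (F k t - f t))\<^sup>2) \<partial>lborel) \<le> ennreal (((1/4) ^ k)\<^sup>2)" for k
  proof -
    have "(\<integral>\<^sup>+t. ennreal ((cmod (F k t - f t))\<^sup>2) \<partial>lborel)
        = (\<integral>\<^sup>+t. liminf (\<lambda>m. ennreal ((cmod (F k t - F m t))\<^sup>2)) \<partial>lborel)"
      using lim
    proof (intro nn_integral_cong_AE, eventually_elim)
      fix t assume "(\<lambda>k. F k t) \<longlonglongrightarrow> f t"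
      then have "(\<lambda>m. ennreal ((cmod (F k t - F m t))\<^sup>2)) \<longlonglongrightarrow> ennreal ((cmod (F k t - f t))\<^sup>2)"
        by (intro tendsto_ennrealI tendsto_intros)
      then show "ennreal ((cmod (F k t - f t))\<^sup>2) = liminf (\<lambda>m. ennreal ((cmod (F k t - F m t))\<^sup>2))"
        by (intro lim_imp_Liminf[symmetric]) auto
    qed
    also have "\<dots> \<le> liminf (\<lambda>m. \<integral>\<^sup>+t. ennreal ((cmod (F k t - F m t))\<^sup>2) \<partial>lborel)"
      by (intro nn_integral_liminf) auto
    also have "\<dots> \<le> ennreal (((1/4) ^ k)\<^sup>2)"
    proof (rule Liminf_le)
      show "\<forall>\<^sub>F m in sequentially. (\<integral>\<^sup>+t. ennreal ((cmod (F k t - F m t))\<^sup>2) \<partial>lborel) \<le> ennreal (((1/4) ^ k)\<^sup>2)"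
        unfolding nnd using dist_r[of k k]
        by (auto intro!: eventually_sequentiallyI[of k] ennreal_leI power_mono less_imp_le)
    qed simp
    finally show ?thesis .
  qed
  have sqd: "sq_integrable (\<lambda>t. F k t - f t)" for k
    unfolding sq_integrable_iff using le_less_trans[OF fatou[of k]] by auto
  have f: "sq_integrable f"
    using sq_integrable_diff[OF F(1) sqd, of 0 0] by simp
  have bd: "norm (X (r k) - abs_l2 f) \<le> (1/4) ^ k" for k
  proof -
    have "ennreal ((norm (X (r k) - abs_l2 f))\<^sup>2) \<le> ennreal (((1/4) ^ k)\<^sup>2)"
      using fatou[of k] unfolding nn_integral_norm_abs_l2[OF sqd] by (simp add: F abs_l2_diff f)
    then show ?thesis by (simp add: power2_le_iff_abs_le)
  qed
  have "(\<lambda>k. X (r k) - abs_l2 f) \<longlonglongrightarrow> 0"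
    by (rule Lim_null_comparison[OF _ LIMSEQ_power_zero[of "1/4::real"]]) (use bd in auto)
  then have "(X \<circ> r) \<longlonglongrightarrow> abs_l2 f"
    by (simp add: LIM_zero_iff comp_def)
  then show "convergent X"
    using X r by (metis Cauchy_converges_subseq convergentI)
qed

section \<open>Gaussian integrals\<close>

lemma integral_lborel_prod:
  fixes f :: "'a::euclidean_space \<Rightarrow> real \<Rightarrow> complex"
  assumes f: "\<And>b. b \<in> Basis \<Longrightarrow> integrable lborel (f b)"
  shows integrable_lborel_prod: "integrable lborel (\<lambda>x :: 'a. \<Prod>b\<in>Basis. f b (x \<bullet> b))"
    and "(\<integral>x. (\<Prod>b\<in>Basis. f b (x \<bullet> b)) \<partial>(lborel :: 'a measure)) = (\<Prod>b\<in>Basis. \<integral>x. f b x \<partial>lborel)"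
proof -
  interpret product_sigma_finite "\<lambda>_ :: 'a. lborel :: real measure"
    by (simp add: product_sigma_finite_def sigma_finite_lborel)
  have [measurable]: "\<And>b. b \<in> Basis \<Longrightarrow> f b \<in> borel_measurable borel"
    using f by (auto dest: borel_measurable_integrable)
  show "integrable lborel (\<lambda>x :: 'a. \<Prod>b\<in>Basis. f b (x \<bullet> b))"
    using f
    by (subst lborel_eq[where 'a = 'a], subst integrable_distr_eq) (auto intro!: product_integrable_prod)
  show "(\<integral>x. (\<Prod>b\<in>Basis. f b (x \<bullet> b)) \<partial>(lborel :: 'a measure)) = (\<Prod>b\<in>Basis. \<integral>x. f b x \<partial>lborel)"
    using f
    by (subst lborel_eq[where 'a = 'a], subst integral_distr) (auto simp: product_integral_prod)
qed

text \<open>A rescaling of the characteristic function of the standard normal distribution.\<close>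

lemma fourier_gaussian_1d:
  fixes \<alpha> w :: real
  assumes "\<alpha> > 0"
  shows "has_bochner_integral lborel (\<lambda>t :: real. exp (- (pi * \<alpha> * t\<^sup>2)) * ei (w * t))
    (complex_of_real (\<alpha> powr (-1/2) * exp (- (pi * w\<^sup>2 / \<alpha>))))"
proof -
  \<comment> \<open>The substitution \<open>x = c * t\<close> turns the exponent
    \<open>x\<^sup>2 / 2\<close> into \<open>pi * \<alpha> * t\<^sup>2\<close>, and \<open>s\<close>
    is the frequency for which \<open>s * (c * t) = 2 * pi * (w * t)\<close>.\<close>
  define c where "c = sqrt (2 * pi * \<alpha>)"
  define s where "s = 2 * pi * w / c"
  have c: "c > 0" "c\<^sup>2 = 2 * pi * \<alpha>" using assms by (auto simp: c_def)
  let ?F = "\<lambda>x. std_normal_density x *\<^sub>R iexp (s * x)"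
  have int: "integrable lborel ?F"
  proof -
    have "integrable lborel std_normal_density" by (rule integrable_normal_density) simp
    then show ?thesis
      by (rule Bochner_Integration.integrable_bound) (simp_all add: normal_density_nonneg)
  qed
  have "(\<integral>x. ?F x \<partial>lborel) = complex_of_real (exp (- (s\<^sup>2) / 2))"
    using fun_cong[OF char_std_normal_distribution, of s]
    by (simp add: char_def integral_density normal_density_nonneg)
  then have "has_bochner_integral lborel ?F (exp (- (s\<^sup>2) / 2))"
    using int by (simp add: has_bochner_integral_iff)
  then have "has_bochner_integral lborel (\<lambda>x. ?F (0 + c * x)) (complex_of_real (exp (- (s\<^sup>2) / 2)) /\<^sub>R \<bar>c\<bar>)"
    using c by (subst (asm) lborel_has_bochner_integral_real_affine_iff[of c _ _ 0]) auto
  then have "has_bochner_integral lborel (\<lambda>x. sqrt (2 * pi) *\<^sub>R ?F (0 + c * x))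
      (sqrt (2 * pi) *\<^sub>R (complex_of_real (exp (- (s\<^sup>2) / 2)) /\<^sub>R \<bar>c\<bar>))"
    by (rule has_bochner_integral_scaleR_right)
  moreover have "sqrt (2 * pi) *\<^sub>R ?F (0 + c * t) = exp (- (pi * \<alpha> * t\<^sup>2)) * ei (w * t)" for t
  proof -
    have "sqrt (2 * pi) * std_normal_density (c * t) = exp (- (pi * \<alpha> * t\<^sup>2))"
      using c by (simp add: normal_density_def power_mult_distrib)
    moreover have "s * (c * t) = 2 * pi * (w * t)"
      using c by (simp add: s_def)
    moreover have "sqrt (2 * pi) *\<^sub>R ?F (0 + c * t)
        = complex_of_real (sqrt (2 * pi) * std_normal_density (c * t)) * iexp (s * (c * t))"
      by (simp add: scaleR_conv_of_real)
    ultimately have "sqrt (2 * pi) *\<^sub>R ?F (0 + c * t)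
        = complex_of_real (exp (- (pi * \<alpha> * t\<^sup>2))) * iexp (2 * pi * (w * t))"
      by (simp only:)
    then show ?thesis by (simp add: mult_ac)
  qed
  moreover have "sqrt (2 * pi) *\<^sub>R (complex_of_real (exp (- (s\<^sup>2) / 2)) /\<^sub>R \<bar>c\<bar>)
      = complex_of_real (\<alpha> powr (-1/2) * exp (- (pi * w\<^sup>2 / \<alpha>)))"
  proof -
    have "s\<^sup>2 / 2 = pi * w\<^sup>2 / \<alpha>"
    proof -
      have "s\<^sup>2 / 2 = (2 * pi * w)\<^sup>2 / (2 * pi * \<alpha>) / 2"
        by (simp add: s_def power_divide c)
      also have "\<dots> = pi * w\<^sup>2 / \<alpha>"
        using assms by (simp add: power2_eq_square)
      finally show ?thesis .
    qed
    moreover have "sqrt (2 * pi) / c = \<alpha> powr (-1/2)"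
      using assms by (simp add: c_def real_sqrt_mult powr_minus_divide powr_half_sqrt)
    moreover have "sqrt (2 * pi) *\<^sub>R (complex_of_real (exp (- (s\<^sup>2) / 2)) /\<^sub>R \<bar>c\<bar>)
        = complex_of_real ((sqrt (2 * pi) / c) * exp (- (s\<^sup>2 / 2)))"
      using c by (simp add: scaleR_conv_of_real divide_simps)
    ultimately show ?thesis by (simp only:)
  qed
  ultimately show ?thesis by simp
qed

lemma fourier_gaussian_0:
  fixes w :: "'a::euclidean_space"
  assumes "\<alpha> > 0"
  shows "has_bochner_integral lborel (\<lambda>t. gauss_exp \<alpha> t * ei (w \<bullet> t))
    (complex_of_real (\<alpha> powr (- (DIM('a) / 2)) * exp (- (pi * (w \<bullet> w) / \<alpha>))))"
proof -
  define f where "f b t = complex_of_real (exp (- (pi * \<alpha> * t\<^sup>2))) * ei ((w \<bullet> b) * t)" for b :: 'a and t :: real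
  have f_int: "integrable lborel (f b)"
    and f_val: "(\<integral>x. f b x \<partial>lborel) = complex_of_real (\<alpha> powr (-1/2) * exp (- (pi * (w \<bullet> b)\<^sup>2 / \<alpha>)))" for b
    using fourier_gaussian_1d[OF assms, of "w \<bullet> b"] unfolding has_bochner_integral_iff f_def [abs_def] by auto
  have eq: "(\<Prod>b\<in>Basis. f b (t \<bullet> b)) = gauss_exp \<alpha> t * ei (w \<bullet> t)" for t
  proof -
    have "(\<Prod>b\<in>Basis. f b (t \<bullet> b)) = exp (\<Sum>b\<in>Basis. complex_of_real (- (pi * \<alpha> * (t \<bullet> b)\<^sup>2)) + 2 * pi * \<i> * ((w \<bullet> b) * (t \<bullet> b)))"
      by (simp only: f_def exp_sum[OF finite_Basis] exp_add exp_of_real)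
    also have "(\<Sum>b\<in>Basis. complex_of_real (- (pi * \<alpha> * (t \<bullet> b)\<^sup>2)) + 2 * pi * \<i> * ((w \<bullet> b) * (t \<bullet> b)))
        = complex_of_real (- (pi * \<alpha> * (t \<bullet> t))) + 2 * pi * \<i> * (w \<bullet> t)"
    proof -
      have "(\<Sum>b\<in>Basis. (t \<bullet> b)\<^sup>2) = t \<bullet> t" "(\<Sum>b\<in>Basis. (w \<bullet> b) * (t \<bullet> b)) = w \<bullet> t"
        by (simp_all add: euclidean_inner[of t t] euclidean_inner[of w t] power2_eq_square)
      then show ?thesis
        by (simp only: sum.distrib sum_negf flip: sum_distrib_left of_real_sum of_real_mult)
    qed
    finally show ?thesis by (simp only: exp_add exp_of_real)
  qed
  have "(\<Prod>b\<in>(Basis :: 'a set). \<alpha> powr (-1/2)) = \<alpha> powr (- (DIM('a) / 2))"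
    using assms by (simp add: powr_power)
  moreover have "(\<Prod>b\<in>Basis. exp (- (pi * (w \<bullet> b)\<^sup>2 / \<alpha>))) = exp (- (pi * (w \<bullet> w) / \<alpha>))"
    by (simp add: euclidean_inner[of w w] power2_eq_square sum_distrib_left sum_divide_distrib sum_negf flip: exp_sum)
  ultimately have "(\<Prod>b\<in>Basis. \<integral>x. f b x \<partial>lborel) = complex_of_real (\<alpha> powr (- (DIM('a) / 2)) * exp (- (pi * (w \<bullet> w) / \<alpha>)))"
    by (simp only: f_val of_real_prod[symmetric] prod.distrib)
  then show ?thesis
    using integrable_lborel_prod[of f, OF f_int] integral_lborel_prod[of f, OF f_int]
    by (simp only: has_bochner_integral_iff eq)
qed

lemma fourier_gaussian:
  fixes w s :: "'a::euclidean_space"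
  assumes "\<alpha> > 0"
  shows "has_bochner_integral lborel (\<lambda>t. gauss_exp \<alpha> (t - s) * ei (w \<bullet> t))
    (\<alpha> powr (- (DIM('a) / 2)) * exp (- (pi * (w \<bullet> w) / \<alpha>)) * ei (w \<bullet> s))"
proof -
  have "has_bochner_integral (distr lborel borel (\<lambda>t. t - s)) (\<lambda>t. gauss_exp \<alpha> t * ei (w \<bullet> t))
    (complex_of_real (\<alpha> powr (- (DIM('a) / 2)) * exp (- (pi * (w \<bullet> w) / \<alpha>))))"
    unfolding lborel_distr_minus by (rule fourier_gaussian_0[OF assms])
  then have "has_bochner_integral lborel (\<lambda>t. gauss_exp \<alpha> (t - s) * ei (w \<bullet> (t - s)))
    (complex_of_real (\<alpha> powr (- (DIM('a) / 2)) * exp (- (pi * (w \<bullet> w) / \<alpha>))))"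
    by (simp add: has_bochner_integral_iff integrable_distr_eq integral_distr)
  then have "has_bochner_integral lborel (\<lambda>t. gauss_exp \<alpha> (t - s) * ei (w \<bullet> (t - s))
      * ei (w \<bullet> s))
    (complex_of_real (\<alpha> powr (- (DIM('a) / 2)) * exp (- (pi * (w \<bullet> w) / \<alpha>))) * ei (w \<bullet> s))"
    by (rule has_bochner_integral_mult_left)
  moreover have "ei (w \<bullet> (t - s)) * ei (w \<bullet> s) = ei (w \<bullet> t)" for t
    by (simp add: inner_diff_right algebra_simps flip: exp_add)
  ultimately show ?thesis by (simp only: mult.assoc of_real_mult)
qed

section \<open>The Gaussian short-time Fourier transform\<close>

text \<open>The function behind the class \<open>gaussian\<close>. Superpositions of shifts are
  evaluated pointwise and under integral signs, which a class does not permit.\<close>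

definition gauss :: "'a::euclidean_space \<Rightarrow> complex" where
  "gauss t = complex_of_real (exp (- pi * (t \<bullet> t)))"

lemma sq_integrable_gauss: "sq_integrable gauss"
  unfolding gauss_def [abs_def] by (rule sq_integrable_gaussian)

lemma norm_gauss: "cmod (gauss t) = exp (- pi * (t \<bullet> t))"
  by (simp add: gauss_def)

lemma norm_gauss_le_1: "cmod (gauss t) \<le> 1"
  by (simp add: norm_gauss)

lemma cnj_gauss: "cnj (gauss t) = gauss t"
  by (simp add: gauss_def)

lemma borel_measurable_gauss [measurable]: "gauss \<in> borel_measurable (borel :: 'a::euclidean_space measure)"
  using sq_integrable_gauss[where 'a = 'a] by (simp add: sq_integrable_def)

definition stft :: "'a::euclidean_space l2 \<Rightarrow> 'a \<times> 'a \<Rightarrow> complex" where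
  "stft f z = cinner_l2 f (tf_l2 z gaussian)"

lemma gaussian_abs: "gaussian = abs_l2 gauss"
  by (simp add: gaussian_def gauss_def [abs_def])

lemma tf_l2_abs: "sq_integrable F \<Longrightarrow> tf_l2 z (abs_l2 F) = abs_l2 (tf_fun z F)"
  by (simp add: tf_l2.abs_eq l2_rel_refl)

lemma tf_l2_gaussian: "tf_l2 z gaussian = abs_l2 (tf_fun z gauss)"
  by (simp add: gaussian_abs tf_l2_abs sq_integrable_gauss)

lemmas sq_integrable_tf_gauss = sq_integrable_tf_fun[OF sq_integrable_gauss]

lemma stft_abs:
  "sq_integrable F \<Longrightarrow> stft (abs_l2 F) z = (\<integral>t. F t * cnj (tf_fun z gauss t) \<partial>lborel)"
  by (simp add: stft_def tf_l2_gaussian cinner_l2_abs sq_integrable_tf_gauss)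

lemma stft_add: "stft (f + g) z = stft f z + stft g z"
  by (simp add: stft_def cinner_l2_add_left)

lemma stft_diff: "stft (f - g) z = stft f z - stft g z"
  by (simp add: stft_def cinner_l2_diff_left)

lemma stft_cscale: "stft (cscale_l2 c f) z = c * stft f z"
  by (simp add: stft_def cinner_l2_cscale_left)

lemma measurable_tf_gauss:
  "(\<lambda>(z, t). tf_fun z gauss t) \<in> borel_measurable (borel \<Otimes>\<^sub>M (borel :: 'a::euclidean_space measure))"
proof -
  have "continuous_on UNIV (\<lambda>p :: ('a \<times> 'a) \<times> 'a. ei (snd (fst p) \<bullet> snd p) * gauss (snd p - fst (fst p)))"
    unfolding gauss_def by (intro continuous_intros)
  then have "(\<lambda>p :: ('a \<times> 'a) \<times> 'a. ei (snd (fst p) \<bullet> snd p) * gauss (snd p - fst (fst p))) \<in> borel_measurable borel"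
    by (rule borel_measurable_continuous_onI)
  then show ?thesis
    by (simp add: tf_fun_def case_prod_unfold borel_prod)
qed

lemma borel_measurable_stft [measurable]: "stft f \<in> borel_measurable borel"
proof -
  obtain F where F: "sq_integrable F" "f = abs_l2 F" by (rule l2_obtain)
  note [measurable] = measurable_tf_gauss
  have [measurable]: "F \<in> borel_measurable borel" using F by (simp add: sq_integrable_def)
  have "(\<lambda>z. \<integral>t. F t * cnj (tf_fun z gauss t) \<partial>lborel) \<in> borel_measurable borel"
    by measurable
  then show ?thesis using F by (simp add: stft_abs cong: measurable_cong)
qed

lemma norm_stft_le: "cmod (stft f z) \<le> norm f * norm (gaussian :: 'a l2)" for f :: "'a::euclidean_space l2"
  unfolding stft_def by (metis norm_cinner_l2_le norm_tf_l2)

text \<open>By completing the square, \<phi>(t)\<phi>(t - x) is a Gaussian of doubled rate centred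
  at the midpoint x/2, times a Gaussian in x. The midpoint is the origin of the phase in the
  formula.\<close>

lemma stft_gaussian:
  fixes z :: "'a::euclidean_space \<times> 'a"
  shows "stft gaussian z = complex_of_real (2 powr (- (DIM('a) / 2)) * exp (- (pi / 2 * (z \<bullet> z))))
    * exp (- (pi * \<i> * (fst z \<bullet> snd z)))"
proof -
  define x w where "x = fst z" and "w = snd z"
  have z: "z \<bullet> z = x \<bullet> x + w \<bullet> w" by (simp add: x_def w_def inner_prod_def)
  have h: "gauss t * cnj (tf_fun z gauss t) =
      exp (- (pi / 2 * (x \<bullet> x))) * (gauss_exp 2 (t - x /\<^sub>R 2) * ei ((- w) \<bullet> t))" for t
  proof -
    have "(- pi * (t \<bullet> t)) + (- pi * ((t - x) \<bullet> (t - x))) = - (pi / 2 * (x \<bullet> x)) + (- (pi * 2 * ((t - x /\<^sub>R 2) \<bullet> (t - x /\<^sub>R 2))))"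
      by (simp add: inner_diff_left inner_diff_right inner_commute[of x t] algebra_simps)
    then have "gauss t * gauss (t - x) = complex_of_real (exp (- (pi / 2 * (x \<bullet> x))) * gauss_exp 2 (t - x /\<^sub>R 2))"
      by (simp only: gauss_def of_real_mult[symmetric] exp_add[symmetric])
    moreover have "cnj (ei (w \<bullet> t)) = ei ((- w) \<bullet> t)"
      by (simp add: exp_cnj)
    ultimately show ?thesis
      unfolding tf_fun_def x_def[symmetric] w_def[symmetric]
      by (simp only: complex_cnj_mult cnj_gauss mult.assoc of_real_mult mult.left_commute[of "gauss t"])
        (simp only: mult_ac)
  qed
  have "has_bochner_integral lborel (\<lambda>t. gauss t * cnj (tf_fun z gauss t))
    (exp (- (pi / 2 * (x \<bullet> x))) * (2 powr (- (DIM('a) / 2)) * exp (- (pi * ((- w) \<bullet> (- w)) / 2)) * ei ((- w) \<bullet> (x /\<^sub>R 2))))"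
    unfolding h by (intro has_bochner_integral_mult_right fourier_gaussian) simp
  then have "stft gaussian z = exp (- (pi / 2 * (x \<bullet> x))) * (2 powr (- (DIM('a) / 2)) * exp (- (pi * ((- w) \<bullet> (- w)) / 2)) * ei ((- w) \<bullet> (x /\<^sub>R 2)))"
    by (simp add: gaussian_abs stft_abs sq_integrable_gauss has_bochner_integral_iff)
  also have "\<dots> = complex_of_real (2 powr (- (DIM('a) / 2)) * (exp (- (pi / 2 * (x \<bullet> x))) * exp (- (pi / 2 * (w \<bullet> w))))) * exp (- (pi * \<i> * (x \<bullet> w)))"
    by (simp add: inner_commute[of w x] mult_ac)
  also have "exp (- (pi / 2 * (x \<bullet> x))) * exp (- (pi / 2 * (w \<bullet> w))) = exp (- (pi / 2 * (z \<bullet> z)))"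
    unfolding z exp_add[symmetric] by (simp add: algebra_simps)
  finally show ?thesis by (simp add: x_def w_def)
qed

lemma norm_stft_gaussian:
  "cmod (stft gaussian z) = 2 powr (- (DIM('a) / 2)) * exp (- (pi / 2 * (z \<bullet> z)))"
  for z :: "'a::euclidean_space \<times> 'a"
  unfolding stft_gaussian by (simp add: norm_mult norm_exp_eq_Re)

lemma tf_l2_diff_index: "tf_l2 z f = cscale_l2 (cnj (twist a (z - a))) (tf_l2 a (tf_l2 (z - a) f))"
  by (simp add: tf_l2_tf_l2 cscale_l2_cscale_l2 mult.commute[of "cnj _"])

lemma stft_tf_l2_gaussian:
  "stft (tf_l2 a gaussian) z = twist a (z - a) * stft gaussian (z - a)"
  unfolding stft_def
  by (subst tf_l2_diff_index[of z _ a]) (simp add: cinner_l2_cscale_right cinner_tf_l2_tf_l2)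

lemma norm_stft_tf_gaussian:
  "cmod (stft (tf_l2 a gaussian) z) = 2 powr (- (DIM('a) / 2)) * exp (- (pi / 2 * ((z - a) \<bullet> (z - a))))"
  for z :: "'a::euclidean_space \<times> 'a"
  unfolding stft_tf_l2_gaussian by (simp add: norm_mult norm_stft_gaussian)

lemma integrable_gauss:
  fixes s :: "'a::euclidean_space"
  assumes "\<alpha> > 0"
  shows "integrable lborel (\<lambda>t. gauss_exp \<alpha> (t - s))"
proof -
  have "complex_integrable lborel (\<lambda>t. complex_of_real (gauss_exp \<alpha> (t - s)))"
    using fourier_gaussian[OF assms, of s 0] by (simp add: has_bochner_integral_iff)
  from integrable_Re[OF this] show ?thesis by simp
qed

lemma norm_tf_gauss_le_1: "cmod (tf_fun z gauss t) \<le> 1"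
  by (simp add: cmod_tf_fun norm_gauss_le_1)

lemma borel_measurable_tf_gauss_index [measurable]:
  "(\<lambda>z. tf_fun z gauss t) \<in> borel_measurable borel"
  using measurable_compose[OF _ measurable_tf_gauss, of "\<lambda>z. (z, t)" borel] by simp

text \<open>The frequency integral is a Fourier transform of a Gaussian of rate 1/2. Its constant
  cancels that of \<open>stft gaussian\<close>, and the exponents combine to a Gaussian of rate 2 in
  \<open>x - t\<close> times \<open>gauss t\<close>. The remaining factor is the squared norm of the
  window.\<close>

lemma gauss_reproducing_0:
  fixes t :: "'a::euclidean_space"
  shows "has_bochner_integral lborel (\<lambda>z. stft gaussian z * tf_fun z gauss t) (2 powr (- (DIM('a) / 2)) * gauss t)"
proof -
  let ?d = "DIM('a) / 2"
  let ?h = "\<lambda>z. stft gaussian z * tf_fun z gauss t"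
  have int: "integrable lborel ?h"
  proof (rule Bochner_Integration.integrable_bound)
    show "integrable lborel (\<lambda>z :: 'a \<times> 'a. 2 powr (- ?d) * gauss_exp (1/2) (z - 0))"
      by (intro integrable_mult_right integrable_gauss) simp
    show "AE z in lborel. norm (?h z) \<le> norm (2 powr (- ?d) * gauss_exp (1/2) (z - 0))"
      using norm_tf_gauss_le_1 by (intro AE_I2) (simp add: norm_mult norm_stft_gaussian mult_left_le)
  qed measurable
  have split: "?h (x, w) = (2 powr (- ?d) * exp (- (pi / 2 * (x \<bullet> x)) - pi * ((t - x) \<bullet> (t - x))))
      * (gauss_exp (1/2) (w - 0) * ei ((t - x /\<^sub>R 2) \<bullet> w))" for x w
  proof -
    have "exp (- (pi * \<i> * (x \<bullet> w))) * ei (w \<bullet> t) = ei ((t - x /\<^sub>R 2) \<bullet> w)"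
      by (simp add: inner_diff_left inner_commute[of w t] algebra_simps flip: exp_add)
    moreover have "exp (- (pi / 2 * ((x, w) \<bullet> (x, w)))) * exp (- pi * ((t - x) \<bullet> (t - x)))
        = exp (- (pi / 2 * (x \<bullet> x)) - pi * ((t - x) \<bullet> (t - x))) * gauss_exp (1/2) (w - 0)"
      unfolding exp_add[symmetric] by (simp add: inner_prod_def algebra_simps)
    moreover have "(complex_of_real (p * A) * E) * (E' * complex_of_real B) = complex_of_real (p * C) * (complex_of_real D * E3)"
      if "E * E' = E3" "A * B = C * D" for p A B C D :: real and E E' E3 :: complex
    proof -
      have "(complex_of_real (p * A) * E) * (E' * complex_of_real B) = complex_of_real p * complex_of_real (A * B) * (E * E')"
        by simp
      also have "\<dots> = complex_of_real (p * C) * (complex_of_real D * E3)"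
        unfolding that by simp
      finally show ?thesis .
    qed
    ultimately show ?thesis
      unfolding stft_gaussian tf_fun_def gauss_def fst_conv snd_conv by blast
  qed
  have inner: "(\<integral>w. ?h (x, w) \<partial>lborel) = exp (- pi * (t \<bullet> t)) * gauss_exp 2 (x - t)" for x
  proof -
    have "(\<integral>w. ?h (x, w) \<partial>lborel) = (2 powr (- ?d) * exp (- (pi / 2 * (x \<bullet> x)) - pi * ((t - x) \<bullet> (t - x))))
      * ((1/2) powr (- ?d) * exp (- (pi * ((t - x /\<^sub>R 2) \<bullet> (t - x /\<^sub>R 2)) / (1/2))) * ei ((t - x /\<^sub>R 2) \<bullet> 0))"
      unfolding split
      using fourier_gaussian[of "1/2" 0 "t - x /\<^sub>R 2"] by (simp only: integral_mult_right_zero has_bochner_integral_iff)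
    also have "\<dots> = complex_of_real ((2 powr (- ?d) * (1/2) powr (- ?d)) * (exp (- (pi / 2 * (x \<bullet> x)) - pi * ((t - x) \<bullet> (t - x))) * exp (- (pi * ((t - x /\<^sub>R 2) \<bullet> (t - x /\<^sub>R 2)) / (1/2)))))"
      by (simp add: mult_ac)
    also have "2 powr (- ?d) * (1/2) powr (- ?d) = 1"
      by (simp flip: powr_mult)
    also have "exp (- (pi / 2 * (x \<bullet> x)) - pi * ((t - x) \<bullet> (t - x))) * exp (- (pi * ((t - x /\<^sub>R 2) \<bullet> (t - x /\<^sub>R 2)) / (1/2)))
      = exp (- pi * (t \<bullet> t)) * gauss_exp 2 (x - t)"
      unfolding exp_add[symmetric]
      by (simp add: inner_diff_left inner_diff_right inner_commute[of x t] algebra_simps)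
    finally show ?thesis by simp
  qed
  have "(\<integral>z. ?h z \<partial>lborel) = (\<integral>x. \<integral>w. ?h (x, w) \<partial>lborel \<partial>lborel)"
    using int unfolding lborel_prod[symmetric] by (rule lborel_pair.integral_fst'[symmetric])
  also have "\<dots> = exp (- pi * (t \<bullet> t)) * complex_of_real (2 powr (- ?d))"
    using fourier_gaussian[of 2 t 0] by (simp add: inner has_bochner_integral_iff)
  finally show ?thesis
    using int by (simp add: has_bochner_integral_iff gauss_def mult.commute)
qed

text \<open>Covariance: the formula for the unshifted Gaussian is translated by \<open>a\<close> in
  phase space. The cocycle from shifting the transform is the one produced by composing the
  shifts.\<close>

lemma gauss_reproducing:
  fixes t :: "'a::euclidean_space"
  shows "has_bochner_integral lborel (\<lambda>z. stft (tf_l2 a gaussian) z * tf_fun z gauss t)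
    (2 powr (- (DIM('a) / 2)) * tf_fun a gauss t)"
proof -
  let ?h = "\<lambda>z. stft (tf_l2 a gaussian) z * tf_fun z gauss t"
  have "has_bochner_integral (distr lborel borel (\<lambda>z. z - a)) (\<lambda>z. ei (snd a \<bullet> t) * (stft gaussian z * tf_fun z gauss (t - fst a)))
     (ei (snd a \<bullet> t) * (2 powr (- (DIM('a) / 2)) * gauss (t - fst a)))"
    unfolding lborel_distr_minus by (intro has_bochner_integral_mult_right gauss_reproducing_0)
  then have "has_bochner_integral lborel (\<lambda>z. ei (snd a \<bullet> t) * (stft gaussian (z - a) * tf_fun (z - a) gauss (t - fst a)))
     (ei (snd a \<bullet> t) * (2 powr (- (DIM('a) / 2)) * gauss (t - fst a)))"
    by (simp add: has_bochner_integral_iff integrable_distr_eq integral_distr)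
  moreover have "ei (snd a \<bullet> t) * (stft gaussian (z - a) * tf_fun (z - a) gauss (t - fst a)) = ?h z" for z
  proof -
    have "ei (snd a \<bullet> t) * tf_fun (z - a) gauss (t - fst a) = twist a (z - a) * tf_fun z gauss t"
      by (simp add: tf_fun_def twist_def algebra_simps inner_commute[of "fst a" "snd z"] inner_commute[of "fst a" "snd a"] flip: exp_add)
    then show ?thesis by (simp add: stft_tf_l2_gaussian)
  qed
  moreover have "ei (snd a \<bullet> t) * (2 powr (- (DIM('a) / 2)) * gauss (t - fst a))
      = 2 powr (- (DIM('a) / 2)) * tf_fun a gauss t"
    by (simp add: tf_fun_def)
  ultimately show ?thesis by (simp only:)
qed

section \<open>Injectivity of the Fourier and short-time Fourier transforms\<close>

text \<open>The closed sets are an intersection-stable generator of the Borel sets, and the sets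
  over which \<open>f\<close> has integral 0 are stable under complements and disjoint countable
  unions.\<close>

lemma AE_eq_0_if_integral_closed_eq_0:
  fixes f :: "'a::euclidean_space \<Rightarrow> complex"
  assumes f: "integrable lborel f"
    and zero: "\<And>C. closed C \<Longrightarrow> (LINT x:C|lborel. f x) = 0"
  shows "AE x in lborel. f x = 0"
proof -
  have set_int: "set_integrable lborel A f" if "A \<in> sets borel" for A
    unfolding set_integrable_def using f that by (intro integrable_mult_indicator) auto
  have all: "(LINT x:A|lborel. f x) = 0" if "A \<in> sets borel" for A
  proof -
    have eq: "sigma_sets UNIV (Collect closed) = sets (borel :: 'a measure)"
      unfolding borel_eq_closed by (rule sets_measure_of [symmetric]) simp
    have "Int_stable (Collect closed :: 'a set set)" by (auto simp: Int_stable_def)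
    moreover have "Collect closed \<subseteq> Pow (UNIV :: 'a set)" by simp
    moreover have "A \<in> sigma_sets UNIV (Collect closed)" using that eq by simp
    ultimately show ?thesis
    proof (induction rule: sigma_sets_induct_disjoint)
      case (compl A)
      then have "A \<in> sets borel" using eq by simp
      have "(LINT x:UNIV|lborel. f x) = (LINT x:A \<union> (UNIV - A)|lborel. f x)"
        by (simp add: Un_Diff_cancel)
      also have "\<dots> = (LINT x:A|lborel. f x) + (LINT x:UNIV - A|lborel. f x)"
        using \<open>A \<in> sets borel\<close> by (intro set_integral_Un set_int) auto
      finally show ?case using compl zero[of UNIV] by simp
    next
      case (union A)
      then have A: "A i \<in> sets borel" for i using eq by auto
      have "(LINT x:(\<Union>i. A i)|lborel. f x) = (\<Sum>i. LINT x:A i|lborel. f x)"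
        using union(1) A by (intro lebesgue_integral_countable_add set_int) (auto simp: disjoint_family_on_def)
      then show ?case using union by simp
    next
      case (basic A)
      then show ?case by (simp add: zero)
    qed (simp add: set_lebesgue_integral_def)
  qed
  then show ?thesis by (intro sigma_finite_measure.density_zero[OF sigma_finite_lborel] f) simp
qed

lemma integral_gauss:
  fixes s :: "'a::euclidean_space"
  assumes "\<alpha> > 0"
  shows "(\<integral>t. gauss_exp \<alpha> (t - s) \<partial>lborel) = \<alpha> powr (- (DIM('a) / 2))"
proof -
  have "complex_of_real (\<integral>t. gauss_exp \<alpha> (t - s) \<partial>lborel)
    = (\<integral>t. complex_of_real (gauss_exp \<alpha> (t - s)) \<partial>lborel)"
    by (simp only: integral_complex_of_real)
  also have "\<dots> = complex_of_real (\<alpha> powr (- (DIM('a) / 2)))"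
    using fourier_gaussian[OF assms, of s 0] by (simp add: has_bochner_integral_iff)
  finally show ?thesis by (simp only: of_real_eq_iff)
qed

text \<open>A Gaussian of rate \<open>\<alpha>\<close> is a multiple of the Fourier transform of one
  of rate \<open>1 / \<alpha>\<close>. By Fubini its pairing with \<open>G\<close> is therefore a
  superposition of the vanishing Fourier integrals of \<open>G\<close>.\<close>

lemma integral_gauss_convolution_eq_0:
  fixes G :: "'a::euclidean_space \<Rightarrow> complex"
  assumes G: "integrable lborel G"
    and zero: "\<And>w. (\<integral>t. G t * ei (w \<bullet> t) \<partial>lborel) = 0"
    and "\<alpha> > 0"
  shows "(\<integral>t. G t * gauss_exp \<alpha> (t - s) \<partial>lborel) = 0"
proof -
  define \<beta> where "\<beta> = 1 / \<alpha>"
  have \<beta>: "\<beta> > 0" using assms by (simp add: \<beta>_def)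
  have [measurable]: "G \<in> borel_measurable borel" using G by (auto dest: borel_measurable_integrable)
  let ?E = "\<lambda>w t. gauss_exp \<beta> (w - 0) * ei ((t - s) \<bullet> w)"
  have int: "integrable (lborel \<Otimes>\<^sub>M lborel) (\<lambda>(t, w). G t * ?E w t)"
  proof (rule lborel_pair.Fubini_integrable)
    show "(\<lambda>(t, w). G t * ?E w t) \<in> borel_measurable (lborel \<Otimes>\<^sub>M lborel)" by measurable
    have "(\<integral>w. norm (case (t, w) of (t, w) \<Rightarrow> G t * ?E w t) \<partial>lborel) = cmod (G t) * (\<integral>w. exp (- (pi * \<beta> * ((w - 0 :: 'a) \<bullet> (w - 0)))) \<partial>lborel)" for t
      by (simp add: norm_mult norm_exp_eq_Re)
    then show "integrable lborel (\<lambda>t. \<integral>w. norm (case (t, w) of (t, w) \<Rightarrow> G t * ?E w t) \<partial>lborel)"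
      using G by simp
    show "AE t in lborel. integrable lborel (\<lambda>w. case (t, w) of (t, w) \<Rightarrow> G t * ?E w t)"
      using fourier_gaussian[OF \<beta>, of "0 :: 'a"]
      by (intro AE_I2) (simp only: has_bochner_integral_iff prod.case integrable_mult_right)
  qed
  have "(\<integral>w. \<integral>t. G t * ?E w t \<partial>lborel \<partial>lborel) = (\<integral>t. \<integral>w. G t * ?E w t \<partial>lborel \<partial>lborel)"
    by (rule lborel_pair.Fubini_integral) (use int in simp)
  moreover have "(\<integral>t. G t * ?E w t \<partial>lborel) = 0" for w
  proof -
    have "G t * ?E w t = (gauss_exp \<beta> (w - 0) * exp (- (2 * pi * \<i> * (s \<bullet> w)))) * (G t * ei (w \<bullet> t))" for t
      by (simp add: inner_diff_left inner_commute[of t w] right_diff_distrib exp_diff exp_minus divide_inverse)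
    then show ?thesis by (simp only: integral_mult_right_zero zero mult_zero_right)
  qed
  moreover have "(\<integral>w. G t * ?E w t \<partial>lborel) = \<beta> powr (- (DIM('a) / 2)) * (G t * gauss_exp \<alpha> (t - s))" for t
  proof -
    have "(\<integral>w. ?E w t \<partial>lborel) = \<beta> powr (- (DIM('a) / 2)) * exp (- (pi * ((t - s) \<bullet> (t - s)) / \<beta>)) * ei ((t - s) \<bullet> 0)"
      using fourier_gaussian[OF \<beta>, of 0 "t - s"] by (simp only: has_bochner_integral_iff)
    then show ?thesis by (simp add: \<beta>_def mult_ac)
  qed
  ultimately have "complex_of_real (\<beta> powr (- (DIM('a) / 2))) * (\<integral>t. G t * gauss_exp \<alpha> (t - s) \<partial>lborel) = 0"
    by (simp only: integral_mult_right_zero Bochner_Integration.integral_zero)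
  then show ?thesis using \<beta> by (simp only: mult_eq_0_iff of_real_eq_0_iff powr_eq_0_iff) auto
qed

text \<open>Averaging a Lipschitz function against a narrow Gaussian changes it uniformly little.\<close>

lemma integral_lipschitz_eq_0:
  fixes G :: "'a::euclidean_space \<Rightarrow> complex" and h :: "'a \<Rightarrow> real"
  assumes G: "integrable lborel G"
    and zero: "\<And>w. (\<integral>t. G t * ei (w \<bullet> t) \<partial>lborel) = 0"
    and lip: "\<And>x y. \<bar>h x - h y\<bar> \<le> L * norm (x - y)" and bd: "\<And>x. \<bar>h x\<bar> \<le> 1"
  shows "(\<integral>t. G t * h t \<partial>lborel) = 0"
proof -
  have Lxy: "0 \<le> L * norm (x - y)" for x y :: 'a
    using lip[of x y] by (rule order_trans[OF abs_ge_zero])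
  have L: "L \<ge> 0"
    using Lxy[of "SOME b. b \<in> Basis" 0] SOME_Basis by (simp add: zero_le_mult_iff)
  have "(L)-lipschitz_on UNIV h"
    using lip L by (intro lipschitz_onI) (auto simp: dist_norm)
  then have [measurable]: "h \<in> borel_measurable borel"
    by (intro borel_measurable_continuous_onI lipschitz_on_continuous_on)
  have [measurable]: "G \<in> borel_measurable borel" using G by (auto dest: borel_measurable_integrable)
  define C where "C = L * 2 powr (DIM('a) / 2) * (\<integral>t. cmod (G t) \<partial>lborel)"
  have Gh: "integrable lborel (\<lambda>t. G t * complex_of_real (h t))"
    by (rule Bochner_Integration.integrable_bound[OF G]) (use bd in \<open>auto simp: norm_mult mult_left_le\<close>)
  have bound: "cmod (\<integral>t. G t * h t \<partial>lborel) * k \<le> C" if "k > 0" for k :: real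
  proof -
    \<comment> \<open>The kernel lives at scale \<open>1 / k\<close>, so averaging changes
      \<open>h\<close> by a multiple of \<open>L / k\<close>. The constant \<open>C\<close> fixed
      above does not depend on \<open>k\<close>.\<close>
    define \<alpha> where "\<alpha> = k\<^sup>2"
    have \<alpha>: "\<alpha> > 0" "\<alpha> / 2 > 0" using that by (simp_all add: \<alpha>_def)
    define c where "c = \<alpha> powr (DIM('a) / 2)"
    define K where "K s t = c * gauss_exp \<alpha> (s - t)" for s t :: 'a
    have c: "c > 0" using \<alpha> by (simp add: c_def)
    have K0: "K s t \<ge> 0" for s t using c by (simp add: K_def)
    have Ki: "integrable lborel (\<lambda>s. K s t)" for t
      unfolding K_def by (intro integrable_mult_right integrable_gauss \<alpha>)
    have K1: "(\<integral>s. K s t \<partial>lborel) = 1" for t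
      using c \<alpha> by (simp add: K_def integral_gauss c_def powr_minus)
    have hKi: "integrable lborel (\<lambda>s. h s * K s t)" for t
      by (rule Bochner_Integration.integrable_bound[OF Ki[of t]])
        (use bd K0 in \<open>auto simp: abs_mult mult_left_le_one_le K_def\<close>)
    define H where "H t = (\<integral>s. h s * K s t \<partial>lborel)" for t
    have [measurable]: "H \<in> borel_measurable borel"
      unfolding H_def K_def by measurable
    have near: "\<bar>h t - H t\<bar> \<le> L * 2 powr (DIM('a) / 2) / k" for t
    proof -
      have le: "\<bar>h t * K s t - h s * K s t\<bar> \<le> (L * c / k) * gauss_exp (\<alpha> / 2) (s - t)" for s
      proof -
        \<comment> \<open>The factor \<open>y\<close> from the Lipschitz bound is absorbed by half
          of the Gaussian exponent. This is why the majorant has rate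
          \<open>\<alpha> / 2\<close>.\<close>
        define y where "y = k * norm (s - t)"
        have y: "\<alpha> * ((s - t) \<bullet> (s - t)) = y\<^sup>2"
          by (simp add: y_def \<alpha>_def power_mult_distrib power2_norm_eq_inner)
        have "y \<le> 1 + y\<^sup>2"
          using zero_le_power2[of "y - 1"] zero_le_power2[of y] unfolding power2_diff power_one mult_1_right by linarith
        also have "\<dots> \<le> 1 + pi * y\<^sup>2 / 2"
          using pi_gt3 mult_right_mono[of 2 pi "y\<^sup>2"] by simp
        also have "\<dots> \<le> exp (pi * y\<^sup>2 / 2)" by (rule exp_ge_add_one_self)
        finally have "y * exp (- (pi * y\<^sup>2)) \<le> exp (pi * y\<^sup>2 / 2) * exp (- (pi * y\<^sup>2))"
          by (rule mult_right_mono) simp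
        also have "\<dots> = exp (- (pi * y\<^sup>2 / 2))"
          unfolding exp_add[symmetric] by (simp add: field_simps)
        finally have ye: "y * exp (- (pi * y\<^sup>2)) \<le> exp (- (pi * y\<^sup>2 / 2))" .
        have "\<bar>h t * K s t - h s * K s t\<bar> = \<bar>h s - h t\<bar> * K s t"
          using K0[of s t] by (simp add: abs_mult abs_minus_commute flip: left_diff_distrib)
        also have "\<dots> \<le> (L * norm (s - t)) * K s t"
          by (intro mult_right_mono lip K0)
        also have "\<dots> = (L * c / k) * (y * exp (- (pi * y\<^sup>2)))"
          using that by (simp add: K_def mult.assoc[of pi] y) (simp add: y_def)
        also have "\<dots> \<le> (L * c / k) * exp (- (pi * y\<^sup>2 / 2))"
          using L c that by (intro mult_left_mono ye) auto
        finally show ?thesis by (simp flip: y) (simp add: mult_ac)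
      qed
      have "h t - H t = (\<integral>s. h t * K s t - h s * K s t \<partial>lborel)"
        using Ki hKi by (simp add: H_def K1)
      also have "\<bar>\<dots>\<bar> \<le> (\<integral>s. (L * c / k) * gauss_exp (\<alpha> / 2) (s - t) \<partial>lborel)"
        using Ki hKi le integrable_gauss[OF \<alpha>(2), of t]
        by (intro integral_abs_bound_integral) auto
      also have "\<dots> = (L * c / k) * (\<alpha> / 2) powr (- (DIM('a) / 2))"
        using integral_gauss[OF \<alpha>(2), of t] by simp
      also have "c * (\<alpha> / 2) powr (- (DIM('a) / 2)) = 2 powr (DIM('a) / 2)"
        using \<alpha> by (simp add: c_def powr_divide powr_minus)
      then have "(L * c / k) * (\<alpha> / 2) powr (- (DIM('a) / 2)) = L * 2 powr (DIM('a) / 2) / k"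
        by (simp add: mult.assoc)
      finally show ?thesis .
    qed
    have int: "integrable (lborel \<Otimes>\<^sub>M lborel) (\<lambda>(t, s). G t * complex_of_real (h s * K s t))"
    proof (rule lborel_pair.Fubini_integrable)
      show "(\<lambda>(t, s). G t * complex_of_real (h s * K s t)) \<in> borel_measurable (lborel \<Otimes>\<^sub>M lborel)"
        unfolding K_def by measurable
      have "cmod (G t) * (\<integral>s. \<bar>h s * K s t\<bar> \<partial>lborel) \<le> cmod (G t)" for t
      proof -
        have "(\<integral>s. \<bar>h s * K s t\<bar> \<partial>lborel) \<le> (\<integral>s. K s t \<partial>lborel)"
          using bd K0 by (intro integral_mono integrable_abs hKi Ki) (simp add: abs_mult mult_left_le_one_le)
        then show ?thesis using mult_left_mono[of _ 1 "cmod (G t)"] by (simp add: K1)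
      qed
      moreover have "0 \<le> cmod (G t) * (\<integral>s. \<bar>h s * K s t\<bar> \<partial>lborel)" for t
        by simp
      moreover have "(\<lambda>t. cmod (G t) * (\<integral>s. \<bar>h s * K s t\<bar> \<partial>lborel)) \<in> borel_measurable lborel"
        unfolding K_def by measurable
      ultimately show "integrable lborel (\<lambda>t. \<integral>s. norm (case (t, s) of (t, s) \<Rightarrow> G t * complex_of_real (h s * K s t)) \<partial>lborel)"
        by (intro Bochner_Integration.integrable_bound[OF integrable_norm[OF G]])
          (auto simp: norm_mult abs_mult simp del: of_real_mult)
      show "AE t in lborel. integrable lborel (\<lambda>s. case (t, s) of (t, s) \<Rightarrow> G t * complex_of_real (h s * K s t))"
        using hKi by (auto simp del: of_real_mult)
    qed
    have inner0: "(\<integral>t. G t * complex_of_real (h s * K s t) \<partial>lborel) = 0" for s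
    proof -
      have "G t * complex_of_real (h s * K s t) = complex_of_real (h s * c) * (G t * gauss_exp \<alpha> (t - s))" for t
        by (simp add: K_def inner_diff_left inner_diff_right inner_commute[of s t] mult_ac)
      then show ?thesis
        using integral_gauss_convolution_eq_0[OF G zero \<alpha>(1), of s] by (simp only: integral_mult_right_zero mult_zero_right)
    qed
    have "(\<integral>t. G t * complex_of_real (H t) \<partial>lborel) = (\<integral>t. \<integral>s. G t * complex_of_real (h s * K s t) \<partial>lborel \<partial>lborel)"
      by (simp add: H_def del: of_real_mult flip: integral_complex_of_real)
    also have "\<dots> = (\<integral>s. \<integral>t. G t * complex_of_real (h s * K s t) \<partial>lborel \<partial>lborel)"
      by (rule lborel_pair.Fubini_integral[symmetric]) (rule int)
    finally have GH0: "(\<integral>t. G t * complex_of_real (H t) \<partial>lborel) = 0"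
      by (simp only: inner0 Bochner_Integration.integral_zero)
    have GH: "integrable lborel (\<lambda>t. G t * complex_of_real (H t))"
      using lborel_pair.integrable_fst[OF int] by (simp add: H_def del: of_real_mult flip: integral_complex_of_real)
    have "(\<integral>t. G t * h t \<partial>lborel) = (\<integral>t. G t * complex_of_real (h t) - G t * complex_of_real (H t) \<partial>lborel)"
      using Gh GH GH0 by simp
    also have "cmod \<dots> \<le> (\<integral>t. cmod (G t) * (L * 2 powr (DIM('a) / 2) / k) \<partial>lborel)"
    proof (intro Bochner_Integration.integral_norm_bound_integral)
      fix t
      have "cmod (G t * complex_of_real (h t) - G t * complex_of_real (H t)) = cmod (G t) * \<bar>h t - H t\<bar>"
        by (simp add: norm_mult flip: right_diff_distrib of_real_diff)
      also have "\<dots> \<le> cmod (G t) * (L * 2 powr (DIM('a) / 2) / k)"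
        by (intro mult_left_mono near) simp
      finally show "cmod (G t * complex_of_real (h t) - G t * complex_of_real (H t)) \<le> \<dots>" .
    qed (use G Gh GH in auto)
    also have "\<dots> = C / k" by (simp add: C_def)
    finally show ?thesis using that by (simp add: field_simps)
  qed
  show ?thesis
  proof (rule ccontr)
    assume *: "(\<integral>t. G t * h t \<partial>lborel) \<noteq> 0"
    define x where "x = cmod (\<integral>t. G t * h t \<partial>lborel)"
    have "x > 0" using * by (simp add: x_def)
    moreover have "0 \<le> C" using L by (auto simp: C_def)
    \<comment> \<open>For \<open>k = C / x + 1\<close> the left side is \<open>C + x\<close>, which
      exceeds \<open>C\<close>.\<close>
    ultimately have "x * (C / x + 1) \<le> C"
      unfolding x_def by (intro bound) (auto intro: add_nonneg_pos)
    then show False using \<open>x > 0\<close> by (simp add: distrib_left)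
  qed
qed

text \<open>The indicator of a nonempty closed set is the limit of the Lipschitz functions
  \<open>max 0 (1 - n * infdist x C)\<close>. Dominated convergence carries the vanishing of the
  pairings over to closed sets, which suffices.\<close>

lemma fourier_eq_0_imp_AE_eq_0:
  fixes G :: "'a::euclidean_space \<Rightarrow> complex"
  assumes G: "integrable lborel G"
    and zero: "\<And>w. (\<integral>t. G t * ei (w \<bullet> t) \<partial>lborel) = 0"
  shows "AE t in lborel. G t = 0"
proof (rule AE_eq_0_if_integral_closed_eq_0[OF G])
  fix C :: "'a set"
  assume C: "closed C"
  have [measurable]: "G \<in> borel_measurable borel" using G by (auto dest: borel_measurable_integrable)
  show "(LINT x:C|lborel. G x) = 0"
  proof (cases "C = {}")
    case False
    define h where "h n x = max 0 (1 - real n * infdist x C)" for n x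
    have "(\<integral>t. G t * complex_of_real (h n t) \<partial>lborel) = 0" for n
    proof (rule integral_lipschitz_eq_0[OF G zero])
      fix x y
      have "\<bar>infdist x C - infdist y C\<bar> \<le> norm (x - y)"
        using infdist_triangle_abs[of x C y] by (simp add: dist_norm)
      then have "\<bar>real n * infdist x C - real n * infdist y C\<bar> \<le> real n * norm (x - y)"
        by (simp add: abs_mult mult_left_mono flip: right_diff_distrib)
      then show "\<bar>h n x - h n y\<bar> \<le> real n * norm (x - y)"
        unfolding h_def by linarith
      show "\<bar>h n x\<bar> \<le> 1"
        using infdist_nonneg[of x C] by (simp add: h_def)
    qed
    moreover have "(\<lambda>n. \<integral>t. G t * complex_of_real (h n t) \<partial>lborel) \<longlonglongrightarrow> (\<integral>t. G t * complex_of_real (indicator C t) \<partial>lborel)"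
    proof (rule integral_dominated_convergence[where w = "\<lambda>t. cmod (G t)"])
      show "AE t in lborel. (\<lambda>n. G t * complex_of_real (h n t)) \<longlonglongrightarrow> G t * complex_of_real (indicator C t)"
      proof (intro AE_I2 tendsto_intros)
        fix t
        show "(\<lambda>n. h n t) \<longlonglongrightarrow> indicator C t"
        proof (cases "t \<in> C")
          case True
          then show ?thesis by (simp add: h_def)
        next
          case notin: False
          then have pos: "infdist t C > 0"
            using infdist_pos_not_in_closed[OF C False] by blast
          obtain N where N: "1 < real N * infdist t C" using ex_less_of_nat_mult[OF pos] by blast
          have "h n t = 0" if "n \<ge> N" for n
          proof -
            have "real N * infdist t C \<le> real n * infdist t C" using that pos by (intro mult_right_mono) auto
            then show ?thesis using N by (simp add: h_def)
          qed
          then have "eventually (\<lambda>n. h n t = 0) sequentially" by (intro eventually_sequentiallyI)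
          then show ?thesis using notin by (simp add: tendsto_eventually)
        qed
      qed
      show "AE t in lborel. norm (G t * complex_of_real (h n t)) \<le> cmod (G t)" for n
        using infdist_nonneg[of _ C] by (intro AE_I2) (auto simp: norm_mult h_def intro!: mult_left_le)
      have [measurable]: "C \<in> sets borel" using C by simp
      show "(\<lambda>t. G t * complex_of_real (indicator C t)) \<in> borel_measurable lborel" by measurable
      show "(\<lambda>t. G t * complex_of_real (h n t)) \<in> borel_measurable lborel" for n
      proof -
        have [measurable]: "(\<lambda>x. infdist x C) \<in> borel_measurable borel"
          by (intro borel_measurable_continuous_onI continuous_intros)
        show ?thesis unfolding h_def by measurable
      qed
    qed (use G in auto)
    ultimately have "(\<integral>t. G t * complex_of_real (indicator C t) \<partial>lborel) = 0"
      by (simp add: LIMSEQ_const_iff)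
    then show ?thesis
      by (simp add: set_lebesgue_integral_def scaleR_conv_of_real mult.commute)
  qed (simp add: set_lebesgue_integral_def)
qed

text \<open>At the points \<open>(0, - w)\<close> the transform is the ordinary Fourier integral of
  \<open>F t * gauss t\<close>, and the Gaussian has no zeros.\<close>

lemma stft_eq_0_imp_eq_0:
  assumes "\<And>z. stft f z = 0"
  shows "f = 0"
proof -
  obtain F where F: "sq_integrable F" "f = abs_l2 F" by (rule l2_obtain)
  have "AE t in lborel. F t * gauss t = 0"
  proof (rule fourier_eq_0_imp_AE_eq_0)
    show "integrable lborel (\<lambda>t. F t * gauss t)"
      using integrable_mult_cnj[OF F(1) sq_integrable_gauss] by (simp add: cnj_gauss)
    fix w :: 'a
    have "stft f (0, - w) = (\<integral>t. F t * gauss t * ei (w \<bullet> t) \<partial>lborel)"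
      using F by (simp add: stft_abs tf_fun_def cnj_gauss exp_cnj mult_ac)
    then show "(\<integral>t. F t * gauss t * ei (w \<bullet> t) \<partial>lborel) = 0"
      by (simp add: assms)
  qed
  then have "l2_rel F (\<lambda>_. 0)"
    using F by (simp add: l2_rel_def sq_integrable_zero gauss_def)
  then show ?thesis
    using F by (metis Quotient3_l2 Quotient3_rel zero_l2_def)
qed

section \<open>Reproducing and inversion formulas\<close>

lemma stft_tf_l2: "stft (tf_l2 a f) z = twist a (z - a) * stft f (z - a)"
  unfolding stft_def
  by (subst tf_l2_diff_index[of z _ a]) (simp add: cinner_l2_cscale_right cinner_tf_l2_tf_l2)

lemma borel_measurable_pair_tf_gauss [measurable (raw)]:
  assumes "f \<in> borel_measurable M" "g \<in> borel_measurable M"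
  shows "(\<lambda>x. tf_fun (f x) gauss (g x)) \<in> borel_measurable M"
proof -
  have "(\<lambda>x. (f x, g x)) \<in> M \<rightarrow>\<^sub>M borel \<Otimes>\<^sub>M borel" using assms by measurable
  from measurable_compose[OF this measurable_tf_gauss] show ?thesis by simp
qed

text \<open>An integral against the transform is moved onto the function side. Fubini applies
  because the integral of the absolute value over \<open>t\<close> has a bound \<open>K\<close>
  independent of \<open>z\<close>: time-frequency shifts preserve the square integral of the
  window.\<close>

lemma
  fixes F :: "'a::euclidean_space \<Rightarrow> complex" and \<Phi> :: "'a \<times> 'a \<Rightarrow> complex"
  assumes F: "sq_integrable F" and \<Phi>: "integrable lborel \<Phi>"
  shows integrable_stft_mult: "integrable lborel (\<lambda>z. stft (abs_l2 F) z * \<Phi> z)"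
    and integral_stft_mult: "(\<integral>z. stft (abs_l2 F) z * \<Phi> z \<partial>lborel)
      = (\<integral>t. F t * (\<integral>z. \<Phi> z * cnj (tf_fun z gauss t) \<partial>lborel) \<partial>lborel)"
proof -
  have [measurable]: "F \<in> borel_measurable borel" "\<Phi> \<in> borel_measurable borel"
    using F \<Phi> by (auto simp: sq_integrable_def dest: borel_measurable_integrable)
  let ?f = "\<lambda>z t. F t * (\<Phi> z * cnj (tf_fun z gauss t))"
  have Ft: "integrable lborel (\<lambda>t. F t * cnj (tf_fun z gauss t))" for z
    by (rule integrable_mult_cnj[OF F sq_integrable_tf_fun[OF sq_integrable_gauss]])
  define K where "K = (\<integral>t. (cmod (F t))\<^sup>2 \<partial>lborel) + (\<integral>t. (cmod (gauss t))\<^sup>2 \<partial>(lborel :: 'a measure))"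
  have K: "(\<integral>t. cmod (F t * cnj (tf_fun z gauss t)) \<partial>lborel) \<le> K" for z
  proof -
    have "(\<integral>t. cmod (F t * cnj (tf_fun z gauss t)) \<partial>lborel)
      \<le> (\<integral>t. (cmod (F t))\<^sup>2 + (cmod (tf_fun z gauss t))\<^sup>2 \<partial>lborel)"
    proof (intro integral_mono integrable_norm Ft Bochner_Integration.integrable_add)
      fix t
      show "cmod (F t * cnj (tf_fun z gauss t)) \<le> (cmod (F t))\<^sup>2 + (cmod (tf_fun z gauss t))\<^sup>2"
        using zero_le_power2[of "cmod (F t) - cmod (tf_fun z gauss t)"] zero_le_power2[of "cmod (F t)"]
          zero_le_power2[of "cmod (tf_fun z gauss t)"]
        unfolding power2_diff norm_mult complex_mod_cnj by linarith
    qed (use F sq_integrable_tf_fun[OF sq_integrable_gauss, of z] in \<open>auto simp: sq_integrable_def\<close>)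
    also have "\<dots> = K"
      using F sq_integrable_tf_fun[OF sq_integrable_gauss, of z]
      by (simp add: K_def integral_tf_fun_sq sq_integrable_def)
    finally show ?thesis .
  qed
  have int: "integrable (lborel \<Otimes>\<^sub>M lborel) (\<lambda>(z, t). ?f z t)"
  proof (rule lborel_pair.Fubini_integrable)
    show "(\<lambda>(z, t). ?f z t) \<in> borel_measurable (lborel \<Otimes>\<^sub>M lborel)" by measurable
    show "integrable lborel (\<lambda>z. \<integral>t. norm (case (z, t) of (z, t) \<Rightarrow> ?f z t) \<partial>lborel)"
    proof (rule Bochner_Integration.integrable_bound)
      show "integrable lborel (\<lambda>z. cmod (\<Phi> z) * K)" using \<Phi> by simp
      show "AE z in lborel. norm (\<integral>t. norm (case (z, t) of (z, t) \<Rightarrow> ?f z t) \<partial>lborel) \<le> norm (cmod (\<Phi> z) * K)"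
      proof (intro AE_I2)
        fix z
        have "(\<integral>t. cmod (?f z t) \<partial>lborel) = cmod (\<Phi> z) * (\<integral>t. cmod (F t * cnj (tf_fun z gauss t)) \<partial>lborel)"
        proof -
          have "cmod (?f z t) = cmod (\<Phi> z) * cmod (F t * cnj (tf_fun z gauss t))" for t
            by (simp add: norm_mult)
          then show ?thesis by (simp only: integral_mult_right_zero)
        qed
        also have "\<dots> \<le> cmod (\<Phi> z) * K" by (intro mult_left_mono K) simp
        finally have "(\<integral>t. cmod (?f z t) \<partial>lborel) \<le> cmod (\<Phi> z) * K" .
        moreover have "0 \<le> (\<integral>t. cmod (?f z t) \<partial>lborel)" by simp
        ultimately show "norm (\<integral>t. norm (case (z, t) of (z, t) \<Rightarrow> ?f z t) \<partial>lborel) \<le> norm (cmod (\<Phi> z) * K)"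
          unfolding prod.case real_norm_def by linarith
      qed
    qed measurable
    show "AE z in lborel. integrable lborel (\<lambda>t. case (z, t) of (z, t) \<Rightarrow> ?f z t)"
    proof (intro AE_I2)
      fix z
      have "integrable lborel (\<lambda>t. \<Phi> z * (F t * cnj (tf_fun z gauss t)))"
        using Ft by (rule integrable_mult_right)
      then show "integrable lborel (\<lambda>t. case (z, t) of (z, t) \<Rightarrow> ?f z t)"
        by (simp only: prod.case mult.left_commute[of "\<Phi> z"])
    qed
  qed
  have eq: "(\<integral>t. ?f z t \<partial>lborel) = stft (abs_l2 F) z * \<Phi> z" for z
    unfolding stft_abs[OF F] integral_mult_left_zero[symmetric]
    by (intro Bochner_Integration.integral_cong) (simp_all add: mult_ac)
  show "integrable lborel (\<lambda>z. stft (abs_l2 F) z * \<Phi> z)"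
    using lborel_pair.integrable_fst[OF int] by (simp only: eq)
  have "(\<integral>z. stft (abs_l2 F) z * \<Phi> z \<partial>lborel) = (\<integral>z. \<integral>t. ?f z t \<partial>lborel \<partial>lborel)"
    by (simp only: eq)
  also have "\<dots> = (\<integral>t. \<integral>z. ?f z t \<partial>lborel \<partial>lborel)"
    by (rule lborel_pair.Fubini_integral[symmetric]) (rule int)
  finally show "(\<integral>z. stft (abs_l2 F) z * \<Phi> z \<partial>lborel)
      = (\<integral>t. F t * (\<integral>z. \<Phi> z * cnj (tf_fun z gauss t) \<partial>lborel) \<partial>lborel)"
    by simp
qed

lemma integrable_stft_tf_gaussian: "integrable lborel (stft (tf_l2 a gaussian))"
proof (rule Bochner_Integration.integrable_bound)
  show "integrable lborel (\<lambda>z. 2 powr (- (DIM('a) / 2)) * gauss_exp (1/2) (z - a))"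
    by (intro integrable_mult_right integrable_gauss) simp
qed (simp_all add: norm_stft_tf_gaussian)

text \<open>After the exchange of integrals the inner one is the conjugate of the pointwise formula
  \<open>gauss_reproducing\<close>.\<close>

lemma stft_reproducing:
  fixes f :: "'a::euclidean_space l2"
  shows "has_bochner_integral lborel (\<lambda>z. stft f z * cnj (stft (tf_l2 a gaussian) z))
    (2 powr (- (DIM('a) / 2)) * stft f a)"
proof -
  obtain F where F: "sq_integrable F" "f = abs_l2 F" by (rule l2_obtain)
  let ?\<Phi> = "\<lambda>z. cnj (stft (tf_l2 a gaussian) z)"
  have \<Phi>: "integrable lborel ?\<Phi>" using integrable_stft_tf_gaussian by simp
  have "(\<integral>z. ?\<Phi> z * cnj (tf_fun z gauss t) \<partial>lborel) = 2 powr (- (DIM('a) / 2)) * cnj (tf_fun a gauss t)" for t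
  proof -
    have "(\<integral>z. ?\<Phi> z * cnj (tf_fun z gauss t) \<partial>lborel) = cnj (\<integral>z. stft (tf_l2 a gaussian) z * tf_fun z gauss t \<partial>lborel)"
      by (simp flip: Bochner_Integration.integral_cnj)
    then show ?thesis using gauss_reproducing[of a t] by (simp add: has_bochner_integral_iff)
  qed
  then have "(\<integral>z. stft f z * ?\<Phi> z \<partial>lborel)
      = (\<integral>t. 2 powr (- (DIM('a) / 2)) * (F t * cnj (tf_fun a gauss t)) \<partial>lborel)"
    unfolding F(2) integral_stft_mult[OF F(1) \<Phi>] by (intro Bochner_Integration.integral_cong) (simp_all add: mult_ac)
  then have "(\<integral>z. stft f z * ?\<Phi> z \<partial>lborel) = 2 powr (- (DIM('a) / 2)) * stft f a"
    by (simp add: stft_abs F)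
  then show ?thesis
    using integrable_stft_mult[OF F(1) \<Phi>] by (simp add: F(2) has_bochner_integral_iff)
qed

text \<open>Absolute values in the reproducing formula; the constant occurs on both sides and
  cancels. The bound replaces a point value by a Gaussian average, which is what makes sampling on a
  lattice controllable by an integral.\<close>

lemma
  fixes f :: "'a::euclidean_space l2"
  shows integrable_norm_stft_gauss: "integrable lborel (\<lambda>z. cmod (stft f z) * gauss_exp (1/2) (z - a))"
    and norm_stft_le_integral: "cmod (stft f a) \<le> (\<integral>z. cmod (stft f z) * gauss_exp (1/2) (z - a) \<partial>lborel)"
proof -
  let ?c = "2 powr (- (DIM('a) / 2))"
  have n: "norm (stft f z * cnj (stft (tf_l2 a gaussian) z)) = ?c * (cmod (stft f z) * gauss_exp (1/2) (z - a))" for z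
    by (simp add: norm_mult norm_stft_tf_gaussian)
  note rep = stft_reproducing[of f a, unfolded has_bochner_integral_iff]
  have "integrable lborel (\<lambda>z. ?c * (cmod (stft f z) * gauss_exp (1/2) (z - a)))"
    using integrable_norm[OF conjunct1[OF rep]] by (simp only: n)
  then show "integrable lborel (\<lambda>z. cmod (stft f z) * gauss_exp (1/2) (z - a))"
    by (rule integrable_mult_right[of "inverse ?c", THEN iffD1[OF arg_cong[of _ _ "integrable lborel"], rotated]])
      (simp add: fun_eq_iff powr_minus)
  have "?c * cmod (stft f a) = norm (\<integral>z. stft f z * cnj (stft (tf_l2 a gaussian) z) \<partial>lborel)"
    using rep by (simp add: norm_mult)
  also have "\<dots> \<le> (\<integral>z. norm (stft f z * cnj (stft (tf_l2 a gaussian) z)) \<partial>lborel)"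
    by (rule integral_norm_bound)
  also have "\<dots> = ?c * (\<integral>z. cmod (stft f z) * gauss_exp (1/2) (z - a) \<partial>lborel)"
    by (simp only: n integral_mult_right_zero)
  finally show "cmod (stft f a) \<le> (\<integral>z. cmod (stft f z) * gauss_exp (1/2) (z - a) \<partial>lborel)"
    by simp
qed

text \<open>The candidate for \<open>g\<close> is the superposition of the \<open>\<pi>(z)\<phi>\<close> with weights \<^term>\<open>stft g z\<close>.  It is
  bounded and integrable, hence in \<open>L\<^sup>2\<close>, and it has the right transform by the reproducing formula.\<close>

lemma stft_inversion:
  fixes g :: "'a::euclidean_space l2"
  assumes g: "integrable lborel (stft g)"
  shows "has_bochner_integral lborel (\<lambda>z. stft h z * cnj (stft g z)) (2 powr (- (DIM('a) / 2)) * cinner_l2 h g)"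
proof -
  define G where "G t = (\<integral>z. stft g z * tf_fun z gauss t \<partial>lborel)" for t :: 'a
  have int: "integrable (lborel \<Otimes>\<^sub>M lborel) (\<lambda>(z, t). stft g z * tf_fun z gauss t)"
  proof (rule lborel_pair.Fubini_integrable)
    show "(\<lambda>(z, t). stft g z * tf_fun z gauss t) \<in> borel_measurable (lborel \<Otimes>\<^sub>M lborel)" by measurable
    have gi: "integrable lborel (\<lambda>t. gauss_exp 1 (t - fst z))" for z :: "'a \<times> 'a"
      by (rule integrable_gauss) simp
    have cm: "cmod (tf_fun z gauss t) = gauss_exp 1 (t - fst z)" for z and t :: 'a
      by (simp add: cmod_tf_fun norm_gauss)
    have "(\<integral>t. cmod (stft g z * tf_fun z gauss t) \<partial>lborel) = cmod (stft g z)" for z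
      using integral_gauss[of 1 "fst z"] by (simp only: norm_mult cm integral_mult_right_zero) simp
    then show "integrable lborel (\<lambda>z. \<integral>t. norm (case (z, t) of (z, t) \<Rightarrow> stft g z * tf_fun z gauss t) \<partial>lborel)"
      using g by simp
    have "integrable lborel (\<lambda>t. tf_fun z gauss t)" for z :: "'a \<times> 'a"
      by (rule Bochner_Integration.integrable_bound[OF gi[of z]]) (auto simp: cm)
    then show "AE z in lborel. integrable lborel (\<lambda>t. case (z, t) of (z, t) \<Rightarrow> stft g z * tf_fun z gauss t)"
      by simp
  qed
  have G_int: "integrable lborel G"
    using lborel_pair.integrable_snd[OF int] by (simp add: G_def [abs_def])
  have [measurable]: "G \<in> borel_measurable borel" using G_int by (auto dest: borel_measurable_integrable)
  define C where "C = (\<integral>z. cmod (stft g z) \<partial>lborel)"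
  have G_bd: "cmod (G t) \<le> C" for t
    unfolding G_def C_def using g
    by (intro order_trans[OF integral_norm_bound] integral_mono')
      (simp_all add: norm_mult mult_left_le norm_tf_gauss_le_1)
  have G: "sq_integrable G"
    unfolding sq_integrable_def
  proof
    show "integrable lborel (\<lambda>t. (cmod (G t))\<^sup>2)"
    proof (rule Bochner_Integration.integrable_bound)
      show "integrable lborel (\<lambda>t. C * cmod (G t))" using G_int by simp
      show "AE t in lborel. norm ((cmod (G t))\<^sup>2) \<le> norm (C * cmod (G t))"
        using G_bd by (intro AE_I2) (auto simp: power2_eq_square abs_mult intro!: mult_right_mono order_trans[OF G_bd])
    qed measurable
  qed simp
  have pair: "has_bochner_integral lborel (\<lambda>z. stft h z * cnj (stft g z)) (cinner_l2 h (abs_l2 G))" for h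
  proof -
    obtain H where H: "sq_integrable H" "h = abs_l2 H" by (rule l2_obtain)
    have \<Phi>: "integrable lborel (\<lambda>z. cnj (stft g z))" using g by simp
    have "(\<integral>z. cnj (stft g z) * cnj (tf_fun z gauss t) \<partial>lborel) = cnj (G t)" for t
      unfolding G_def by (simp flip: Bochner_Integration.integral_cnj)
    then show ?thesis
      using integrable_stft_mult[OF H(1) \<Phi>] integral_stft_mult[OF H(1) \<Phi>]
      by (simp add: H has_bochner_integral_iff cinner_l2_abs G)
  qed
  have "stft (abs_l2 G) a = 2 powr (- (DIM('a) / 2)) * stft g a" for a
  proof -
    have "stft (abs_l2 G) a = cnj (cinner_l2 (tf_l2 a gaussian) (abs_l2 G))"
      by (simp add: stft_def cinner_l2_cnj)
    also have "\<dots> = cnj (\<integral>z. stft (tf_l2 a gaussian) z * cnj (stft g z) \<partial>lborel)"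
      using pair by (simp add: has_bochner_integral_iff)
    also have "\<dots> = (\<integral>z. stft g z * cnj (stft (tf_l2 a gaussian) z) \<partial>lborel)"
      by (simp add: mult.commute flip: Bochner_Integration.integral_cnj)
    also have "\<dots> = 2 powr (- (DIM('a) / 2)) * stft g a"
      using stft_reproducing[of g a] by (simp add: has_bochner_integral_iff)
    finally show ?thesis .
  qed
  then have "abs_l2 G - cscale_l2 (2 powr (- (DIM('a) / 2))) g = 0"
    by (intro stft_eq_0_imp_eq_0) (simp add: stft_diff stft_cscale)
  then have "abs_l2 G = cscale_l2 (2 powr (- (DIM('a) / 2))) g" by simp
  then show ?thesis using pair[of h] by (simp add: cinner_l2_cscale_right)
qed

section \<open>Sampling on a lattice\<close>

lemma lattice_subgroup_diff:
  "lattice_subgroup \<Lambda> \<Longrightarrow> x \<in> \<Lambda> \<Longrightarrow> y \<in> \<Lambda> \<Longrightarrow> x - y \<in> \<Lambda>"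
  unfolding lattice_subgroup_def by (metis diff_conv_add_uminus)

text \<open>Differences of lattice points lie in the lattice, so an isolating ball around 0
  separates all pairs. Half its radius makes the balls disjoint.\<close>

lemma lattice_subgroup_separated:
  assumes "lattice_subgroup \<Lambda>"
  obtains r where "r > 0" "\<And>x y. x \<in> \<Lambda> \<Longrightarrow> y \<in> \<Lambda> \<Longrightarrow> x \<noteq> y \<Longrightarrow> ball x r \<inter> ball y r = {}"
proof -
  have "0 isolated_in \<Lambda>"
    using assms by (auto simp: lattice_subgroup_def discrete_def)
  then obtain T where T: "open T" "T \<inter> \<Lambda> = {0}" by (auto simp: isolated_in_def)
  then obtain e where e: "e > 0" "ball 0 e \<subseteq> T" by (metis Int_iff insertI1 open_contains_ball)
  have far: "e \<le> dist x y" if "x \<in> \<Lambda>" "y \<in> \<Lambda>" "x \<noteq> y" for x y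
  proof (rule ccontr)
    assume "\<not> e \<le> dist x y"
    then have "x - y \<in> ball 0 e" by (simp add: dist_norm norm_minus_commute)
    then have "x - y \<in> T \<inter> \<Lambda>" using e lattice_subgroup_diff[OF assms that(1,2)] by auto
    then show False using T that by auto
  qed
  show thesis
  proof
    show "e / 2 > 0" using e by simp
    show "ball x (e/2) \<inter> ball y (e/2) = {}" if "x \<in> \<Lambda>" "y \<in> \<Lambda>" "x \<noteq> y" for x y
      using far[OF that] by (intro disjoint_ballI) simp
  qed
qed

text \<open>Each summand is compared with an integral over the ball of radius \<open>r\<close>
  around \<open>l\<close>. For \<open>w\<close> in this ball, |w - z|^2 is at most 2|z - l|^2 +
  2r^2, so halving the rate and paying the factor \<open>E\<close> covers the move from
  \<open>l\<close> to \<open>w\<close>. The balls are disjoint, hence one Gaussian integral bounds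
  the sum uniformly in \<open>z\<close>.\<close>

lemma lattice_gauss_sum_bounded:
  fixes \<Lambda> :: "'b::euclidean_space set"
  assumes \<Lambda>: "lattice_subgroup \<Lambda>" and \<alpha>: "\<alpha> > 0"
  obtains C where "C \<ge> 0" "\<And>z F. finite F \<Longrightarrow> F \<subseteq> \<Lambda> \<Longrightarrow> (\<Sum>l\<in>F. gauss_exp \<alpha> (z - l)) \<le> C"
proof -
  obtain r where r: "r > 0" "\<And>x y. x \<in> \<Lambda> \<Longrightarrow> y \<in> \<Lambda> \<Longrightarrow> x \<noteq> y \<Longrightarrow> ball x r \<inter> ball y r = {}"
    by (rule lattice_subgroup_separated[OF \<Lambda>], rule that)
  define V where "V = measure lborel (ball (0 :: 'b) r)"
  have V: "V > 0" using r by (simp add: V_def content_ball_pos)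
  have V_ball: "measure lborel (ball l r) = V" for l :: 'b
    using content_ball_conv_unit_ball[of r l] content_ball_conv_unit_ball[of r "0 :: 'b"] r by (simp add: V_def)
  define E where "E = exp (pi * \<alpha> * r\<^sup>2)"
  define C where "C = E * (\<alpha> / 2) powr (- (DIM('b) / 2)) / V"
  have \<alpha>2: "\<alpha> / 2 > 0" using \<alpha> by simp
  let ?g = "\<lambda>z w. gauss_exp (\<alpha> / 2) (w - z)"
  show thesis
  proof
    show "C \<ge> 0" using V by (simp add: C_def E_def)
    fix z :: 'b and F assume F: "finite F" "F \<subseteq> \<Lambda>"
    have gi: "set_integrable lborel (ball l r) (?g z)" for l
      unfolding set_integrable_def by (intro integrable_mult_indicator integrable_gauss \<alpha>2) simp
    have one: "V * gauss_exp \<alpha> (z - l) \<le> E * (LINT w:ball l r|lborel. ?g z w)" for l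
    proof -
      have "V * gauss_exp \<alpha> (z - l) = (LINT w:ball l r|lborel. gauss_exp \<alpha> (z - l))"
        using emeasure_lborel_ball_finite[of l r] by (simp add: set_lebesgue_integral_def V_ball)
      also have "\<dots> \<le> (LINT w:ball l r|lborel. E * ?g z w)"
      proof (rule set_integral_mono)
        show "set_integrable lborel (ball l r) (\<lambda>w. gauss_exp \<alpha> (z - l))"
          unfolding set_integrable_def
          by (intro integrable_scaleR_left integrable_real_indicator) (simp_all add: emeasure_lborel_ball_finite[unfolded infinity_ennreal_def])
        show "set_integrable lborel (ball l r) (\<lambda>w. E * ?g z w)"
          using gi by (rule set_integrable_mult_right)
        fix w assume "w \<in> ball l r"
        then have "norm (w - l) \<le> r" by (simp add: dist_norm norm_minus_commute)
        then have "(w - l) \<bullet> (w - l) \<le> r\<^sup>2"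
          unfolding power2_norm_eq_inner[symmetric] by (intro power_mono) auto
        moreover have "0 \<le> ((w - l) + (z - l)) \<bullet> ((w - l) + (z - l))" by simp
        ultimately have "(w - z) \<bullet> (w - z) \<le> 2 * ((z - l) \<bullet> (z - l)) + 2 * r\<^sup>2"
          by (simp add: inner_diff_left inner_diff_right inner_add_left inner_add_right inner_commute)
        then have "pi * (\<alpha> / 2) * ((w - z) \<bullet> (w - z)) \<le> pi * (\<alpha> / 2) * (2 * ((z - l) \<bullet> (z - l)) + 2 * r\<^sup>2)"
          using \<alpha> by (intro mult_left_mono) auto
        then show "gauss_exp \<alpha> (z - l) \<le> E * ?g z w"
          unfolding E_def exp_add[symmetric] by (simp add: algebra_simps)
      qed
      also have "\<dots> = E * (LINT w:ball l r|lborel. ?g z w)" by (rule set_integral_mult_right)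
      finally show ?thesis .
    qed
    have "V * (\<Sum>l\<in>F. gauss_exp \<alpha> (z - l)) \<le> (\<Sum>l\<in>F. E * (LINT w:ball l r|lborel. ?g z w))"
      unfolding sum_distrib_left by (intro sum_mono one)
    also have "\<dots> = E * (\<Sum>l\<in>F. LINT w:ball l r|lborel. ?g z w)"
      by (simp add: sum_distrib_left)
    also have "(\<Sum>l\<in>F. LINT w:ball l r|lborel. ?g z w) = (LINT w:(\<Union>l\<in>F. ball l r)|lborel. ?g z w)"
    proof (intro set_integral_finite_Union[symmetric] gi F)
      show "disjoint_family_on (\<lambda>l. ball l r) F"
        using F r(2) unfolding disjoint_family_on_def by blast
    qed simp
    also have "\<dots> \<le> (\<integral>w. ?g z w \<partial>lborel)"
      unfolding set_lebesgue_integral_def using borel_open[OF open_UN[of F "\<lambda>l. ball l r"]]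
      by (intro integral_mono integrable_mult_indicator integrable_gauss \<alpha>2) (auto simp: indicator_def)
    also have "\<dots> = (\<alpha> / 2) powr (- (DIM('b) / 2))"
      by (rule integral_gauss[OF \<alpha>2])
    finally have "V * (\<Sum>l\<in>F. gauss_exp \<alpha> (z - l)) \<le> E * (\<alpha> / 2) powr (- (DIM('b) / 2))"
      by (simp add: E_def)
    then show "(\<Sum>l\<in>F. gauss_exp \<alpha> (z - l)) \<le> C"
      using V by (simp add: C_def field_simps)
  qed
qed

text \<open>Replacing every sample by its Gaussian average and exchanging sum and integral leaves a
  Gaussian lattice sum centred at \<open>z - w\<close>, which has a bound independent of the
  centre.\<close>

lemma lattice_stft_sum_bounded:
  fixes \<Lambda> :: "('a::euclidean_space \<times> 'a) set"
  assumes \<Lambda>: "lattice_subgroup \<Lambda>" and g: "integrable lborel (stft g)"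
  obtains C where "C \<ge> 0" "\<And>z F. finite F \<Longrightarrow> F \<subseteq> \<Lambda> \<Longrightarrow> (\<Sum>l\<in>F. cmod (stft g (z - l))) \<le> C"
proof -
  have half: "(1/2 :: real) > 0" by simp
  obtain C where C: "C \<ge> 0" "\<And>z F. finite F \<Longrightarrow> F \<subseteq> \<Lambda> \<Longrightarrow> (\<Sum>l\<in>F. gauss_exp (1/2) (z - l)) \<le> C"
    by (rule lattice_gauss_sum_bounded[OF \<Lambda> half], rule that)
  show thesis
  proof
    show "0 \<le> C * (\<integral>w. cmod (stft g w) \<partial>lborel)" using C by simp
    fix z :: "'a \<times> 'a" and F assume F: "finite F" "F \<subseteq> \<Lambda>"
    let ?e = "\<lambda>w l. gauss_exp (1/2) (w - (z - l))"
    have "(\<Sum>l\<in>F. cmod (stft g (z - l))) \<le> (\<Sum>l\<in>F. \<integral>w. cmod (stft g w) * ?e w l \<partial>lborel)"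
      by (intro sum_mono norm_stft_le_integral)
    also have "\<dots> = (\<integral>w. (\<Sum>l\<in>F. cmod (stft g w) * ?e w l) \<partial>lborel)"
      by (intro Bochner_Integration.integral_sum[symmetric] integrable_norm_stft_gauss)
    also have "\<dots> \<le> (\<integral>w. C * cmod (stft g w) \<partial>lborel)"
    proof (intro integral_mono Bochner_Integration.integrable_sum integrable_norm_stft_gauss)
      fix w
      have "(\<Sum>l\<in>F. ?e w l) = (\<Sum>l\<in>F. gauss_exp (1/2) ((z - w) - l))"
        by (intro sum.cong refl) (simp add: inner_diff_left inner_diff_right inner_commute)
      then have "(\<Sum>l\<in>F. ?e w l) \<le> C" using C(2)[OF F] by simp
      then show "(\<Sum>l\<in>F. cmod (stft g w) * ?e w l) \<le> C * cmod (stft g w)"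
        unfolding sum_distrib_left[symmetric] by (subst mult.commute) (intro mult_right_mono, auto)
    qed (use g in auto)
    finally show "(\<Sum>l\<in>F. cmod (stft g (z - l))) \<le> C * (\<integral>w. cmod (stft g w) \<partial>lborel)" by simp
  qed
qed

text \<open>The inversion formula bounds each coefficient by the integral of |stft f| against the
  shifted |stft g|. Summing under the integral, the shifted factors contribute at most
  \<open>C\<close>, and the integral of |stft f| remains.\<close>

lemma abs_summable_cinner_tf_l2:
  fixes \<Lambda> :: "('a::euclidean_space \<times> 'a) set"
  assumes \<Lambda>: "lattice_subgroup \<Lambda>" and f: "integrable lborel (stft f)" and g: "integrable lborel (stft g)"
  shows "(\<lambda>l. cmod (cinner_l2 f (tf_l2 l g))) summable_on \<Lambda>"
proof -
  obtain C where C: "C \<ge> 0" "\<And>z F. finite F \<Longrightarrow> F \<subseteq> \<Lambda> \<Longrightarrow> (\<Sum>l\<in>F. cmod (stft g (z - l))) \<le> C"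
    by (rule lattice_stft_sum_bounded[OF \<Lambda> g], rule that)
  let ?c = "2 powr (- (DIM('a) / 2))"
  have shift: "integrable lborel (\<lambda>z. stft g (z - l))" for l
  proof -
    have "integrable (distr lborel borel (\<lambda>z. z - l)) (stft g)"
      unfolding lborel_distr_minus by (rule g)
    then show ?thesis by (subst (asm) integrable_distr_eq) auto
  qed
  have tfi: "integrable lborel (stft (tf_l2 l g))" for l
    by (rule Bochner_Integration.integrable_bound[OF shift[of l]]) (simp_all add: stft_tf_l2 norm_mult)
  have prod: "integrable lborel (\<lambda>z. cmod (stft f z) * cmod (stft g (z - l)))" for l
  proof (rule Bochner_Integration.integrable_bound)
    show "integrable lborel (\<lambda>z. cmod (stft f z) * (norm g * norm (gaussian :: 'a l2)))"
      using f by simp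
  qed (auto intro!: AE_I2 mult_left_mono simp: abs_mult order_trans[OF norm_stft_le])
  have le: "?c * cmod (cinner_l2 f (tf_l2 l g)) \<le> (\<integral>z. cmod (stft f z) * cmod (stft g (z - l)) \<partial>lborel)" for l
  proof -
    have "?c * cmod (cinner_l2 f (tf_l2 l g)) = cmod (\<integral>z. stft f z * cnj (stft (tf_l2 l g) z) \<partial>lborel)"
      using stft_inversion[OF tfi, of f l] by (simp add: has_bochner_integral_iff norm_mult)
    also have "\<dots> \<le> (\<integral>z. cmod (stft f z * cnj (stft (tf_l2 l g) z)) \<partial>lborel)"
      by (rule integral_norm_bound)
    finally show ?thesis by (simp add: norm_mult stft_tf_l2)
  qed
  have "bdd_above (sum (\<lambda>l. cmod (cinner_l2 f (tf_l2 l g))) ` {F. F \<subseteq> \<Lambda> \<and> finite F})"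
  proof (rule bdd_aboveI2)
    fix F assume "F \<in> {F. F \<subseteq> \<Lambda> \<and> finite F}"
    then have F: "finite F" "F \<subseteq> \<Lambda>" by auto
    have "?c * (\<Sum>l\<in>F. cmod (cinner_l2 f (tf_l2 l g))) \<le> (\<Sum>l\<in>F. \<integral>z. cmod (stft f z) * cmod (stft g (z - l)) \<partial>lborel)"
      unfolding sum_distrib_left by (intro sum_mono le)
    also have "\<dots> = (\<integral>z. (\<Sum>l\<in>F. cmod (stft f z) * cmod (stft g (z - l))) \<partial>lborel)"
      by (intro Bochner_Integration.integral_sum[symmetric] prod)
    also have "\<dots> \<le> (\<integral>z. cmod (stft f z) * C \<partial>lborel)"
      using f prod C(2)[OF F]
      by (intro integral_mono Bochner_Integration.integrable_sum) (auto intro!: mult_left_mono simp flip: sum_distrib_left)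
    finally show "(\<Sum>l\<in>F. cmod (cinner_l2 f (tf_l2 l g))) \<le> (\<integral>z. cmod (stft f z) * C \<partial>lborel) / ?c"
      by (subst pos_le_divide_eq) (auto simp: mult.commute)
  qed
  then show ?thesis by (intro nonneg_bdd_above_summable_on) auto
qed

lemma integrable_stft_if_M1:
  assumes "weight v" and f: "f \<in> M1 v"
  shows "integrable lborel (stft f)"
proof -
  have v: "1 \<le> v z" for z using assms(1) by (simp only: weight_def)
  have "(\<integral>\<^sup>+z. ennreal (cmod (stft f z)) \<partial>lborel) = (\<integral>\<^sup>+z. ennreal (cmod (stft f z)) \<partial>lebesgue)"
    by (rule nn_integral_completion[symmetric])
  also have "\<dots> \<le> (\<integral>\<^sup>+z. ennreal (cmod (cinner_l2 f (tf_shift z gaussian)) * v z) \<partial>lebesgue)"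
    using v by (intro nn_integral_mono ennreal_leI) (simp add: stft_def mult_le_cancel_left1)
  also have "\<dots> < \<infinity>" using f by (simp add: M1_def)
  finally show ?thesis by (simp add: integrable_iff_bounded)
qed

section \<open>Density of the modulation space\<close>

text \<open>The projection theorem: a minimizing sequence for the distance from \<open>f\<close> to
  \<open>S\<close> converges, and the residual of its limit is orthogonal to \<open>S\<close>, hence
  0.\<close>

lemma real_inner_dense_if_orthogonal_trivial:
  fixes S :: "'a::{real_inner, complete_space} set"
  assumes S: "subspace S" and orth: "\<And>e. (\<And>u. u \<in> S \<Longrightarrow> inner e u = 0) \<Longrightarrow> e = 0"
  shows "closure S = UNIV"
proof -
  have "f \<in> closure S" for f
  proof -
    define d where "d = infdist f S"
    have S0: "S \<noteq> {}" using subspace_0[OF S] by auto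
    have d0: "0 \<le> d" by (simp add: d_def infdist_nonneg)
    have d_le: "d \<le> norm (f - u)" if "u \<in> S" for u
      using infdist_le[OF that, of f] by (simp add: d_def dist_norm)
    have "\<exists>w\<in>S. norm (f - w) < d + 1 / real (Suc n)" for n
    proof -
      have "d < d + 1 / real (Suc n)" by simp
      then show ?thesis
        unfolding d_def infdist_notempty[OF S0]
        by (subst (asm) cINF_less_iff) (use S0 in \<open>auto simp: dist_norm intro: bdd_belowI2[of _ 0]\<close>)
    qed
    then obtain w where w: "\<And>n. w n \<in> S" "\<And>n. norm (f - w n) < d + 1 / real (Suc n)"
      by metis
    have lim_norm: "(\<lambda>n. norm (f - w n)) \<longlonglongrightarrow> d"
    proof (rule tendsto_sandwich[of "\<lambda>_. d" _ _ "\<lambda>n. d + 1 / real (Suc n)"])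
      show "(\<lambda>n. d + 1 / real (Suc n)) \<longlonglongrightarrow> d"
        using tendsto_add[OF tendsto_const LIMSEQ_inverse_real_of_nat, of d] by (simp add: inverse_eq_divide)
    qed (simp_all only: d_le w less_imp_le[OF w(2)] eventually_True tendsto_const)
    \<comment> \<open>Parallelogram law; the midpoint of \<open>w m\<close> and \<open>w n\<close>
      lies in \<open>S\<close> and so has distance at least \<open>d\<close> from
      \<open>f\<close>.\<close>
    have par: "(norm (w m - w n))\<^sup>2 \<le> 2 * ((norm (f - w m))\<^sup>2 - d\<^sup>2) + 2 * ((norm (f - w n))\<^sup>2 - d\<^sup>2)" for m n
    proof -
      have "d \<le> norm (f - (w m + w n) /\<^sub>R 2)"
        by (intro d_le subspace_scale[OF S] subspace_add[OF S] w)
      then have "d\<^sup>2 \<le> (norm (f - (w m + w n) /\<^sub>R 2))\<^sup>2"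
        using d0 by (intro power_mono)
      moreover have "(norm (w m - w n))\<^sup>2 = 2 * (norm (f - w m))\<^sup>2 + 2 * (norm (f - w n))\<^sup>2 - 4 * (norm (f - (w m + w n) /\<^sub>R 2))\<^sup>2"
        unfolding power2_norm_eq_inner
        by (simp add: inner_diff_left inner_diff_right inner_add_left inner_add_right inner_commute algebra_simps)
      ultimately show ?thesis by simp
    qed
    have "Cauchy w"
    proof (rule metric_CauchyI)
      fix e :: real assume "e > 0"
      have "(\<lambda>n. (norm (f - w n))\<^sup>2 - d\<^sup>2) \<longlonglongrightarrow> d\<^sup>2 - d\<^sup>2"
        by (intro tendsto_intros lim_norm)
      then have "\<forall>\<^sub>F n in sequentially. (norm (f - w n))\<^sup>2 - d\<^sup>2 < e\<^sup>2 / 4"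
        using \<open>e > 0\<close> by (intro order_tendstoD(2)) auto
      then obtain N where N: "\<And>n. n \<ge> N \<Longrightarrow> (norm (f - w n))\<^sup>2 - d\<^sup>2 < e\<^sup>2 / 4"
        by (auto simp: eventually_sequentially)
      have "dist (w m) (w n) < e" if "m \<ge> N" "n \<ge> N" for m n
      proof -
        have "x < z" if "x \<le> 2 * a + 2 * b" "a < z / 4" "b < z / 4" for x a b z :: real
          using that by linarith
        from this[OF par N[OF that(1)] N[OF that(2)]]
        have "(norm (w m - w n))\<^sup>2 < e\<^sup>2" .
        then show ?thesis using \<open>e > 0\<close> by (simp add: dist_norm power2_less_imp_less)
      qed
      then show "\<exists>M. \<forall>m\<ge>M. \<forall>n\<ge>M. dist (w m) (w n) < e" by blast
    qed
    then obtain w0 where w0: "w \<longlonglongrightarrow> w0" by (auto simp: Cauchy_convergent_iff convergent_def)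
    have norm0: "norm (f - w0) = d"
      using LIMSEQ_unique[OF lim_norm tendsto_norm[OF tendsto_diff[OF tendsto_const w0]]] by simp
    have min: "d \<le> norm (f - w0 - t *\<^sub>R u)" if "u \<in> S" for t u
    proof (rule LIMSEQ_le_const)
      show "(\<lambda>n. norm (f - w n - t *\<^sub>R u)) \<longlonglongrightarrow> norm (f - w0 - t *\<^sub>R u)"
        by (intro tendsto_intros w0)
      have "d \<le> norm (f - w n - t *\<^sub>R u)" for n
        using d_le[OF subspace_add[OF S w(1)[of n] subspace_scale[OF S that, of t]]]
        by (simp add: diff_diff_add)
      then show "\<exists>N. \<forall>n\<ge>N. d \<le> norm (f - w n - t *\<^sub>R u)" by blast
    qed
    have "f - w0 = 0"
    proof (rule orth)
      fix u assume u: "u \<in> S"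
      \<comment> \<open>Moving from \<open>w0\<close> by \<open>?p / inner u u\<close> along
        \<open>u\<close> lowers the squared distance by \<open>?p\<^sup>2 / inner u u\<close>, which
        minimality forbids unless \<open>?p\<close> is 0.\<close>
      let ?p = "inner (f - w0) u"
      show "?p = 0"
      proof (cases "u = 0")
        case False
        then have uu: "inner u u > 0" by simp
        have "d\<^sup>2 \<le> (norm (f - w0 - (?p / inner u u) *\<^sub>R u))\<^sup>2"
          using d0 by (intro power_mono min u)
        also have "\<dots> = d\<^sup>2 - ?p\<^sup>2 / inner u u"
        proof -
          have "(norm (e - t *\<^sub>R u))\<^sup>2 = (norm e)\<^sup>2 - 2 * (t * inner e u) + t * (t * inner u u)" for e t
            unfolding power2_norm_eq_inner by (simp add: inner_diff_left inner_diff_right inner_commute[of u e] right_diff_distrib)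
          then show ?thesis
            using uu unfolding norm0[symmetric] by (simp add: power2_eq_square)
        qed
        finally have "?p\<^sup>2 / inner u u \<le> 0" by simp
        then show ?thesis using uu by (simp add: divide_le_0_iff)
      qed simp
    qed
    then have "w \<longlonglongrightarrow> f" using w0 by simp
    then show ?thesis using w(1) by (auto simp: closure_sequential)
  qed
  then show ?thesis by auto
qed

text \<open>A Steinhaus argument. For large \<open>n\<close> the set \<open>A n\<close>, where
  \<open>v\<close> is at most \<open>n\<close>, has more than 3/4 of the volume \<open>V\<close> of
  the unit ball. If it were disjoint from its translate by a small \<open>z\<close>, the two would
  occupy more than 3/2 of \<open>V\<close> inside a ball of smaller volume. So both \<open>a\<close>
  and \<open>z + a\<close> lie in \<open>A n\<close> for some \<open>a\<close>, and
  submultiplicativity and symmetry bound \<open>v z\<close> by the square of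
  \<open>n\<close>.\<close>

lemma weight_locally_bounded:
  fixes v :: "'b::euclidean_space \<Rightarrow> real"
  assumes v: "weight v"
  obtains N \<delta> where "N \<ge> 1" "\<delta> > 0" "\<And>z. norm z \<le> \<delta> \<Longrightarrow> v z \<le> N"
proof -
  have [measurable]: "v \<in> borel_measurable lebesgue" and sub: "v (z + w) \<le> v z * v w"
    and ge1: "1 \<le> v z" and sym: "v (- z) = v z" for z w
    using v by (auto simp: weight_def)
  define V where "V = measure lebesgue (cball (0 :: 'b) 1)"
  have V: "V > 0" by (simp add: V_def content_cball_pos)
  define A where "A n = {z \<in> cball (0 :: 'b) 1. v z \<le> real n}" for n
  have A_sets: "A n \<in> sets lebesgue" for n
  proof -
    have "{z \<in> space lebesgue. v z \<le> real n} \<in> sets lebesgue" by measurable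
    moreover have "cball 0 1 \<in> sets (lebesgue :: 'b measure)" by simp
    moreover have "A n = cball 0 1 \<inter> {z \<in> space lebesgue. v z \<le> real n}" by (auto simp: A_def)
    ultimately show ?thesis by (simp only: sets.Int)
  qed
  have A_lm: "A n \<in> lmeasurable" for n
    by (rule bounded_set_imp_lmeasurable[OF bounded_subset[OF bounded_cball[of 0 1]] A_sets]) (auto simp: A_def)
  have "(\<lambda>n. measure lebesgue (A n)) \<longlonglongrightarrow> measure lebesgue (\<Union>n. A n)"
  proof (rule Lim_measure_incseq)
    show "incseq A" by (auto simp: incseq_def A_def)
    have "(\<Union>n. A n) \<subseteq> cball 0 1" by (auto simp: A_def)
    then show "emeasure lebesgue (\<Union>n. A n) \<noteq> \<infinity>"
      using bounded_set_imp_lmeasurable[OF bounded_subset[OF bounded_cball[of 0 1]], of "\<Union>n. A n"] A_sets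
      by (auto simp: fmeasurable_def)
  qed (use A_sets in auto)
  moreover have "(\<Union>n. A n) = cball 0 1"
    using real_arch_simple by (fastforce simp: A_def)
  ultimately have "\<forall>\<^sub>F n in sequentially. 3 / 4 * V < measure lebesgue (A n)"
    using V by (intro order_tendstoD(1)[of _ V]) (auto simp: V_def)
  then obtain n where n: "3 / 4 * V < measure lebesgue (A n)"
    by (auto simp: eventually_sequentially)
  have "((\<lambda>d :: real. (1 + d) ^ DIM('b)) \<longlongrightarrow> (1 + 0) ^ DIM('b)) (at_right 0)"
    by (intro tendsto_intros)
  then have "\<forall>\<^sub>F d :: real in at_right 0. (1 + d) ^ DIM('b) < 3 / 2"
    by (rule order_tendstoD) simp
  then have "\<forall>\<^sub>F d :: real in at_right 0. (1 + d) ^ DIM('b) < 3 / 2 \<and> d > 0"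
    using eventually_at_right_less[of "0 :: real"] by eventually_elim simp
  then obtain \<delta> :: real where \<delta>: "\<delta> > 0" "(1 + \<delta>) ^ DIM('b) < 3 / 2"
    using eventually_happens'[of "at_right (0 :: real)"] by (auto simp: trivial_limit_at_right_real)
  show thesis
  proof
    show "\<delta> > 0" by fact
    show "1 \<le> max 1 ((real n)\<^sup>2)" by simp
    fix z :: 'b assume z: "norm z \<le> \<delta>"
    have "A n \<inter> ((+) z) ` A n \<noteq> {}"
    proof
      assume disj: "A n \<inter> ((+) z) ` A n = {}"
      have zA: "((+) z) ` A n \<in> lmeasurable" by (rule measurable_translation[OF A_lm])
      have "2 * measure lebesgue (A n) = measure lebesgue (A n) + measure lebesgue (((+) z) ` A n)"
        by (simp add: measure_translation)
      also have "\<dots> = measure lebesgue (A n \<union> ((+) z) ` A n)"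
        using A_lm zA disj by (intro measure_Un3[symmetric, THEN trans[rotated]]) (auto simp: measure_Un3)
      also have "\<dots> \<le> measure lebesgue (cball (0 :: 'b) (1 + \<delta>))"
      proof (intro measure_mono_fmeasurable)
        show "A n \<union> ((+) z) ` A n \<subseteq> cball 0 (1 + \<delta>)"
        proof
          fix x assume "x \<in> A n \<union> ((+) z) ` A n"
          then consider "norm x \<le> 1" | a where "norm a \<le> 1" "x = z + a" by (auto simp: A_def)
          then show "x \<in> cball 0 (1 + \<delta>)"
          proof cases
            case 2
            then show ?thesis using z norm_triangle_ineq[of z a] by simp
          qed (use \<delta>(1) in simp)
        qed
      qed (use A_lm zA in auto)
      also have "\<dots> = (1 + \<delta>) ^ DIM('b) * V"
        using \<delta>(1) content_cball[of "1 + \<delta>" "0 :: 'b"] content_cball[of 1 "0 :: 'b"] by (simp add: V_def)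
      also have "\<dots> < 3 / 2 * V" using \<delta> V by (intro mult_strict_right_mono)
      finally show False using n by simp
    qed
    then obtain a where a: "a \<in> A n" "z + a \<in> A n" by auto
    have "v z \<le> v (z + a) * v (- a)" using sub[of "z + a" "- a"] by simp
    also have "\<dots> \<le> real n * real n"
      using a ge1[of a] unfolding sym by (intro mult_mono) (auto simp: A_def)
    finally show "v z \<le> max 1 ((real n)\<^sup>2)" by (simp add: power2_eq_square)
  qed
qed

text \<open>A vector is cut into equal pieces of norm at most \<open>\<delta>\<close>; their number
  grows linearly in the norm, and each contributes a factor of at most \<open>N\<close>.\<close>

lemma weight_exponential_growth:
  fixes v :: "'b::euclidean_space \<Rightarrow> real"
  assumes v: "weight v"
  obtains C c where "C \<ge> 0" "c \<ge> 0" "\<And>z. v z \<le> C * exp (c * norm z)"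
proof -
  obtain N \<delta> where N: "N \<ge> 1" "\<delta> > 0" "\<And>z. norm z \<le> \<delta> \<Longrightarrow> v z \<le> N"
    by (rule weight_locally_bounded[OF v], rule that)
  have sub: "v (z + w) \<le> v z * v w" and ge1: "1 \<le> v z" for z w
    using v by (auto simp: weight_def)
  have pow: "v (real (Suc k) *\<^sub>R z) \<le> v z ^ Suc k" for k z
  proof (induction k)
    case (Suc k)
    have "v (real (Suc (Suc k)) *\<^sub>R z) \<le> v z * v (real (Suc k) *\<^sub>R z)"
      using sub[of z "real (Suc k) *\<^sub>R z"]
      by (subst of_nat_Suc) (simp only: scaleR_left_distrib scaleR_one)
    also have "\<dots> \<le> v z * v z ^ Suc k"
      using ge1[of z] by (intro mult_left_mono Suc) auto
    finally show ?case by simp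
  qed simp
  show thesis
  proof
    show "0 \<le> N\<^sup>2" by simp
    show "0 \<le> ln N / \<delta>" using N by simp
    fix z :: 'b
    define k where "k = nat \<lceil>norm z / \<delta>\<rceil>"
    have k: "norm z / \<delta> \<le> real k" "real k \<le> norm z / \<delta> + 1"
      using N(2) by (auto simp: k_def of_nat_ceiling) 
    \<comment> \<open>\<open>Suc k\<close> pieces rather than \<open>k\<close>, since
      \<open>k\<close> is 0 at the origin. The extra piece and the rounding account for the constant
      \<open>N\<^sup>2\<close>.\<close>
    define y where "y = z /\<^sub>R real (Suc k)"
    have "norm z \<le> \<delta> * real (Suc k)" using k(1) N(2) by (simp add: field_simps)
    then have "norm y \<le> \<delta>" by (simp add: y_def divide_simps)
    then have "v y \<le> N" by (rule N)
    have "v z = v (real (Suc k) *\<^sub>R y)" by (simp add: y_def)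
    also have "\<dots> \<le> v y ^ Suc k" by (rule pow)
    also have "\<dots> \<le> N ^ Suc k" using \<open>v y \<le> N\<close> ge1[of y] by (intro power_mono) auto
    also have "\<dots> = exp (real (Suc k) * ln N)"
      using N(1) by (simp only: exp_of_nat_mult exp_ln)
    also have "\<dots> \<le> exp ((norm z / \<delta> + 2) * ln N)"
      using k(2) N(1) by (simp add: mult_right_mono)
    also have "\<dots> = N\<^sup>2 * exp (ln N / \<delta> * norm z)"
      using N(1) by (simp add: distrib_right exp_add exp_double)
    finally show "v z \<le> N\<^sup>2 * exp (ln N / \<delta> * norm z)" .
  qed
qed

section \<open>The modulation space as a complex subspace containing the shifted Gaussians\<close>

lemma M1_iff: "f \<in> M1 v \<longleftrightarrow> (\<integral>\<^sup>+z. ennreal (cmod (stft f z) * v z) \<partial>lebesgue) < \<infinity>"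
  by (simp add: M1_def stft_def)

lemma M1_add:
  assumes v: "weight v" and "f \<in> M1 v" "g \<in> M1 v"
  shows "f + g \<in> M1 v"
proof -
  have [measurable]: "v \<in> borel_measurable lebesgue" and ge1: "1 \<le> v z" for z
    using v by (simp_all only: weight_def)
  have [measurable]: "stft h \<in> borel_measurable lebesgue" for h :: "'a l2"
    by (rule measurable_completion) simp
  have "(\<integral>\<^sup>+z. ennreal (cmod (stft (f + g) z) * v z) \<partial>lebesgue)
      \<le> (\<integral>\<^sup>+z. ennreal (cmod (stft f z) * v z) + ennreal (cmod (stft g z) * v z) \<partial>lebesgue)"
  proof (rule nn_integral_mono)
    fix z
    have "cmod (stft (f + g) z) * v z \<le> (cmod (stft f z) + cmod (stft g z)) * v z"
      using ge1[of z] by (intro mult_right_mono) (auto simp: stft_add norm_triangle_ineq)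
    then have "ennreal (cmod (stft (f + g) z) * v z) \<le> ennreal (cmod (stft f z) * v z + cmod (stft g z) * v z)"
      by (intro ennreal_leI) (simp add: distrib_right)
    also have "\<dots> = ennreal (cmod (stft f z) * v z) + ennreal (cmod (stft g z) * v z)"
      using ge1[of z] by (intro ennreal_plus) auto
    finally show "ennreal (cmod (stft (f + g) z) * v z) \<le> \<dots>" .
  qed
  also have "\<dots> = (\<integral>\<^sup>+z. ennreal (cmod (stft f z) * v z) \<partial>lebesgue) + (\<integral>\<^sup>+z. ennreal (cmod (stft g z) * v z) \<partial>lebesgue)"
    by (rule nn_integral_add) auto
  also have "\<dots> < \<infinity>" using assms by (simp add: M1_iff)
  finally show ?thesis by (simp add: M1_iff)
qed

lemma M1_cscale:
  assumes v: "weight v" and "f \<in> M1 v"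
  shows "cscale_l2 c f \<in> M1 v"
proof -
  have [measurable]: "v \<in> borel_measurable lebesgue"
    using v by (simp_all only: weight_def)
  have [measurable]: "stft h \<in> borel_measurable lebesgue" for h :: "'a l2"
    by (rule measurable_completion) simp
  have "(\<integral>\<^sup>+z. ennreal (cmod (stft (cscale_l2 c f) z) * v z) \<partial>lebesgue)
      = (\<integral>\<^sup>+z. ennreal (cmod c) * ennreal (cmod (stft f z) * v z) \<partial>lebesgue)"
    by (intro nn_integral_cong) (simp add: stft_cscale norm_mult mult.assoc ennreal_mult')
  also have "\<dots> = ennreal (cmod c) * (\<integral>\<^sup>+z. ennreal (cmod (stft f z) * v z) \<partial>lebesgue)"
    by (rule nn_integral_cmult) simp
  also have "\<dots> < \<infinity>" using assms by (simp add: M1_iff ennreal_mult_less_top)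
  finally show ?thesis by (simp add: M1_iff)
qed

text \<open>Half of the decay of the transform absorbs the exponential growth of the weight, by
  completing the square in \<open>c * y\<close>. The other half is an integrable Gaussian of rate
  1/4, and \<open>K\<close> collects the constants.\<close>

lemma M1_tf_gaussian:
  fixes a :: "'a::euclidean_space \<times> 'a"
  assumes v: "weight v"
  shows "tf_l2 a gaussian \<in> M1 v"
proof -
  obtain C c where C: "C \<ge> 0" "c \<ge> 0" "\<And>z. v z \<le> C * exp (c * norm z)"
    by (rule weight_exponential_growth[OF v], rule that)
  let ?d = "2 powr (- (DIM('a) / 2))"
  define K where "K = ?d * C * exp (c * norm a + c\<^sup>2 / pi)"
  have K: "K \<ge> 0" using C by (simp add: K_def)
  have le: "cmod (stft (tf_l2 a gaussian) z) * v z \<le> K * gauss_exp (1/4) (z - a)" for z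
  proof -
    define y where "y = norm (z - a)"
    have yy: "(z - a) \<bullet> (z - a) = y\<^sup>2" by (simp add: y_def power2_norm_eq_inner)
    have "norm z \<le> norm a + y" unfolding y_def by (metis norm_triangle_sub)
    then have "c * norm z \<le> c * norm a + c * y"
      using C(2) by (simp add: mult_left_mono flip: distrib_left)
    moreover have "c * y \<le> c\<^sup>2 / pi + pi / 4 * y\<^sup>2"
    proof -
      have "0 \<le> (sqrt pi / 2 * y - c / sqrt pi)\<^sup>2" by simp
      also have "\<dots> = pi / 4 * y\<^sup>2 + c\<^sup>2 / pi - c * y"
        by (simp add: power2_diff power_mult_distrib power_divide) 
      finally show ?thesis by simp
    qed
    ultimately have le1: "- (pi / 2 * y\<^sup>2) + c * norm z \<le> (c * norm a + c\<^sup>2 / pi) + (- (pi * (1/4) * y\<^sup>2))"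
      by simp
    have "cmod (stft (tf_l2 a gaussian) z) * v z \<le> (?d * exp (- (pi / 2 * y\<^sup>2))) * (C * exp (c * norm z))"
      unfolding norm_stft_tf_gaussian yy using C(3) by (intro mult_left_mono) auto
    also have "\<dots> = ?d * C * exp (- (pi / 2 * y\<^sup>2) + c * norm z)"
      by (simp only: exp_add mult_ac)
    also have "\<dots> \<le> ?d * C * exp ((c * norm a + c\<^sup>2 / pi) + (- (pi * (1/4) * y\<^sup>2)))"
      using le1 C(1) by (intro mult_left_mono) auto
    also have "\<dots> = K * exp (- (pi * (1/4) * y\<^sup>2))"
      by (simp only: K_def exp_add mult.assoc)
    finally show ?thesis unfolding yy .
  qed
  have int: "integrable lborel (\<lambda>z. K * gauss_exp (1/4) (z - a))"
    by (intro integrable_mult_right integrable_gauss) simp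
  have "(\<integral>\<^sup>+z. ennreal (cmod (stft (tf_l2 a gaussian) z) * v z) \<partial>lebesgue)
      \<le> (\<integral>\<^sup>+z. ennreal (K * gauss_exp (1/4) (z - a)) \<partial>lebesgue)"
    by (intro nn_integral_mono ennreal_leI le)
  also have "\<dots> = (\<integral>\<^sup>+z. ennreal (K * gauss_exp (1/4) (z - a)) \<partial>lborel)"
    by (rule nn_integral_completion)
  also have "\<dots> < \<infinity>"
    by (subst nn_integral_eq_integral[OF int]) (use K in auto)
  finally show ?thesis by (simp add: M1_iff)
qed

text \<open>A vector orthogonal to the space is orthogonal to every shifted Gaussian, so its
  transform vanishes. Real orthogonality controls only real parts; testing also with the multiple by
  the imaginary unit gives the imaginary parts.\<close>

lemma closure_M1:
  assumes v: "weight v"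
  shows "closure (M1 v) = UNIV"
proof (rule real_inner_dense_if_orthogonal_trivial)
  have "0 \<in> M1 v" by (simp add: M1_iff stft_def)
  then show "subspace (M1 v)"
    using M1_add[OF v] M1_cscale[OF v] by (auto simp: subspace_def scaleR_l2_def)
  fix e assume e: "\<And>u. u \<in> M1 v \<Longrightarrow> inner e u = 0"
  show "e = 0"
  proof (rule stft_eq_0_imp_eq_0)
    fix z
    have "Re (stft e z) = 0"
      using e[OF M1_tf_gaussian[OF v, of z]] by (simp add: inner_l2_def stft_def)
    moreover have "Im (stft e z) = 0"
      using e[OF M1_cscale[OF v M1_tf_gaussian[OF v, of z], of \<i>]]
      by (simp add: inner_l2_def stft_def cinner_l2_cscale_right)
    ultimately show "stft e z = 0" by (simp add: complex_eq_iff)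
  qed
qed

section \<open>Positive definite functions on a lattice\<close>

text \<open>Dominated convergence for sums: outside a finite set both the sequence and its limit are
  bounded by a tail of \<open>b\<close>, and on the finite set the limit is termwise.\<close>

lemma tannery:
  fixes x :: "nat \<Rightarrow> 'i \<Rightarrow> complex"
  assumes b: "b summable_on A" and le: "\<And>n l. l \<in> A \<Longrightarrow> cmod (x n l) \<le> b l"
    and lim: "\<And>l. l \<in> A \<Longrightarrow> (\<lambda>n. x n l) \<longlonglongrightarrow> y l"
  shows "(\<lambda>n. infsum (x n) A) \<longlonglongrightarrow> infsum y A"
proof -
  have b0: "0 \<le> b l" if "l \<in> A" for l using le[OF that, of 0] norm_ge_zero order_trans by blast
  have ley: "cmod (y l) \<le> b l" if "l \<in> A" for l
    using LIMSEQ_le_const2[OF tendsto_norm[OF lim[OF that]]] le[OF that] by blast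
  have xs: "x n summable_on A" for n
    by (rule abs_summable_summable[OF Infinite_Sum.abs_summable_on_comparison_test'[OF b le]])
  have ys: "y summable_on A"
    by (rule abs_summable_summable[OF Infinite_Sum.abs_summable_on_comparison_test'[OF b ley]])
  have "(\<lambda>n. infsum (\<lambda>l. x n l - y l) A) \<longlonglongrightarrow> 0"
  proof (rule LIMSEQ_I)
    fix e :: real assume e: "e > 0"
    have "\<forall>\<^sub>F F in finite_subsets_at_top A. dist (sum b F) (infsum b A) < e / 4"
      using tendstoD[OF infsum_tendsto[OF b], of "e / 4"] e by simp
    then obtain F where F: "finite F" "F \<subseteq> A" "dist (sum b F) (infsum b A) < e / 4"
      by (auto simp: eventually_finite_subsets_at_top)
    have bF: "b summable_on (A - F)" by (rule summable_on_cofin_subset[OF b F(1)])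
    have "infsum b A = infsum b (F \<union> (A - F))" using F by (simp add: Un_absorb1)
    also have "\<dots> = sum b F + infsum b (A - F)"
      using F bF by (subst infsum_Un_disjoint) auto
    finally have tail: "infsum b (A - F) < e / 4"
      using F(3) by (simp add: dist_real_def)
    have "(\<lambda>n. \<Sum>l\<in>F. x n l - y l) \<longlonglongrightarrow> (\<Sum>l\<in>F. y l - y l)"
      using F by (intro tendsto_sum tendsto_diff tendsto_const lim) auto
    then have "(\<lambda>n. \<Sum>l\<in>F. x n l - y l) \<longlonglongrightarrow> 0" by simp
    then obtain N where N: "\<And>n. n \<ge> N \<Longrightarrow> cmod (\<Sum>l\<in>F. x n l - y l) < e / 2"
      using LIMSEQ_D[of _ 0 "e / 2"] e by auto
    have "cmod (infsum (\<lambda>l. x n l - y l) A) < e" if "n \<ge> N" for n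
    proof -
      have zb: "cmod (x n l - y l) \<le> b l + b l" if "l \<in> A - F" for l
        using norm_triangle_ineq4[of "x n l" "y l"] le[of l n] ley[of l] that by simp
      have dF: "(\<lambda>l. x n l - y l) summable_on (A - F)"
        by (rule abs_summable_summable[OF Infinite_Sum.abs_summable_on_comparison_test'[OF summable_on_add[OF bF bF] zb]])
      have "infsum (\<lambda>l. x n l - y l) A = infsum (\<lambda>l. x n l - y l) (F \<union> (A - F))"
        using F by (simp add: Un_absorb1)
      also have "\<dots> = (\<Sum>l\<in>F. x n l - y l) + infsum (\<lambda>l. x n l - y l) (A - F)"
        using F dF by (subst infsum_Un_disjoint) auto
      also have "cmod \<dots> \<le> cmod (\<Sum>l\<in>F. x n l - y l) + cmod (infsum (\<lambda>l. x n l - y l) (A - F))"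
        by (rule norm_triangle_ineq)
      also have "cmod (infsum (\<lambda>l. x n l - y l) (A - F)) \<le> infsum b (A - F) + infsum b (A - F)"
        by (rule norm_infsum_le[OF has_sum_infsum[OF dF] has_sum_add[OF has_sum_infsum[OF bF] has_sum_infsum[OF bF]] zb])
      finally show ?thesis using N[OF that] tail by simp
    qed
    then show "\<exists>N. \<forall>n\<ge>N. cmod (infsum (\<lambda>l. x n l - y l) A - 0) < e" by auto
  qed
  moreover have "infsum (\<lambda>l. x n l - y l) A = infsum (x n) A - infsum y A" for n
    using infsum_add[OF xs[of n] iffD2[OF summable_on_uminus ys]] by (simp add: infsum_uminus)
  ultimately show ?thesis by (simp add: LIM_zero_iff)
qed

text \<open>The Schur product theorem for Gram matrices. Writing the first matrix as an integral
  over \<open>t\<close> turns the double sum, for each \<open>t\<close>, into the squared norm of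
  the combination of the \<open>v a\<close> with coefficients \<open>cnj (U a t)\<close>.\<close>

lemma Re_schur_gram_nonneg:
  fixes u v :: "'i \<Rightarrow> 'a::euclidean_space l2"
  assumes "finite J"
  shows "0 \<le> Re (\<Sum>a\<in>J. \<Sum>b\<in>J. cnj (cinner_l2 (u a) (u b)) * cinner_l2 (v a) (v b))"
proof -
  have "\<exists>U. \<forall>a. sq_integrable (U a) \<and> u a = abs_l2 (U a)"
    by (intro choice allI) (metis l2_obtain)
  then obtain U where U: "\<And>a. sq_integrable (U a)" "\<And>a. u a = abs_l2 (U a)" by blast
  have int: "integrable lborel (\<lambda>t. U b t * cnj (U a t) * cinner_l2 (v a) (v b))" for a b
    by (intro integrable_mult_left integrable_mult_cnj U)
  have "cnj (cinner_l2 (u a) (u b)) * cinner_l2 (v a) (v b)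
      = (\<integral>t. U b t * cnj (U a t) * cinner_l2 (v a) (v b) \<partial>lborel)" for a b
    unfolding U(2) cinner_l2_cnj by (simp add: cinner_l2_abs U(1))
  then have "(\<Sum>a\<in>J. \<Sum>b\<in>J. cnj (cinner_l2 (u a) (u b)) * cinner_l2 (v a) (v b))
      = (\<Sum>a\<in>J. \<Sum>b\<in>J. \<integral>t. U b t * cnj (U a t) * cinner_l2 (v a) (v b) \<partial>lborel)"
    by (simp only:)
  also have "\<dots> = (\<integral>t. (\<Sum>a\<in>J. \<Sum>b\<in>J. U b t * cnj (U a t) * cinner_l2 (v a) (v b)) \<partial>lborel)"
    by (subst Bochner_Integration.integral_sum, intro Bochner_Integration.integrable_sum int,
        intro sum.cong refl Bochner_Integration.integral_sum[symmetric] int)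
  also have "\<dots> = (\<integral>t. complex_of_real ((norm (\<Sum>a\<in>J. cscale_l2 (cnj (U a t)) (v a)))\<^sup>2) \<partial>lborel)"
  proof (intro Bochner_Integration.integral_cong refl)
    fix t
    show "(\<Sum>a\<in>J. \<Sum>b\<in>J. U b t * cnj (U a t) * cinner_l2 (v a) (v b))
        = complex_of_real ((norm (\<Sum>a\<in>J. cscale_l2 (cnj (U a t)) (v a)))\<^sup>2)"
      unfolding cinner_l2_self[symmetric] cinner_l2_sum_left cinner_l2_sum_right
      by (subst sum.swap, intro sum.cong refl) (simp add: cinner_l2_cscale_left cinner_l2_cscale_right mult_ac)
  qed
  also have "Re \<dots> = (\<integral>t. (norm (\<Sum>a\<in>J. cscale_l2 (cnj (U a t)) (v a)))\<^sup>2 \<partial>lborel)"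
    by (simp only: integral_complex_of_real Re_complex_of_real)
  finally show ?thesis by simp
qed

text \<open>Amenability of the lattice enters through the Gaussian weights \<open>w c\<close>, whose normalized
  autocorrelations \<open>r c l / r c 0\<close> tend to 1 as \<open>c\<close> tends to 0.\<close>

lemma Re_infsum_nonneg_if_pos_def:
  fixes \<Lambda> :: "'b::euclidean_space set" and p :: "'b \<Rightarrow> complex"
  assumes \<Lambda>: "lattice_subgroup \<Lambda>"
    and p: "(\<lambda>l. cmod (p l)) summable_on \<Lambda>"
    and pos: "\<And>F w. finite F \<Longrightarrow> F \<subseteq> \<Lambda> \<Longrightarrow> 0 \<le> Re (\<Sum>l\<in>F. \<Sum>m\<in>F. complex_of_real (w l * w m) * p (l - m))"
  shows "0 \<le> Re (infsum p \<Lambda>)"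
proof -
  have \<Lambda>_cl: "0 \<in> \<Lambda>" "\<And>x y. x \<in> \<Lambda> \<Longrightarrow> y \<in> \<Lambda> \<Longrightarrow> x + y \<in> \<Lambda>" "\<And>x. x \<in> \<Lambda> \<Longrightarrow> - x \<in> \<Lambda>"
    "\<And>x y. x \<in> \<Lambda> \<Longrightarrow> y \<in> \<Lambda> \<Longrightarrow> x - y \<in> \<Lambda>"
    using \<Lambda> lattice_subgroup_diff[OF \<Lambda>] by (auto simp: lattice_subgroup_def)
  define w where "w c x = gauss_exp c x" for c and x :: 'b
  define r where "r c l = infsum (\<lambda>m. w c (l + m) * w c m) \<Lambda>" for c l
  have w0: "0 < w c x" for c x by (simp add: w_def)
  have w_even: "w c (- x) = w c x" for c x by (simp add: w_def)
  have w1: "w c x \<le> 1" if "c > 0" for c x using that by (simp add: w_def)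
  have w_sum: "w c summable_on \<Lambda>" if c: "c > 0" for c
  proof -
    obtain C where C: "C \<ge> 0" "\<And>z F. finite F \<Longrightarrow> F \<subseteq> \<Lambda> \<Longrightarrow> (\<Sum>l\<in>F. gauss_exp c (z - l)) \<le> C"
      by (rule lattice_gauss_sum_bounded[OF \<Lambda> c], rule that)
    show ?thesis
    proof (rule nonneg_bdd_above_summable_on)
      show "bdd_above (sum (w c) ` {F. F \<subseteq> \<Lambda> \<and> finite F})"
        using C(2)[of _ 0] by (intro bdd_aboveI2[of _ _ C]) (simp add: w_def)
    qed (simp add: w_def)
  qed
  have ww_sum: "(\<lambda>m. w c (l + m) * w c m) summable_on \<Lambda>" if "c > 0" for c l
    by (rule summable_on_comparison_test[OF w_sum[OF that]])
      (use w0 w1[OF that] in \<open>auto simp: less_imp_le mult_left_le_one_le\<close>)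
  have r0: "1 \<le> r c 0" if "c > 0" for c
  proof -
    have "sum (\<lambda>m. w c (0 + m) * w c m) {0} \<le> r c 0"
      unfolding r_def using \<Lambda>_cl w0 by (intro finite_sum_le_infsum ww_sum[OF that]) (auto simp: less_imp_le)
    then show ?thesis by (simp add: w_def)
  qed
  have r_nonneg: "0 \<le> r c l" for c l
    unfolding r_def by (intro infsum_nonneg mult_nonneg_nonneg less_imp_le[OF w0])
  have bij_add: "bij_betw (\<lambda>m. l + m) \<Lambda> \<Lambda>" if "l \<in> \<Lambda>" for l
    using \<Lambda>_cl that by (intro bij_betw_byWitness[where f' = "\<lambda>m. m - l"]) auto
  have bij_neg: "bij_betw uminus \<Lambda> \<Lambda>"
    using \<Lambda>_cl by (intro bij_betw_byWitness[where f' = uminus]) auto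
  \<comment> \<open>Twice a product is at most the sum of the squares, and a shift by
    \<open>l\<close> permutes the lattice.\<close>
  have r_le: "r c l \<le> r c 0" if "c > 0" "l \<in> \<Lambda>" for c l
  proof -
    have s: "(\<lambda>m. w c m * w c m) summable_on \<Lambda>" using ww_sum[OF that(1), of 0] by simp
    have s': "(\<lambda>m. w c (l + m) * w c (l + m)) summable_on \<Lambda>"
      using s summable_on_reindex_bij_betw[OF bij_add[OF that(2)], of "\<lambda>m. w c m * w c m"] by simp
    have "2 * r c l = infsum (\<lambda>m. 2 * (w c (l + m) * w c m)) \<Lambda>"
      unfolding r_def by (simp add: infsum_cmult_right')
    also have "\<dots> \<le> infsum (\<lambda>m. w c (l + m) * w c (l + m) + w c m * w c m) \<Lambda>"
    proof (intro infsum_mono summable_on_add s s' summable_on_cmult_right ww_sum that)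
      fix m
      show "2 * (w c (l + m) * w c m) \<le> w c (l + m) * w c (l + m) + w c m * w c m"
        using sum_squares_bound[of "w c (l + m)" "w c m"] by (simp add: power2_eq_square)
    qed
    also have "\<dots> = infsum (\<lambda>m. w c (l + m) * w c (l + m)) \<Lambda> + infsum (\<lambda>m. w c m * w c m) \<Lambda>"
      by (rule infsum_add[OF s' s])
    also have "infsum (\<lambda>m. w c (l + m) * w c (l + m)) \<Lambda> = infsum (\<lambda>m. w c m * w c m) \<Lambda>"
      by (rule infsum_reindex_bij_betw[OF bij_add[OF that(2)]])
    finally show ?thesis by (simp add: r_def)
  qed
  \<comment> \<open>Substituting \<open>- m\<close> allows the products at \<open>l + m\<close> and
    \<open>l - m\<close> to be averaged. Their sum contains \<open>x + inverse x\<close>, which is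
    at least 2. The resulting lower bound \<open>w c l\<close> for the normalized autocorrelation
    tends to 1 as \<open>c\<close> tends to 0.\<close>
  have r_ge: "w c l * r c 0 \<le> r c l" if "c > 0" "l \<in> \<Lambda>" for c l
  proof -
    have s: "(\<lambda>m. w c m * w c m) summable_on \<Lambda>" using ww_sum[OF that(1), of 0] by simp
    have neg: "w c (l + - m) * w c (- m) = w c (l - m) * w c m" for m
      by (simp add: w_even)
    have s': "(\<lambda>m. w c (l - m) * w c m) summable_on \<Lambda>"
      using ww_sum[OF that(1), of l] summable_on_reindex_bij_betw[OF bij_neg, of "\<lambda>m. w c (l + m) * w c m"]
      by (simp add: w_even)
    have r': "r c l = infsum (\<lambda>m. w c (l - m) * w c m) \<Lambda>"
      using infsum_reindex_bij_betw[OF bij_neg, of "\<lambda>m. w c (l + m) * w c m"] by (simp add: r_def w_even)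
    have "2 * (w c l * r c 0) = infsum (\<lambda>m. 2 * (w c l * (w c m * w c m))) \<Lambda>"
      unfolding r_def by (simp add: infsum_cmult_right')
    also have "\<dots> \<le> infsum (\<lambda>m. w c (l + m) * w c m + w c (l - m) * w c m) \<Lambda>"
    proof (intro infsum_mono summable_on_add s s' summable_on_cmult_right ww_sum that)
      fix m
      define x where "x = exp (2 * pi * c * (l \<bullet> m))"
      have x: "x > 0" by (simp add: x_def)
      have "w c (l - m) = w c l * w c m * x" "w c (l + m) = w c l * w c m * inverse x"
        unfolding w_def x_def exp_minus[symmetric] exp_add[symmetric]
        by (simp_all add: inner_diff_left inner_diff_right inner_add_left inner_add_right inner_commute[of m l] algebra_simps)
      moreover have "2 \<le> x + inverse x"
      proof -
        have "0 \<le> (x - 1)\<^sup>2 / x" using x by simp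
        also have "\<dots> = x + inverse x - 2" using x by (simp add: power2_eq_square field_simps)
        finally show ?thesis by simp
      qed
      ultimately have "w c l * w c m * w c m * 2 \<le> w c (l + m) * w c m + w c (l - m) * w c m"
        using mult_left_mono[of 2 "x + inverse x" "w c l * w c m * w c m"] w0[of c l] w0[of c m]
        by (simp add: algebra_simps)
      then show "2 * (w c l * (w c m * w c m)) \<le> w c (l + m) * w c m + w c (l - m) * w c m"
        by (simp add: mult_ac)
    qed
    also have "\<dots> = 2 * r c l"
      using infsum_add[OF ww_sum[OF that(1), of l] s'] by (simp add: r' [symmetric] r_def [symmetric])
    finally show ?thesis by simp
  qed
  have avg: "0 \<le> Re (infsum (\<lambda>l. p l * complex_of_real (r c l)) \<Lambda>)" if c: "c > 0" for c
  proof -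
    define h where "h = (\<lambda>(l, m). p l * complex_of_real (w c (l + m) * w c m))"
    have "(\<lambda>x. norm (h x)) summable_on \<Lambda> \<times> \<Lambda>"
    proof (rule iffD2[OF Infinite_Sum.abs_summable_on_Sigma_iff], intro conjI ballI)
      fix l
      show "(\<lambda>m. norm (h (l, m))) summable_on \<Lambda>"
        using summable_on_cmult_right[OF ww_sum[OF c, of l], of "cmod (p l)"] w0
        by (simp add: h_def norm_mult abs_mult less_imp_le)
      have "infsum (\<lambda>m. norm (h (l, m))) \<Lambda> = cmod (p l) * r c l" for l
        unfolding r_def using w0 by (simp add: h_def norm_mult abs_mult less_imp_le infsum_cmult_right')
      moreover have "(\<lambda>l. norm (cmod (p l) * r c l)) summable_on \<Lambda>"
        by (rule Infinite_Sum.abs_summable_on_comparison_test'[OF summable_on_cmult_left[OF p, of "r c 0"]])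
          (use r_le[OF c] r_nonneg in \<open>auto simp: abs_mult intro: mult_left_mono\<close>)
      ultimately show "(\<lambda>l. norm (infsum (\<lambda>m. norm (h (l, m))) \<Lambda>)) summable_on \<Lambda>" by simp
    qed
    then have hs: "h summable_on \<Lambda> \<times> \<Lambda>" by (rule abs_summable_summable)
    have eq: "infsum h (\<Lambda> \<times> \<Lambda>) = infsum (\<lambda>l. p l * complex_of_real (r c l)) \<Lambda>"
    proof -
      have "infsum h (\<Lambda> \<times> \<Lambda>) = infsum (\<lambda>l. infsum (\<lambda>m. h (l, m)) \<Lambda>) \<Lambda>"
        using hs by (intro infsum_Sigma_banach[symmetric]) auto
      also have "(\<lambda>l. infsum (\<lambda>m. h (l, m)) \<Lambda>) = (\<lambda>l. p l * complex_of_real (r c l))"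
      proof
        fix l
        have "((\<lambda>m. complex_of_real (w c (l + m) * w c m)) has_sum complex_of_real (r c l)) \<Lambda>"
          unfolding r_def by (intro has_sum_of_real has_sum_infsum ww_sum c)
        from has_sum_cmult_right[OF this, of "p l"]
        show "infsum (\<lambda>m. h (l, m)) \<Lambda> = p l * complex_of_real (r c l)"
          unfolding h_def prod.case by (rule infsumI)
      qed
      finally show ?thesis .
    qed
    \<comment> \<open>The substitution of \<open>l - m\<close> for \<open>l\<close> turns the
      autocorrelation sum into the quadratic form with entries
      \<open>w c l * w c m * p (l - m)\<close>.\<close>
    have bij: "bij_betw (\<lambda>(l, m). (l - m, m)) (\<Lambda> \<times> \<Lambda>) (\<Lambda> \<times> \<Lambda>)"
      using \<Lambda>_cl by (intro bij_betw_byWitness[where f' = "\<lambda>(l, m). (l + m, m)"]) auto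
    have "((\<lambda>x. h (case x of (l, m) \<Rightarrow> (l - m, m))) has_sum infsum h (\<Lambda> \<times> \<Lambda>)) (\<Lambda> \<times> \<Lambda>)"
      unfolding has_sum_reindex_bij_betw[OF bij] by (rule has_sum_infsum[OF hs])
    then have "((\<lambda>x. Re (h (case x of (l, m) \<Rightarrow> (l - m, m)))) has_sum Re (infsum h (\<Lambda> \<times> \<Lambda>))) (\<Lambda> \<times> \<Lambda>)"
      by (rule has_sum_Re)
    then have lim: "(sum (\<lambda>x. Re (h (case x of (l, m) \<Rightarrow> (l - m, m)))) \<longlongrightarrow> Re (infsum h (\<Lambda> \<times> \<Lambda>))) (finite_subsets_at_top (\<Lambda> \<times> \<Lambda>))"
      by (simp add: has_sum_def)
    define s where "s = sum (\<lambda>x. Re (h (case x of (l, m) \<Rightarrow> (l - m, m))))"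
    have "0 \<le> Re (infsum h (\<Lambda> \<times> \<Lambda>))"
    proof (rule ccontr)
      assume "\<not> 0 \<le> Re (infsum h (\<Lambda> \<times> \<Lambda>))"
      then have "\<forall>\<^sub>F X in finite_subsets_at_top (\<Lambda> \<times> \<Lambda>). s X < 0"
        using lim unfolding s_def by (intro order_tendstoD(2)) auto
      then have "\<exists>X. finite X \<and> X \<subseteq> \<Lambda> \<times> \<Lambda> \<and> (\<forall>Y. finite Y \<and> X \<subseteq> Y \<and> Y \<subseteq> \<Lambda> \<times> \<Lambda> \<longrightarrow> s Y < 0)"
        by (simp only: eventually_finite_subsets_at_top)
      then obtain X where X: "finite X" "X \<subseteq> \<Lambda> \<times> \<Lambda>"
        "\<And>Y. finite Y \<and> X \<subseteq> Y \<and> Y \<subseteq> \<Lambda> \<times> \<Lambda> \<Longrightarrow> s Y < 0"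
        by (elim exE conjE) blast
      \<comment> \<open>Positivity is available only on squares \<open>F \<times> F\<close>, so the
        finite set of pairs is enlarged to one.\<close>
      define F where "F = fst ` X \<union> snd ` X"
      have F: "finite F" "F \<subseteq> \<Lambda>" "X \<subseteq> F \<times> F"
      proof -
        show "finite F" using X(1) by (simp add: F_def)
        show "F \<subseteq> \<Lambda>" using subsetD[OF X(2)] by (auto simp: F_def)
        show "X \<subseteq> F \<times> F" by (intro subsetI) (simp add: F_def mem_Times_iff)
      qed
      have "s (F \<times> F)
          = Re (\<Sum>l\<in>F. \<Sum>m\<in>F. complex_of_real (w c l * w c m) * p (l - m))"
        unfolding Re_sum s_def by (subst sum.cartesian_product, intro sum.cong refl) (auto simp: h_def mult_ac)
      moreover have "\<dots> \<ge> 0" by (rule pos[OF F(1,2)])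
      ultimately show False using X(3)[of "F \<times> F"] F by (simp add: Sigma_mono)
    qed
    then show ?thesis by (simp add: eq)
  qed
  define c where "c n = inverse (real (Suc n))" for n
  have c: "c n > 0" for n by (simp add: c_def)
  have "(\<lambda>n. infsum (\<lambda>l. p l * complex_of_real (r (c n) l / r (c n) 0)) \<Lambda>) \<longlonglongrightarrow> infsum p \<Lambda>"
  proof (rule tannery[OF p])
    fix n l assume l: "l \<in> \<Lambda>"
    have "r (c n) l / r (c n) 0 \<le> 1" using r_le[OF c l, of n] r0[OF c, of n] by (simp add: divide_le_eq)
    moreover have "0 \<le> r (c n) l / r (c n) 0" by (intro divide_nonneg_nonneg r_nonneg)
    ultimately show "cmod (p l * complex_of_real (r (c n) l / r (c n) 0)) \<le> cmod (p l)"
      unfolding norm_mult norm_of_real by (intro mult_left_le) auto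
  next
    fix l assume l: "l \<in> \<Lambda>"
    have "(\<lambda>n. r (c n) l / r (c n) 0) \<longlonglongrightarrow> 1"
    proof (rule tendsto_sandwich)
      show "\<forall>\<^sub>F n in sequentially. w (c n) l \<le> r (c n) l / r (c n) 0"
        using r_ge[OF c l] r0[OF c] by (intro always_eventually allI) (subst pos_le_divide_eq, auto intro: less_le_trans[of 0 1])
      show "\<forall>\<^sub>F n in sequentially. r (c n) l / r (c n) 0 \<le> 1"
        using r_le[OF c l] r0[OF c] by (intro always_eventually allI) (subst pos_divide_le_eq, auto intro: less_le_trans[of 0 1])
      have "(\<lambda>n. gauss_exp (c n) l) \<longlonglongrightarrow> exp (- (pi * 0 * (l \<bullet> l)))"
        unfolding c_def by (intro tendsto_intros LIMSEQ_inverse_real_of_nat)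
      then show "(\<lambda>n. w (c n) l) \<longlonglongrightarrow> 1" by (simp add: w_def)
    qed simp
    then have "(\<lambda>n. p l * complex_of_real (r (c n) l / r (c n) 0)) \<longlonglongrightarrow> p l * complex_of_real 1"
      by (intro tendsto_intros)
    then show "(\<lambda>n. p l * complex_of_real (r (c n) l / r (c n) 0)) \<longlonglongrightarrow> p l" by simp
  qed
  then have "(\<lambda>n. Re (infsum (\<lambda>l. p l * complex_of_real (r (c n) l / r (c n) 0)) \<Lambda>)) \<longlonglongrightarrow> Re (infsum p \<Lambda>)"
    by (rule tendsto_Re)
  moreover have "0 \<le> Re (infsum (\<lambda>l. p l * complex_of_real (r (c n) l / r (c n) 0)) \<Lambda>)" for n
  proof -
    have "infsum (\<lambda>l. p l * complex_of_real (r (c n) l / r (c n) 0)) \<Lambda>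
        = infsum (\<lambda>l. p l * complex_of_real (r (c n) l)) \<Lambda> * complex_of_real (inverse (r (c n) 0))"
      unfolding infsum_cmult_left'[symmetric] by (simp add: divide_inverse mult.assoc)
    then show ?thesis using avg[OF c, of n] r_nonneg[of "c n" 0] by simp
  qed
  ultimately show ?thesis by (intro LIMSEQ_le_const) auto
qed

section \<open>The pre-inner product\<close>

abbreviation coeff :: "'a::euclidean_space l2 \<Rightarrow> 'a l2 \<Rightarrow> 'a \<times> 'a \<Rightarrow> complex" where
  "coeff f g l \<equiv> cinner_l2 f (tf_l2 l g)"

abbreviation tf_op :: "complex \<Rightarrow> 'a::euclidean_space \<times> 'a \<Rightarrow> 'a l2 \<Rightarrow>\<^sub>L 'a l2" where
  "tf_op c l \<equiv> cmult_op c o\<^sub>L tf_shift l"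

text \<open>Feichtinger's algebra, that is \<^const>\<open>M1\<close> for the weight 1.\<close>

definition S0 :: "'a::euclidean_space l2 set" where
  "S0 = {f. integrable lborel (stft f)}"

lemma S0_add: "f \<in> S0 \<Longrightarrow> g \<in> S0 \<Longrightarrow> f + g \<in> S0"
  by (simp add: S0_def stft_add [abs_def])

lemma S0_diff: "f \<in> S0 \<Longrightarrow> g \<in> S0 \<Longrightarrow> f - g \<in> S0"
  by (simp add: S0_def stft_diff [abs_def])

lemma M1_subset_S0: "weight v \<Longrightarrow> M1 v \<subseteq> S0"
  by (auto simp: S0_def integrable_stft_if_M1)

section \<open>Convergence of the operator series and sesquilinearity\<close>

lemma abs_summable_S0:
  assumes "lattice_subgroup \<Lambda>" "f \<in> S0" "g \<in> S0"
  shows "(\<lambda>l. cmod (coeff f g l)) summable_on \<Lambda>"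
  using assms by (intro abs_summable_cinner_tf_l2) (auto simp: S0_def)

lemma abs_summable_S0':
  assumes "lattice_subgroup \<Lambda>" "f \<in> S0" "g \<in> S0"
  shows "(\<lambda>l. cmod (cinner_l2 (tf_l2 l g) f)) summable_on \<Lambda>"
  using abs_summable_S0[OF assms] by (metis (no_types, lifting) cinner_l2_cnj complex_mod_cnj summable_on_cong)

lemma norm_cmult_op: "norm (cmult_op c) \<le> cmod c"
  by (rule norm_blinfun_bound) (simp_all add: norm_cscale_l2)

lemma cmult_op_zero: "cmult_op 0 = 0"
  using norm_cmult_op[of 0] by simp

lemma norm_cmult_op_tf_shift: "norm (tf_op c z) \<le> cmod c"
  by (rule norm_blinfun_bound) (simp_all add: norm_cscale_l2 norm_tf_l2)

lemma has_sum_pre_ip: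
  assumes "lattice_subgroup \<Lambda>" "f \<in> S0" "g \<in> S0"
  shows "((\<lambda>l. tf_op (coeff f g l) l) has_sum pre_ip \<Lambda> f g) \<Lambda>"
proof -
  have "(\<lambda>l. tf_op (coeff f g l) l) summable_on \<Lambda>"
    by (rule abs_summable_summable[OF Infinite_Sum.abs_summable_on_comparison_test'[OF abs_summable_S0[OF assms]]])
      (rule norm_cmult_op_tf_shift)
  then show ?thesis unfolding pre_ip_def tf_shift_apply by (rule has_sum_infsum)
qed

lemma pre_ip_in_nc_torus:
  assumes "lattice_subgroup \<Lambda>" "f \<in> S0" "g \<in> S0"
  shows "pre_ip \<Lambda> f g \<in> nc_torus \<Lambda>"
  unfolding nc_torus_def
proof (rule Lim_in_closed_set[OF closed_closure])
  show "(sum (\<lambda>l. tf_op (coeff f g l) l) \<longlongrightarrow> pre_ip \<Lambda> f g) (finite_subsets_at_top \<Lambda>)"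
    using has_sum_pre_ip[OF assms] by (simp add: has_sum_def)
  show "\<forall>\<^sub>F F in finite_subsets_at_top \<Lambda>. sum (\<lambda>l. tf_op (coeff f g l) l) F
      \<in> closure {(\<Sum>l\<in>F. tf_op (a l) l) | F a. finite F \<and> F \<subseteq> \<Lambda>}"
  proof (rule eventually_finite_subsets_at_top_weakI)
    fix X assume "finite X" "X \<subseteq> \<Lambda>"
    then show "sum (\<lambda>l. tf_op (coeff f g l) l) X
      \<in> closure {(\<Sum>l\<in>F. tf_op (a l) l) | F a. finite F \<and> F \<subseteq> \<Lambda>}"
      by (intro subsetD[OF closure_subset] CollectI exI[of _ X] exI[of _ "\<lambda>l. coeff f g l"]) simp
  qed
qed simp

lemma bounded_linear_blinfun_cinner: "bounded_linear (\<lambda>A. cinner_l2 (blinfun_apply A k) k')"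
  by (rule bounded_linear_compose[OF bounded_linear_cinner_l2_left blinfun.bounded_linear_left])

lemma has_sum_cinner_pre_ip:
  assumes "lattice_subgroup \<Lambda>" "f \<in> S0" "g \<in> S0"
  shows "((\<lambda>l. coeff f g l * cinner_l2 (tf_l2 l k) k') has_sum cinner_l2 (pre_ip \<Lambda> f g k) k') \<Lambda>"
  using has_sum_bounded_linear[OF bounded_linear_blinfun_cinner has_sum_pre_ip[OF assms], of k k']
  by (simp add: cinner_l2_cscale_left)

lemma blinfun_eqI_cinner:
  fixes A B :: "'a::euclidean_space l2 \<Rightarrow>\<^sub>L 'a l2"
  assumes "\<And>k k'. cinner_l2 (blinfun_apply A k) k' = cinner_l2 (blinfun_apply B k) k'"
  shows "A = B"
  using assms by (intro blinfun_eqI l2_eqI)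

lemma pre_ip_add_left:
  assumes "lattice_subgroup \<Lambda>" "f \<in> S0" "f' \<in> S0" "g \<in> S0"
  shows "pre_ip \<Lambda> (f + f') g = pre_ip \<Lambda> f g + pre_ip \<Lambda> f' g"
proof (rule blinfun_eqI_cinner)
  fix k k' :: "'a l2"
  show "cinner_l2 (pre_ip \<Lambda> (f + f') g k) k' = cinner_l2 ((pre_ip \<Lambda> f g + pre_ip \<Lambda> f' g) k) k'"
    using has_sum_cinner_pre_ip[OF assms(1) S0_add[OF assms(2,3)] assms(4), of k k']
      has_sum_add[OF has_sum_cinner_pre_ip[OF assms(1,2,4), of k k'] has_sum_cinner_pre_ip[OF assms(1,3,4), of k k']]
    by (intro infsumI[THEN trans[OF sym], OF _ infsumI])
      (simp_all add: cinner_l2_add_left plus_blinfun.rep_eq distrib_right)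
qed

text \<open>Replacing \<open>l\<close> by \<open>- l\<close> exchanges the roles of \<open>f\<close>
  and \<open>g\<close>. The adjoint of \<pi>(l) produces a phase in each of the two factors, and
  these phases are conjugate.\<close>

lemma cinner_pre_ip_adjoint:
  assumes \<Lambda>: "lattice_subgroup \<Lambda>" and f: "f \<in> S0" and g: "g \<in> S0"
  shows "cinner_l2 (pre_ip \<Lambda> g f k') k = cnj (cinner_l2 (pre_ip \<Lambda> f g k) k')"
proof -
  have bij: "bij_betw uminus \<Lambda> \<Lambda>"
    using \<Lambda> by (intro bij_betw_byWitness[where f' = uminus]) (auto simp: lattice_subgroup_def)
  have "((\<lambda>l. coeff g f (- l) * cinner_l2 (tf_l2 (- l) k') k) has_sum cinner_l2 (pre_ip \<Lambda> g f k') k) \<Lambda>"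
    using has_sum_cinner_pre_ip[OF \<Lambda> g f, of k' k]
      has_sum_reindex_bij_betw[OF bij, of "\<lambda>l. coeff g f l * cinner_l2 (tf_l2 l k') k"] by simp
  moreover have "coeff g f (- l) * cinner_l2 (tf_l2 (- l) k') k
      = cnj (coeff f g l * cinner_l2 (tf_l2 l k) k')" for l
  proof -
    have 1: "coeff g f (- l) = cnj (twist (- l) l) * cinner_l2 (tf_l2 l g) f"
      using cinner_tf_l2_right[of g "- l" f] by simp
    have "cinner_l2 (tf_l2 (- l) k') k = cnj (coeff k k' (- l))" by (simp add: cinner_l2_cnj)
    also have "\<dots> = twist (- l) l * coeff k' k l"
      using cinner_tf_l2_right[of k "- l" k'] by (simp add: cinner_l2_cnj)
    finally have 2: "cinner_l2 (tf_l2 (- l) k') k = twist (- l) l * coeff k' k l" .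
    have "coeff g f (- l) * cinner_l2 (tf_l2 (- l) k') k
        = (twist (- l) l * cnj (twist (- l) l)) * (cinner_l2 (tf_l2 l g) f * coeff k' k l)"
      unfolding 1 2 by (simp only: mult_ac)
    then show ?thesis by (simp add: cinner_l2_cnj)
  qed
  ultimately have "((\<lambda>l. cnj (coeff f g l * cinner_l2 (tf_l2 l k) k')) has_sum cinner_l2 (pre_ip \<Lambda> g f k') k) \<Lambda>"
    by simp
  moreover have "((\<lambda>l. cnj (coeff f g l * cinner_l2 (tf_l2 l k) k')) has_sum cnj (cinner_l2 (pre_ip \<Lambda> f g k) k')) \<Lambda>"
    by (intro has_sum_bounded_linear[OF bounded_linear_cnj] has_sum_cinner_pre_ip assms)
  ultimately show ?thesis by (rule has_sum_unique)
qed

lemma pre_ip_diff_left: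
  assumes "lattice_subgroup \<Lambda>" "f \<in> S0" "f' \<in> S0" "g \<in> S0"
  shows "pre_ip \<Lambda> (f - f') g = pre_ip \<Lambda> f g - pre_ip \<Lambda> f' g"
  using pre_ip_add_left[OF assms(1) S0_diff[OF assms(2,3)] assms(3,4)] by simp

lemma pre_ip_add_right:
  assumes "lattice_subgroup \<Lambda>" "f \<in> S0" "g \<in> S0" "g' \<in> S0"
  shows "pre_ip \<Lambda> f (g + g') = pre_ip \<Lambda> f g + pre_ip \<Lambda> f g'"
proof (rule blinfun_eqI_cinner)
  fix k k' :: "'a l2"
  show "cinner_l2 (pre_ip \<Lambda> f (g + g') k) k' = cinner_l2 ((pre_ip \<Lambda> f g + pre_ip \<Lambda> f g') k) k'"
    using cinner_pre_ip_adjoint[OF assms(1) S0_add[OF assms(3,4)] assms(2), of k k']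
      cinner_pre_ip_adjoint[OF assms(1,3,2), of k k'] cinner_pre_ip_adjoint[OF assms(1,4,2), of k k']
      pre_ip_add_left[OF assms(1,3,4,2)]
    by (simp add: plus_blinfun.rep_eq cinner_l2_add_left)
qed

lemma pre_ip_diff_right:
  assumes "lattice_subgroup \<Lambda>" "f \<in> S0" "g \<in> S0" "g' \<in> S0"
  shows "pre_ip \<Lambda> f (g - g') = pre_ip \<Lambda> f g - pre_ip \<Lambda> f g'"
  using pre_ip_add_right[OF assms(1,2) S0_diff[OF assms(3,4)] assms(4)] by simp

lemma has_sum_finite_sum:
  fixes f :: "'i \<Rightarrow> 'j \<Rightarrow> 'c::topological_comm_monoid_add"
  assumes "\<And>i. i \<in> I \<Longrightarrow> (f i has_sum s i) A"
  shows "((\<lambda>x. \<Sum>i\<in>I. f i x) has_sum (\<Sum>i\<in>I. s i)) A"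
proof -
  have "sum (\<lambda>x. \<Sum>i\<in>I. f i x) = (\<lambda>F. \<Sum>i\<in>I. sum (f i) F)"
    by (intro ext sum.swap)
  then show ?thesis
    using assms by (simp only: has_sum_def tendsto_sum)
qed

lemma summable_on_finite_sum:
  fixes f :: "'i \<Rightarrow> 'j \<Rightarrow> 'c::{topological_comm_monoid_add, t2_space}"
  assumes "\<And>i. i \<in> I \<Longrightarrow> f i summable_on A"
  shows "(\<lambda>x. \<Sum>i\<in>I. f i x) summable_on A"
  by (rule has_sum_imp_summable[OF has_sum_finite_sum[OF has_sum_infsum[OF assms]]])

text \<open>The summands are positive definite functions of the lattice point, because the cocycles of the
  factors \<^term>\<open>coeff (f j) (f i) l\<close> and \<^term>\<open>cinner_l2 (tf_l2 l (k i)) (k j)\<close> cancel.\<close>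

lemma Re_pre_ip_form_nonneg:
  fixes f k :: "nat \<Rightarrow> 'a::euclidean_space l2"
  assumes \<Lambda>: "lattice_subgroup \<Lambda>" and f: "\<And>i. f i \<in> S0" and I: "finite I"
  shows "0 \<le> Re (\<Sum>i\<in>I. \<Sum>j\<in>I. cinner_l2 (pre_ip \<Lambda> (f j) (f i) (k i)) (k j))"
proof -
  define p where "p l = (\<Sum>i\<in>I. \<Sum>j\<in>I. coeff (f j) (f i) l * cinner_l2 (tf_l2 l (k i)) (k j))" for l
  have hs: "(p has_sum (\<Sum>i\<in>I. \<Sum>j\<in>I. cinner_l2 (pre_ip \<Lambda> (f j) (f i) (k i)) (k j))) \<Lambda>"
    unfolding p_def by (intro has_sum_finite_sum has_sum_cinner_pre_ip \<Lambda> f)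
  have "0 \<le> Re (infsum p \<Lambda>)"
  proof (rule Re_infsum_nonneg_if_pos_def[OF \<Lambda>])
    show "(\<lambda>l. cmod (p l)) summable_on \<Lambda>"
    proof (rule Infinite_Sum.abs_summable_on_comparison_test')
      show "(\<lambda>l. \<Sum>i\<in>I. \<Sum>j\<in>I. cmod (coeff (f j) (f i) l) * (norm (k i) * norm (k j))) summable_on \<Lambda>"
        by (intro summable_on_finite_sum summable_on_cmult_left abs_summable_S0 \<Lambda> f)
      fix l
      show "cmod (p l) \<le> (\<Sum>i\<in>I. \<Sum>j\<in>I. cmod (coeff (f j) (f i) l) * (norm (k i) * norm (k j)))"
        unfolding p_def
      proof (intro sum_norm_le)
        fix i j
        show "cmod (coeff (f j) (f i) l * cinner_l2 (tf_l2 l (k i)) (k j))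
            \<le> cmod (coeff (f j) (f i) l) * (norm (k i) * norm (k j))"
          unfolding norm_mult by (intro mult_left_mono) (use norm_cinner_l2_le[of "tf_l2 l (k i)" "k j"] in \<open>simp_all add: norm_tf_l2\<close>)
      qed
    qed
    fix F and w :: "'a \<times> 'a \<Rightarrow> real" assume F: "finite F" "F \<subseteq> \<Lambda>"
    let ?J = "F \<times> I"
    \<comment> \<open>Indexing by pairs of a lattice point and a summation index turns the fourfold
      sum into one Schur product of two Gram matrices. The real weights enter through
      \<open>?u\<close> alone.\<close>
    let ?u = "\<lambda>(l, i). cscale_l2 (w l) (tf_l2 l (f i))" and ?v = "\<lambda>(l, i). tf_l2 l (k i)"
    have "cnj (cinner_l2 (?u (l, i)) (?u (m, j))) * cinner_l2 (?v (l, i)) (?v (m, j))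
        = complex_of_real (w l * w m) * (coeff (f j) (f i) (l - m) * cinner_l2 (tf_l2 (l - m) (k i)) (k j))" for l m i j
    proof -
      have "cnj (cinner_l2 (?u (l, i)) (?u (m, j))) * cinner_l2 (?v (l, i)) (?v (m, j))
          = (twist m (l - m) * cnj (twist m (l - m))) *
            (complex_of_real (w l * w m) * (cnj (cinner_l2 (tf_l2 (l - m) (f i)) (f j)) * cinner_l2 (tf_l2 (l - m) (k i)) (k j)))"
        unfolding prod.case cinner_l2_cscale_left cinner_l2_cscale_right cinner_tf_l2_tf_l2_diff[of l _ m]
        by (simp only: complex_cnj_mult complex_cnj_complex_of_real complex_cnj_cnj of_real_mult mult_ac)
      then show ?thesis by (simp add: cinner_l2_cnj)
    qed
    then have "(\<Sum>a\<in>?J. \<Sum>b\<in>?J. cnj (cinner_l2 (?u a) (?u b)) * cinner_l2 (?v a) (?v b))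
        = (\<Sum>l\<in>F. \<Sum>i\<in>I. \<Sum>m\<in>F. \<Sum>j\<in>I. complex_of_real (w l * w m) * (coeff (f j) (f i) (l - m) * cinner_l2 (tf_l2 (l - m) (k i)) (k j)))"
      unfolding sum.cartesian_product' by (simp only: )
    also have "\<dots> = (\<Sum>l\<in>F. \<Sum>m\<in>F. complex_of_real (w l * w m) * p (l - m))"
      unfolding p_def sum_distrib_left by (intro sum.cong refl sum.swap)
    finally have eq: "(\<Sum>l\<in>F. \<Sum>m\<in>F. complex_of_real (w l * w m) * p (l - m))
      = (\<Sum>a\<in>?J. \<Sum>b\<in>?J. cnj (cinner_l2 (?u a) (?u b)) * cinner_l2 (?v a) (?v b))" ..
    show "0 \<le> Re (\<Sum>l\<in>F. \<Sum>m\<in>F. complex_of_real (w l * w m) * p (l - m))"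
      unfolding eq by (rule Re_schur_gram_nonneg) (use F I in simp)
  qed
  then show ?thesis using infsumI[OF hs] by simp
qed

text \<open>Module Cauchy-Schwarz as a discriminant argument. The two-term case of the nonnegative
  form, with diagonal entries estimated by operator norms, gives a quadratic inequality in the
  second test vector.\<close>

lemma norm_pre_ip_le:
  assumes \<Lambda>: "lattice_subgroup \<Lambda>" and f: "f \<in> S0" and g: "g \<in> S0"
  shows "norm (pre_ip \<Lambda> f g) \<le> pre_norm \<Lambda> f * pre_norm \<Lambda> g"
proof (rule norm_blinfun_bound)
  show "0 \<le> pre_norm \<Lambda> f * pre_norm \<Lambda> g" by (simp add: pre_norm_def)
  fix k
  define a where "a = norm (pre_ip \<Lambda> g g)"
  define c where "c = norm (pre_ip \<Lambda> f f)"
  define y where "y = norm (pre_ip \<Lambda> f g k)"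
  have diag: "Re (cinner_l2 (pre_ip \<Lambda> h h x) x) \<le> norm (pre_ip \<Lambda> h h) * (norm x)\<^sup>2" for h x
  proof -
    have "Re (cinner_l2 (pre_ip \<Lambda> h h x) x) \<le> norm (pre_ip \<Lambda> h h x) * norm x"
      by (rule order_trans[OF complex_Re_le_cmod norm_cinner_l2_le])
    also have "\<dots> \<le> (norm (pre_ip \<Lambda> h h) * norm x) * norm x"
      by (intro mult_right_mono norm_blinfun) simp
    finally show ?thesis by (simp add: power2_eq_square mult.assoc)
  qed
  have form: "0 \<le> a * (norm k)\<^sup>2 + 2 * Re (cinner_l2 (pre_ip \<Lambda> f g k) k') + c * (norm k')\<^sup>2" for k'
  proof -
    define ff where "ff i = (if i = 0 then g else f)" for i :: nat
    define kk where "kk i = (if i = 0 then k else k')" for i :: nat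
    have "0 \<le> Re (\<Sum>i\<in>{0, 1::nat}. \<Sum>j\<in>{0, 1::nat}. cinner_l2 (pre_ip \<Lambda> (ff j) (ff i) (kk i)) (kk j))"
      by (rule Re_pre_ip_form_nonneg[OF \<Lambda>]) (auto simp: ff_def f g)
    also have "\<dots> = Re (cinner_l2 (pre_ip \<Lambda> g g k) k) + Re (cinner_l2 (pre_ip \<Lambda> f g k) k')
        + (Re (cinner_l2 (pre_ip \<Lambda> g f k') k) + Re (cinner_l2 (pre_ip \<Lambda> f f k') k'))"
      by (simp add: ff_def kk_def)
    also have "cinner_l2 (pre_ip \<Lambda> g f k') k = cnj (cinner_l2 (pre_ip \<Lambda> f g k) k')"
      by (rule cinner_pre_ip_adjoint[OF \<Lambda> f g])
    finally show ?thesis using diag[of g k] diag[of f k'] by (simp add: a_def c_def)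
  qed
  \<comment> \<open>The test vector is a negative multiple of the image of \<open>k\<close> under
    the inner product operator, so the cross term becomes
    \<open>- 2 * t * y\<^sup>2\<close>.\<close>
  have quad: "2 * t * y\<^sup>2 \<le> a * (norm k)\<^sup>2 + c * (t\<^sup>2 * y\<^sup>2)" for t :: real
  proof -
    let ?x = "pre_ip \<Lambda> f g k"
    have "Re (cinner_l2 ?x (- (t *\<^sub>R ?x))) = - (t * y\<^sup>2)"
      unfolding inner_l2_def[symmetric] y_def by (simp add: power2_norm_eq_inner)
    moreover have "(norm (- (t *\<^sub>R ?x)))\<^sup>2 = t\<^sup>2 * y\<^sup>2"
      by (simp add: y_def power_mult_distrib)
    ultimately show ?thesis using form[of "- (t *\<^sub>R ?x)"] by simp
  qed
  have "y\<^sup>2 \<le> c * a * (norm k)\<^sup>2"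
  proof (cases "c = 0")
    \<comment> \<open>Without a quadratic term the inequality is linear in \<open>t\<close> and
      fails for large \<open>t\<close> unless \<open>y\<close> vanishes. Otherwise, for
      \<open>c > 0\<close>, the choice \<open>t = 1 / c\<close> is optimal.\<close>
    case True
    have "y\<^sup>2 = 0"
    proof (rule ccontr)
      assume "y\<^sup>2 \<noteq> 0"
      then have "2 * ((a * (norm k)\<^sup>2 + 1) / y\<^sup>2) * y\<^sup>2 = 2 * (a * (norm k)\<^sup>2 + 1)" by simp
      moreover have "0 \<le> a * (norm k)\<^sup>2" by (simp add: a_def)
      ultimately show False
        using quad[of "(a * (norm k)\<^sup>2 + 1) / y\<^sup>2"] True by simp
    qed
    then show ?thesis using True by simp
  next
    case False
    then have c: "c > 0" by (simp add: c_def)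
    have "2 * (1 / c) * y\<^sup>2 \<le> a * (norm k)\<^sup>2 + c * ((1 / c)\<^sup>2 * y\<^sup>2)" by (rule quad)
    also have "c * ((1 / c)\<^sup>2 * y\<^sup>2) = (1 / c) * y\<^sup>2" using c by (simp add: power2_eq_square)
    finally have "y\<^sup>2 / c \<le> a * (norm k)\<^sup>2" by simp
    then show ?thesis using c by (simp add: pos_divide_le_eq mult_ac)
  qed
  then have "sqrt (y\<^sup>2) \<le> sqrt (c * a * (norm k)\<^sup>2)" by (rule real_sqrt_le_mono)
  then show "norm (pre_ip \<Lambda> f g k) \<le> pre_norm \<Lambda> f * pre_norm \<Lambda> g * norm k"
    by (simp add: y_def a_def c_def pre_norm_def real_sqrt_mult)
qed

section \<open>The module seminorm\<close>

lemma pre_norm_nonneg: "0 \<le> pre_norm \<Lambda> f"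
  by (simp add: pre_norm_def)

lemma pre_norm_zero: "pre_norm \<Lambda> 0 = 0"
  by (simp add: pre_norm_def pre_ip_def cmult_op_zero)

lemma pre_norm_triangle:
  assumes \<Lambda>: "lattice_subgroup \<Lambda>" and f: "f \<in> S0" and g: "g \<in> S0"
  shows "pre_norm \<Lambda> (f + g) \<le> pre_norm \<Lambda> f + pre_norm \<Lambda> g"
proof -
  have "pre_ip \<Lambda> (f + g) (f + g) = (pre_ip \<Lambda> f f + pre_ip \<Lambda> f g) + (pre_ip \<Lambda> g f + pre_ip \<Lambda> g g)"
    using \<Lambda> f g by (simp add: pre_ip_add_left pre_ip_add_right S0_add)
  then have "norm (pre_ip \<Lambda> (f + g) (f + g)) \<le> (norm (pre_ip \<Lambda> f f) + norm (pre_ip \<Lambda> f g)) + (norm (pre_ip \<Lambda> g f) + norm (pre_ip \<Lambda> g g))"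
    by (simp only:) (intro order_trans[OF norm_triangle_ineq] add_mono norm_triangle_ineq)
  also have "\<dots> \<le> (pre_norm \<Lambda> f * pre_norm \<Lambda> f + pre_norm \<Lambda> f * pre_norm \<Lambda> g) + (pre_norm \<Lambda> g * pre_norm \<Lambda> f + pre_norm \<Lambda> g * pre_norm \<Lambda> g)"
    by (intro add_mono norm_pre_ip_le assms)
  also have "\<dots> = (pre_norm \<Lambda> f + pre_norm \<Lambda> g)\<^sup>2"
    by (simp add: power2_eq_square algebra_simps)
  finally show ?thesis
    unfolding pre_norm_def[of \<Lambda> "f + g"] by (intro real_le_lsqrt add_nonneg_nonneg pre_norm_nonneg)
qed

section \<open>Extension of the inner product by continuity\<close>

lemma mod_approx_S0: "weight v \<Longrightarrow> mod_approx \<Lambda> v F f \<Longrightarrow> F n \<in> S0"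
  using M1_subset_S0 by (auto simp: mod_approx_def)

lemma mod_approx_const: "f \<in> M1 v \<Longrightarrow> mod_approx \<Lambda> v (\<lambda>_. f) f"
  by (simp add: mod_approx_def pre_norm_zero)

lemma M1_subset_mod_V: "M1 v \<subseteq> mod_V \<Lambda> v"
  using mod_approx_const by (auto simp: mod_V_def)

lemma mod_approx_pre_norm_bounded:
  assumes \<Lambda>: "lattice_subgroup \<Lambda>" and v: "weight v" and F: "mod_approx \<Lambda> v F f"
  obtains B N where "B > 0" "\<And>n. n \<ge> N \<Longrightarrow> pre_norm \<Lambda> (F n) \<le> B"
proof -
  note FS = mod_approx_S0[OF v F]
  obtain N where N: "\<And>m n. m \<ge> N \<Longrightarrow> n \<ge> N \<Longrightarrow> pre_norm \<Lambda> (F m - F n) < 1"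
    using F unfolding mod_approx_def by (meson zero_less_one)
  show thesis
  proof
    show "pre_norm \<Lambda> (F N) + 1 > 0" using pre_norm_nonneg[of \<Lambda> "F N"] by linarith
    fix n assume "n \<ge> N"
    have "pre_norm \<Lambda> (F n) \<le> pre_norm \<Lambda> (F n - F N) + pre_norm \<Lambda> (F N)"
      using pre_norm_triangle[OF \<Lambda> S0_diff[OF FS[of n] FS[of N]] FS[of N]] by simp
    then show "pre_norm \<Lambda> (F n) \<le> pre_norm \<Lambda> (F N) + 1"
      using N[OF \<open>n \<ge> N\<close> order_refl] by linarith
  qed
qed

lemma convergent_pre_ip:
  assumes \<Lambda>: "lattice_subgroup \<Lambda>" and v: "weight v"
    and F: "mod_approx \<Lambda> v F f" and G: "mod_approx \<Lambda> v G g"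
  shows "convergent (\<lambda>n. pre_ip \<Lambda> (F n) (G n))"
proof -
  note FS = mod_approx_S0[OF v F] and GS = mod_approx_S0[OF v G]
  obtain B N where B: "B > 0" "\<And>n. n \<ge> N \<Longrightarrow> pre_norm \<Lambda> (F n) \<le> B"
    by (rule mod_approx_pre_norm_bounded[OF \<Lambda> v F], rule that)
  obtain B' N' where B': "B' > 0" "\<And>n. n \<ge> N' \<Longrightarrow> pre_norm \<Lambda> (G n) \<le> B'"
    by (rule mod_approx_pre_norm_bounded[OF \<Lambda> v G], rule that)
  have "Cauchy (\<lambda>n. pre_ip \<Lambda> (F n) (G n))"
  proof (rule CauchyI)
    fix e :: real assume e: "e > 0"
    obtain M where M: "\<And>m n. m \<ge> M \<Longrightarrow> n \<ge> M \<Longrightarrow> pre_norm \<Lambda> (F m - F n) < e / (2 * B')"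
      using F B' e unfolding mod_approx_def by (metis divide_pos_pos mult_pos_pos zero_less_numeral)
    obtain M' where M': "\<And>m n. m \<ge> M' \<Longrightarrow> n \<ge> M' \<Longrightarrow> pre_norm \<Lambda> (G m - G n) < e / (2 * B)"
      using G B e unfolding mod_approx_def by (metis divide_pos_pos mult_pos_pos zero_less_numeral)
    have "norm (pre_ip \<Lambda> (F m) (G m) - pre_ip \<Lambda> (F n) (G n)) < e"
      if "m \<ge> max (max M M') (max N N')" "n \<ge> max (max M M') (max N N')" for m n
    proof -
      have "pre_ip \<Lambda> (F m) (G m) - pre_ip \<Lambda> (F n) (G n) = pre_ip \<Lambda> (F m - F n) (G m) + pre_ip \<Lambda> (F n) (G m - G n)"
        using \<Lambda> FS GS by (simp add: pre_ip_diff_left pre_ip_diff_right S0_diff)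
      also have "norm \<dots> \<le> pre_norm \<Lambda> (F m - F n) * pre_norm \<Lambda> (G m) + pre_norm \<Lambda> (F n) * pre_norm \<Lambda> (G m - G n)"
        by (intro order_trans[OF norm_triangle_ineq] add_mono norm_pre_ip_le \<Lambda> FS GS S0_diff)
      also have "\<dots> \<le> pre_norm \<Lambda> (F m - F n) * B' + B * pre_norm \<Lambda> (G m - G n)"
        using that B B' by (intro add_mono mult_left_mono mult_right_mono pre_norm_nonneg) auto
      also have "\<dots> < (e / (2 * B')) * B' + B * (e / (2 * B))"
        using that B(1) B'(1) by (intro add_strict_mono mult_strict_right_mono mult_strict_left_mono M M') auto
      also have "\<dots> = e" using B(1) B'(1) by simp
      finally show ?thesis .
    qed
    then show "\<exists>M. \<forall>m\<ge>M. \<forall>n\<ge>M. norm (pre_ip \<Lambda> (F m) (G m) - pre_ip \<Lambda> (F n) (G n)) < e" by blast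
  qed
  then show ?thesis by (simp add: Cauchy_convergent_iff)
qed

text \<open>Convergence of \<open>F\<close> and \<open>G\<close> in \<open>l2\<close> makes the
  coefficients converge one by one with a uniform bound, but gives no summability. The summable
  majorant comes from the other factor, because \<open>k\<close> and \<open>k'\<close> lie in
  \<open>S0\<close>. The right side mentions only \<open>f\<close> and \<open>g\<close>, so the
  limit operator cannot depend on the sequences.\<close>

lemma cinner_lim_pre_ip:
  assumes \<Lambda>: "lattice_subgroup \<Lambda>" and v: "weight v"
    and F: "mod_approx \<Lambda> v F f" and G: "mod_approx \<Lambda> v G g"
    and A: "(\<lambda>n. pre_ip \<Lambda> (F n) (G n)) \<longlonglongrightarrow> A"
    and k: "k \<in> S0" "k' \<in> S0"
  shows "cinner_l2 (blinfun_apply A k) k' = infsum (\<lambda>l. coeff f g l * cinner_l2 (tf_l2 l k) k') \<Lambda>"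
proof -
  note FS = mod_approx_S0[OF v F] and GS = mod_approx_S0[OF v G]
  have lim: "F \<longlonglongrightarrow> f" "G \<longlonglongrightarrow> g" using F G by (auto simp: mod_approx_def)
  obtain K K' where K: "\<And>n. norm (F n) \<le> K" "\<And>n. norm (G n) \<le> K'"
    using lim[THEN convergentI, THEN convergent_imp_Bseq] by (auto simp: Bseq_def)
  have "(\<lambda>n. infsum (\<lambda>l. coeff (F n) (G n) l * cinner_l2 (tf_l2 l k) k') \<Lambda>)
      \<longlonglongrightarrow> infsum (\<lambda>l. coeff f g l * cinner_l2 (tf_l2 l k) k') \<Lambda>"
  proof (rule tannery)
    show "(\<lambda>l. (K * K') * cmod (cinner_l2 (tf_l2 l k) k')) summable_on \<Lambda>"
      by (intro summable_on_cmult_right abs_summable_S0' \<Lambda> k)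
    fix l
    show "cmod (coeff (F n) (G n) l * cinner_l2 (tf_l2 l k) k') \<le> (K * K') * cmod (cinner_l2 (tf_l2 l k) k')" for n
    proof -
      have "cmod (coeff (F n) (G n) l) \<le> norm (F n) * norm (G n)"
        using norm_cinner_l2_le[of "F n" "tf_l2 l (G n)"] by (simp add: norm_tf_l2)
      also have "\<dots> \<le> K * K'" using K order_trans[OF norm_ge_zero K(1)] by (intro mult_mono) auto
      finally show ?thesis by (simp add: norm_mult mult_right_mono)
    qed
    have "(\<lambda>n. tf_shift l (G n)) \<longlonglongrightarrow> tf_shift l g"
      by (intro blinfun.tendsto tendsto_const lim)
    then show "(\<lambda>n. coeff (F n) (G n) l * cinner_l2 (tf_l2 l k) k') \<longlonglongrightarrow> coeff f g l * cinner_l2 (tf_l2 l k) k'"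
      by (intro tendsto_mult tendsto_cinner_l2 tendsto_const lim) simp
  qed
  moreover have "infsum (\<lambda>l. coeff (F n) (G n) l * cinner_l2 (tf_l2 l k) k') \<Lambda> = cinner_l2 (pre_ip \<Lambda> (F n) (G n) k) k'" for n
    by (rule infsumI[OF has_sum_cinner_pre_ip[OF \<Lambda> FS GS]])
  moreover have "(\<lambda>n. cinner_l2 (pre_ip \<Lambda> (F n) (G n) k) k') \<longlonglongrightarrow> cinner_l2 (blinfun_apply A k) k'"
    by (rule bounded_linear.tendsto[OF bounded_linear_blinfun_cinner A])
  ultimately show ?thesis by (simp add: LIMSEQ_unique)
qed

lemma blinfun_eqI_M1:
  fixes A B :: "'a::euclidean_space l2 \<Rightarrow>\<^sub>L 'a l2"
  assumes v: "weight v"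
    and eq: "\<And>k k'. k \<in> M1 v \<Longrightarrow> k' \<in> M1 v \<Longrightarrow> cinner_l2 (blinfun_apply A k) k' = cinner_l2 (blinfun_apply B k) k'"
  shows "A = B"
proof -
  have 1: "blinfun_apply A k = blinfun_apply B k" if "k \<in> M1 v" for k
  proof (rule l2_eqI)
    fix h
    have "closed {h. cinner_l2 (blinfun_apply A k) h = cinner_l2 (blinfun_apply B k) h}"
      by (intro closed_Collect_eq linear_continuous_on bounded_linear_cinner_l2_right)
    then have "closure (M1 v) \<subseteq> {h. cinner_l2 (blinfun_apply A k) h = cinner_l2 (blinfun_apply B k) h}"
      using eq[OF that] by (intro closure_minimal) auto
    then show "cinner_l2 (blinfun_apply A k) h = cinner_l2 (blinfun_apply B k) h"
      using closure_M1[OF v] by auto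
  qed
  have "closed {k. blinfun_apply A k = blinfun_apply B k}"
    by (intro closed_Collect_eq linear_continuous_on blinfun.bounded_linear_right)
  then have "closure (M1 v) \<subseteq> {k. blinfun_apply A k = blinfun_apply B k}"
    using 1 by (intro closure_minimal) auto
  then show ?thesis using closure_M1[OF v] by (intro blinfun_eqI) auto
qed

text \<open>Shows that the definite description in \<open>mod_ip\<close> denotes: the limit along
  one pair of sequences serves for all pairs, since its matrix coefficients on the dense space
  \<open>M1 v\<close> are the same.\<close>

lemma tendsto_mod_ip:
  assumes \<Lambda>: "lattice_subgroup \<Lambda>" and v: "weight v"
    and F: "mod_approx \<Lambda> v F f" and G: "mod_approx \<Lambda> v G g"
  shows "(\<lambda>n. pre_ip \<Lambda> (F n) (G n)) \<longlonglongrightarrow> mod_ip \<Lambda> v f g"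
proof -
  let ?P = "\<lambda>A. A \<in> nc_torus \<Lambda> \<and> (\<forall>F G. mod_approx \<Lambda> v F f \<longrightarrow> mod_approx \<Lambda> v G g \<longrightarrow>
        (\<lambda>n. pre_ip \<Lambda> (F n) (G n)) \<longlonglongrightarrow> A)"
  obtain A where A: "(\<lambda>n. pre_ip \<Lambda> (F n) (G n)) \<longlonglongrightarrow> A"
    using convergent_pre_ip[OF \<Lambda> v F G] by (auto simp: convergent_def)
  have "?P A"
  proof (intro conjI allI impI)
    have "pre_ip \<Lambda> (F n) (G n) \<in> nc_torus \<Lambda>" for n
      by (intro pre_ip_in_nc_torus \<Lambda> mod_approx_S0[OF v F] mod_approx_S0[OF v G])
    then show "A \<in> nc_torus \<Lambda>"
      unfolding nc_torus_def by (rule closed_sequentially[OF closed_closure _ A])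
    fix F' G' assume F': "mod_approx \<Lambda> v F' f" and G': "mod_approx \<Lambda> v G' g"
    obtain A' where A': "(\<lambda>n. pre_ip \<Lambda> (F' n) (G' n)) \<longlonglongrightarrow> A'"
      using convergent_pre_ip[OF \<Lambda> v F' G'] by (auto simp: convergent_def)
    have "A' = A"
    proof (rule blinfun_eqI_M1[OF v])
      fix k k' assume "k \<in> M1 v" "k' \<in> M1 v"
      then have "k \<in> S0" "k' \<in> S0" using M1_subset_S0[OF v] by auto
      then show "cinner_l2 (blinfun_apply A' k) k' = cinner_l2 (blinfun_apply A k) k'"
        using cinner_lim_pre_ip[OF \<Lambda> v F G A] cinner_lim_pre_ip[OF \<Lambda> v F' G' A'] by simp
    qed
    then show "(\<lambda>n. pre_ip \<Lambda> (F' n) (G' n)) \<longlonglongrightarrow> A" using A' by simp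
  qed
  \<comment> \<open>Uniqueness uses that \<open>F\<close> and \<open>G\<close> exist; with no
    approximating sequences the condition would hold vacuously.\<close>
  moreover have "B = A" if "?P B" for B
    by (rule LIMSEQ_unique[OF _ A]) (use that F G in simp)
  ultimately have "?P (mod_ip \<Lambda> v f g)"
    unfolding mod_ip_def by (rule theI)
  then show ?thesis using F G by simp
qed

lemma mod_ip_M1:
  assumes "lattice_subgroup \<Lambda>" "weight v" "f \<in> M1 v" "g \<in> M1 v"
  shows "mod_ip \<Lambda> v f g = pre_ip \<Lambda> f g"
  using tendsto_mod_ip[OF assms(1,2) mod_approx_const[OF assms(3)] mod_approx_const[OF assms(4)]]
  by (simp add: LIMSEQ_const_iff)

text \<open>Conjugation by \<open>\<pi>(z)\<close> multiplies \<open>\<pi>(l)\<close> by a character of \<open>l\<close>.  Averaging the conjugates by \<open>0\<close> and by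
  a \<open>z\<close> whose character is \<open>-1\<close> at \<open>l\<close> removes the term \<open>\<pi>(l)\<close> and keeps the constant term.\<close>

lemma tf_l2_conj:
  "tf_l2 z (tf_l2 l (tf_l2 (- z) f)) = cscale_l2 (twist z (- z) * exp (2 * pi * \<i> * (snd z \<bullet> fst l - fst z \<bullet> snd l))) (tf_l2 l f)"
proof -
  have "tf_l2 z (tf_l2 l (tf_l2 (- z) f)) = cscale_l2 (twist l (- z) * twist z (l - z)) (tf_l2 l f)"
    by (simp add: tf_l2_tf_l2 tf_l2_cscale_l2 cscale_l2_cscale_l2)
  also have "twist l (- z) * twist z (l - z) = twist z (- z) * exp (2 * pi * \<i> * (snd z \<bullet> fst l - fst z \<bullet> snd l))"
    unfolding twist_def exp_add[symmetric]
    by (simp add: inner_diff_right inner_commute[of "snd z" "fst l"] algebra_simps)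
  finally show ?thesis .
qed

lemma exists_character_minus_one:
  fixes l :: "'a::euclidean_space \<times> 'a"
  assumes "l \<noteq> 0"
  obtains z :: "'a \<times> 'a" where "exp (2 * pi * \<i> * (snd z \<bullet> fst l - fst z \<bullet> snd l)) = -1"
proof -
  have l: "l \<bullet> l > 0" using assms by simp
  \<comment> \<open>\<open>z\<close> is \<open>l\<close> rotated by the symplectic matrix, so its
    symplectic pairing with \<open>l\<close> is \<open>c\<close> times the squared norm of
    \<open>l\<close>; \<open>c\<close> normalizes this to 1/2, half a period of the
    character.\<close>
  define c where "c = 1 / (2 * (l \<bullet> l))"
  define z where "z = (- (c *\<^sub>R snd l), c *\<^sub>R fst l)"
  have "snd z \<bullet> fst l - fst z \<bullet> snd l = c * (l \<bullet> l)"
    by (simp add: z_def inner_prod_def distrib_left)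
  also have "\<dots> = 1 / 2" using l by (simp add: c_def)
  finally have half: "snd z \<bullet> fst l - fst z \<bullet> snd l = 1 / 2" .
  have "exp (2 * pi * \<i> * (snd z \<bullet> fst l - fst z \<bullet> snd l)) = exp (pi * \<i>)"
    unfolding of_real_diff[symmetric] half by simp
  then show thesis using that by (simp add: exp_pi_i)
qed

lemma norm_constant_term_le:
  fixes a :: "'a::euclidean_space \<times> 'a \<Rightarrow> complex"
  assumes "finite F" "0 \<notin> F"
  shows "cmod t \<le> norm (cmult_op t + (\<Sum>l\<in>F. tf_op (a l) l))"
  using assms
\<comment> \<open>The coefficients are generalized because removing the term at \<open>x\<close>
  multiplies each remaining one by \<open>(1 + \<eta> l) / 2\<close>.\<close>
proof (induction F arbitrary: a rule: finite_induct)
  case empty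
  have "norm (cmult_op t gaussian :: 'a l2) \<le> norm (cmult_op t :: 'a l2 \<Rightarrow>\<^sub>L 'a l2) * norm (gaussian :: 'a l2)"
    by (rule norm_blinfun)
  moreover have "norm (gaussian :: 'a l2) > 0"
  proof -
    have "stft (gaussian :: 'a l2) 0 \<noteq> 0" by (simp add: stft_gaussian)
    then have "(gaussian :: 'a l2) \<noteq> 0" by (auto simp: stft_def)
    then show ?thesis by simp
  qed
  ultimately show ?case by (simp add: norm_cscale_l2)
next
  case (insert x F)
  then have "x \<noteq> 0" "0 \<notin> F" by auto
  obtain z where z: "exp (2 * pi * \<i> * (snd z \<bullet> fst x - fst z \<bullet> snd x)) = -1"
    by (rule exists_character_minus_one[OF \<open>x \<noteq> 0\<close>], rule that)
  define \<eta> where "\<eta> l = exp (2 * pi * \<i> * (snd z \<bullet> fst l - fst z \<bullet> snd l))" for l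
  have \<eta>: "\<eta> x = -1" using z by (simp add: \<eta>_def)
  define A where "A = cmult_op t + (\<Sum>l\<in>insert x F. tf_op (a l) l)"
  \<comment> \<open>The scalar makes this the conjugate of \<open>A\<close> by the unitary \<pi>(z),
    whose inverse is \<pi>(-z) only up to the cocycle. The constant term is thereby preserved
    exactly.\<close>
  define C where "C = (cmult_op (cnj (twist z (- z))) o\<^sub>L tf_shift z) o\<^sub>L (A o\<^sub>L tf_shift (- z))"
  define a' where "a' l = a l * (1 + \<eta> l) / 2" for l
  have A_app: "blinfun_apply A f = cscale_l2 t f + (\<Sum>l\<in>insert x F. cscale_l2 (a l) (tf_l2 l f))" for f
    by (simp only: A_def plus_blinfun.rep_eq blinfun.sum_left blinfun_apply_blinfun_compose cmult_op_apply tf_shift_apply)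
  have tf_sum: "tf_l2 z (\<Sum>l\<in>G. h l) = (\<Sum>l\<in>G. tf_l2 z (h l))" for G and h :: "_ \<Rightarrow> 'a l2"
    using blinfun.sum_right[of "tf_shift z" h G] by simp
  have cs_sum: "cscale_l2 c (\<Sum>l\<in>G. h l) = (\<Sum>l\<in>G. cscale_l2 c (h l))" for c G and h :: "_ \<Rightarrow> 'a l2"
    using blinfun.sum_right[of "cmult_op c" h G] by simp
  have C_app: "blinfun_apply C f = cscale_l2 t f + (\<Sum>l\<in>insert x F. cscale_l2 (a l * \<eta> l) (tf_l2 l f))" for f
  proof -
    have "blinfun_apply C f = cscale_l2 (cnj (twist z (- z))) (tf_l2 z (blinfun_apply A (tf_l2 (- z) f)))"
      by (simp add: C_def)
    also have "\<dots> = cscale_l2 (cnj (twist z (- z)) * twist z (- z) * t) f + (\<Sum>l\<in>insert x F. cscale_l2 (cnj (twist z (- z)) * twist z (- z) * (a l * \<eta> l)) (tf_l2 l f))"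
      unfolding A_app tf_l2_add tf_sum cscale_l2_add cs_sum tf_l2_cscale_l2 tf_l2_conj \<eta>_def[symmetric] cscale_l2_cscale_l2
      by (simp only: tf_l2_tf_l2 cscale_l2_cscale_l2 right_minus tf_l2_zero_index mult_ac)
    finally show ?thesis by (simp add: mult.commute[of "cnj _"])
  qed
  have "norm C \<le> norm A"
  proof (rule norm_blinfun_bound)
    fix f
    have "norm (blinfun_apply C f) = norm (blinfun_apply A (tf_l2 (- z) f))"
      by (simp add: C_def norm_cscale_l2 norm_tf_l2)
    also have "\<dots> \<le> norm A * norm f"
      using norm_blinfun[of A "tf_l2 (- z) f"] by (simp add: norm_tf_l2)
    finally show "norm (blinfun_apply C f) \<le> norm A * norm f" .
  qed simp
  have "cmult_op t + (\<Sum>l\<in>F. tf_op (a' l) l) = (A + C) /\<^sub>R 2"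
  proof (rule blinfun_eqI)
    fix f :: "'a l2"
    have half: "(1/2) *\<^sub>R h = cscale_l2 (1/2) h" for h :: "'a l2" by (simp add: scaleR_l2_def)
    have x0: "cscale_l2 (a x) (tf_l2 x f) + cscale_l2 (a x * \<eta> x) (tf_l2 x f) = 0"
      unfolding cscale_l2_add_left[symmetric] \<eta> by (rule l2_eqI) (simp add: cinner_l2_cscale_left)
    have "blinfun_apply ((A + C) /\<^sub>R 2) f = cscale_l2 (1/2) (blinfun_apply A f + blinfun_apply C f)"
      by (simp add: scaleR_blinfun.rep_eq plus_blinfun.rep_eq half)
    also have "blinfun_apply A f + blinfun_apply C f = (cscale_l2 t f + cscale_l2 t f)
        + ((cscale_l2 (a x) (tf_l2 x f) + cscale_l2 (a x * \<eta> x) (tf_l2 x f)) + (\<Sum>l\<in>F. cscale_l2 (a l) (tf_l2 l f) + cscale_l2 (a l * \<eta> l) (tf_l2 l f)))"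
      unfolding A_app C_app by (simp only: sum.insert[OF insert.hyps(1,2)] sum.distrib add_ac)
    also have "\<dots> = cscale_l2 (t + t) f + (\<Sum>l\<in>F. cscale_l2 (a l * (1 + \<eta> l)) (tf_l2 l f))"
      unfolding x0 by (simp only: cscale_l2_add_left distrib_left mult_1_right add_0_left)
    finally show "blinfun_apply (cmult_op t + (\<Sum>l\<in>F. tf_op (a' l) l)) f = blinfun_apply ((A + C) /\<^sub>R 2) f"
      by (simp add: plus_blinfun.rep_eq blinfun.sum_left cscale_l2_add cs_sum cscale_l2_cscale_l2 a'_def)
  qed
  then have "cmod t \<le> norm ((A + C) /\<^sub>R 2)"
    using insert.IH[OF \<open>0 \<notin> F\<close>, of a'] by simp
  also have "\<dots> \<le> norm A" using norm_triangle_ineq[of A C] \<open>norm C \<le> norm A\<close> by simp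
  finally show ?case by (simp only: A_def)
qed

section \<open>The canonical trace\<close>

lemma subspace_closure:
  fixes S :: "'a::real_normed_vector set"
  assumes "subspace S"
  shows "subspace (closure S)"
  unfolding subspace_def
proof (intro conjI ballI allI)
  show "0 \<in> closure S" using subspace_0[OF assms] closure_subset by blast
  fix x assume "x \<in> closure S"
  then obtain X where X: "\<And>n. X n \<in> S" "X \<longlonglongrightarrow> x" unfolding closure_sequential by blast
  show "c *\<^sub>R x \<in> closure S" for c
    unfolding closure_sequential
    by (intro exI[of _ "\<lambda>n. c *\<^sub>R X n"] conjI allI subspace_scale[OF assms] X tendsto_scaleR tendsto_const)
  fix y assume "y \<in> closure S"
  then obtain Y where Y: "\<And>n. Y n \<in> S" "Y \<longlonglongrightarrow> y" unfolding closure_sequential by blast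
  show "x + y \<in> closure S"
    unfolding closure_sequential
    by (intro exI[of _ "\<lambda>n. X n + Y n"] conjI allI subspace_add[OF assms] X Y tendsto_add)
qed

lemma cmult_op_add: "cmult_op (a + b) = cmult_op a + cmult_op b"
  by (rule blinfun_eqI) (simp add: cscale_l2_add_left plus_blinfun.rep_eq)

lemma cmult_op_scaleR: "cmult_op (r *\<^sub>R a) = r *\<^sub>R cmult_op a"
  by (rule blinfun_eqI) (simp add: scaleR_blinfun.rep_eq scaleR_l2_def cscale_l2_cscale_l2 scaleR_conv_of_real)

lemma cmult_op_tf_shift_compose:
  "(tf_op a l) o\<^sub>L (tf_op b m) = tf_op (a * b * twist l m) (l + m)"
  by (rule blinfun_eqI) (simp add: tf_l2_cscale_l2 tf_l2_tf_l2 cscale_l2_cscale_l2 mult.assoc)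

text \<open>The graph of the trace \<open>\<Sum> a\<^sub>l \<pi>(l) \<mapsto> a\<^sub>0\<close>, closed up in the operator norm.\<close>

definition trace_graph :: "(('a::euclidean_space l2 \<Rightarrow>\<^sub>L 'a l2) \<times> complex) set" where
  "trace_graph = closure (span {(tf_op c l, if l = 0 then c else 0) | c l. True})"

lemma closed_trace_graph: "closed trace_graph"
  by (simp add: trace_graph_def)

lemma subspace_trace_graph: "subspace trace_graph"
  unfolding trace_graph_def by (intro subspace_closure subspace_span)

lemma trace_graph_base: "(tf_op c l, if l = 0 then c else 0) \<in> trace_graph"
  unfolding trace_graph_def by (intro subsetD[OF closure_subset] span_base) blast

lemma trace_graph_sum:
  assumes "\<And>i. i \<in> I \<Longrightarrow> (A i, t i) \<in> trace_graph"
  shows "(\<Sum>i\<in>I. A i, \<Sum>i\<in>I. t i) \<in> trace_graph"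
  using subspace_sum[OF subspace_trace_graph, of I "\<lambda>i. (A i, t i)"] assms by (simp add: sum_prod)

text \<open>Finite sums with the constant term split off form a subspace \<open>R\<close> containing
  the generators. The bound holds on \<open>R\<close> and is a closed condition. It implies that the
  zero operator has only the trace value 0, so the set of pairs is a graph.\<close>

lemma norm_trace_le:
  assumes "(A, t) \<in> trace_graph"
  shows "cmod t \<le> norm A"
proof -
  define R :: "(('a l2 \<Rightarrow>\<^sub>L 'a l2) \<times> complex) set" where
    "R = {(cmult_op t + (\<Sum>l\<in>F. tf_op (a l) l), t) | t F a. finite F \<and> 0 \<notin> F}"
  have RI: "(A, t) \<in> R" if "finite F" "0 \<notin> F" "A = cmult_op t + (\<Sum>l\<in>F. tf_op (a l) l)" for A t F a
    unfolding R_def using that by blast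
  have tf0: "tf_op c 0 = cmult_op c" for c :: complex
    by (rule blinfun_eqI) simp
  have "{(tf_op c l, if l = 0 then c else 0) | c l. True} \<subseteq> R"
  proof clarify
    fix c and x y :: 'a
    show "(tf_op c (x, y), if (x, y) = 0 then c else 0) \<in> R"
    proof (cases "(x, y) = 0")
      case True
      then show ?thesis by (intro RI[of "{}"]) (simp_all only: tf0 if_True, simp_all)
    next
      case False
      then show ?thesis by (intro RI[of "{(x, y)}" _ _ "\<lambda>_. c"]) (auto simp: cmult_op_zero)
    qed
  qed
  moreover have "subspace R"
    unfolding subspace_def
  proof (intro conjI ballI allI)
    show "0 \<in> R" unfolding zero_prod_def by (rule RI[of "{}"]) (simp_all add: cmult_op_zero)
    fix x assume "x \<in> R"
    then obtain t F a where x: "x = (cmult_op t + (\<Sum>l\<in>F. tf_op (a l) l), t)" "finite F" "0 \<notin> F"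
      by (auto simp: R_def)
    have sc: "r *\<^sub>R (tf_op b l) = tf_op (r *\<^sub>R b) l" for r b and l :: "'a \<times> 'a"
      by (rule blinfun_eqI) (simp add: cmult_op_scaleR scaleR_blinfun.rep_eq)
    show "r *\<^sub>R x \<in> R" for r
      unfolding x(1) scaleR_Pair using x(2,3)
      by (intro RI[of F _ _ "\<lambda>l. r *\<^sub>R a l"]) (simp_all only: scaleR_add_right scaleR_sum_right sc cmult_op_scaleR simp_thms)
    fix y assume "y \<in> R"
    then obtain t' F' a' where y: "y = (cmult_op t' + (\<Sum>l\<in>F'. tf_op (a' l) l), t')" "finite F'" "0 \<notin> F'"
      by (auto simp: R_def)
    \<comment> \<open>Extension of the coefficients by 0 brings both sums to the common index set
      \<open>F \<union> F'\<close>.\<close>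
    define b where "b l = (if l \<in> F then a l else 0)" for l
    define b' where "b' l = (if l \<in> F' then a' l else 0)" for l
    have "(\<Sum>l\<in>F. tf_op (a l) l) = (\<Sum>l\<in>F \<union> F'. tf_op (b l) l)"
      by (rule sum.mono_neutral_cong_left) (use x y in \<open>auto simp: b_def cmult_op_zero\<close>)
    moreover have "(\<Sum>l\<in>F'. tf_op (a' l) l) = (\<Sum>l\<in>F \<union> F'. tf_op (b' l) l)"
      by (rule sum.mono_neutral_cong_left) (use x y in \<open>auto simp: b'_def cmult_op_zero\<close>)
    moreover have ad: "tf_op (c + d) l = (tf_op c l) + (tf_op d l)" for c d and l :: "'a \<times> 'a"
      by (rule blinfun_eqI) (simp add: cmult_op_add plus_blinfun.rep_eq)
    ultimately show "x + y \<in> R"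
      unfolding x(1) y(1) add_Pair using x(2,3) y(2,3)
      by (intro RI[of "F \<union> F'" _ _ "\<lambda>l. b l + b' l"]) (simp_all only: ad sum.distrib cmult_op_add finite_Un Un_iff simp_thms ac_simps)
  qed
  ultimately have "span {(tf_op c l, if l = 0 then c else 0) | c l. True} \<subseteq> R"
    by (rule span_minimal)
  also have "R \<subseteq> {p. cmod (snd p) \<le> norm (fst p)}"
    by (auto simp: R_def intro: norm_constant_term_le)
  finally have "(trace_graph :: (('a l2 \<Rightarrow>\<^sub>L 'a l2) \<times> complex) set) \<subseteq> {p. cmod (snd p) \<le> norm (fst p)}"
    unfolding trace_graph_def
    by (rule closure_minimal) (intro closed_Collect_le continuous_intros)
  then show ?thesis using assms by auto
qed

text \<open>The coefficient at 0 is \<open>cinner_l2 f g\<close>, and the trace values of the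
  partial sums are constant from the moment 0 is included.\<close>

lemma trace_pre_ip:
  assumes \<Lambda>: "lattice_subgroup \<Lambda>" and f: "f \<in> S0" and g: "g \<in> S0"
  shows "(pre_ip \<Lambda> f g, cinner_l2 f g) \<in> trace_graph"
proof (rule Lim_in_closed_set[OF closed_trace_graph _ finite_subsets_at_top_neq_bot])
  let ?a = "\<lambda>l. coeff f g l"
  show "\<forall>\<^sub>F F in finite_subsets_at_top \<Lambda>. (\<Sum>l\<in>F. tf_op (?a l) l, \<Sum>l\<in>F. if l = 0 then ?a l else 0) \<in> trace_graph"
    by (intro always_eventually allI trace_graph_sum trace_graph_base)
  have "0 \<in> \<Lambda>" using \<Lambda> by (simp add: lattice_subgroup_def)
  have "\<forall>\<^sub>F F in finite_subsets_at_top \<Lambda>. (\<Sum>l\<in>F. if l = 0 then ?a l else 0) = cinner_l2 f g"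
    unfolding eventually_finite_subsets_at_top
    by (rule exI[of _ "{0}"]) (use \<open>0 \<in> \<Lambda>\<close> in \<open>auto simp: sum.delta\<close>)
  then have "((\<lambda>F. \<Sum>l\<in>F. if l = 0 then ?a l else 0) \<longlongrightarrow> cinner_l2 f g) (finite_subsets_at_top \<Lambda>)"
    by (rule tendsto_eventually)
  then show "((\<lambda>F. (\<Sum>l\<in>F. tf_op (?a l) l, \<Sum>l\<in>F. if l = 0 then ?a l else 0)) \<longlongrightarrow> (pre_ip \<Lambda> f g, cinner_l2 f g)) (finite_subsets_at_top \<Lambda>)"
    using has_sum_pre_ip[OF assms] unfolding has_sum_def by (intro tendsto_Pair)
qed

section \<open>Trace of a product of inner products and the resulting square-sum bound\<close>

lemma summable_cmod_sq_S0:
  assumes "lattice_subgroup \<Lambda>" "f \<in> S0" "g \<in> S0"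
  shows "(\<lambda>l. (cmod (coeff f g l))\<^sup>2) summable_on \<Lambda>"
proof (rule summable_on_comparison_test)
  show "(\<lambda>l. (norm f * norm g) * cmod (coeff f g l)) summable_on \<Lambda>"
    by (intro summable_on_cmult_right abs_summable_S0 assms)
  fix l
  show "(cmod (coeff f g l))\<^sup>2 \<le> (norm f * norm g) * cmod (coeff f g l)"
    using norm_cinner_l2_le[of f "tf_l2 l g"] by (simp add: power2_eq_square mult_right_mono norm_tf_l2)
qed simp

text \<open>The second series is indexed by the negative of the lattice point. In a product of
  partial sums over the same finite set the constant terms are then exactly the diagonal ones, and
  the cocycle cancels the phase of the adjoint, leaving squared moduli.\<close>

lemma trace_pre_ip_compose:
  assumes \<Lambda>: "lattice_subgroup \<Lambda>" and f: "f \<in> S0" and g: "g \<in> S0"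
  shows "(pre_ip \<Lambda> f g o\<^sub>L pre_ip \<Lambda> g f, complex_of_real (\<Sum>\<^sub>\<infinity>l\<in>\<Lambda>. (cmod (coeff f g l))\<^sup>2)) \<in> trace_graph"
proof (rule Lim_in_closed_set[OF closed_trace_graph _ finite_subsets_at_top_neq_bot])
  define a where "a l = coeff f g l" for l
  define b where "b l = coeff g f (- l)" for l
  have ab: "a l * b m * twist l (- m) = complex_of_real ((cmod (a l))\<^sup>2)" if "l = m" for l m
  proof -
    have "b l = cnj (twist (- l) l) * cnj (a l)"
      using cinner_tf_l2_right[of g "- l" f] by (simp add: a_def b_def cinner_l2_cnj)
    moreover have "twist (- l) l = twist l (- l)" by (simp add: twist_def)
    ultimately have "a l * b l * twist l (- l) = a l * cnj (a l) * (twist l (- l) * cnj (twist l (- l)))"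
      by (simp only: mult_ac)
    then show ?thesis using that by (simp only: twist_mult_cnj mult_1_right complex_norm_square)
  qed
  let ?S = "\<lambda>F. \<Sum>l\<in>F. tf_op (a l) l"
  let ?R = "\<lambda>F. \<Sum>m\<in>F. tf_op (b m) (- m)"
  have bij: "bij_betw uminus \<Lambda> \<Lambda>"
    using \<Lambda> by (intro bij_betw_byWitness[where f' = uminus]) (auto simp: lattice_subgroup_def)
  have "(?S \<longlongrightarrow> pre_ip \<Lambda> f g) (finite_subsets_at_top \<Lambda>)"
    using has_sum_pre_ip[OF assms] by (simp add: has_sum_def a_def)
  moreover have "((\<lambda>m. tf_op (b m) (- m)) has_sum pre_ip \<Lambda> g f) \<Lambda>"
    using has_sum_pre_ip[OF \<Lambda> g f]
      has_sum_reindex_bij_betw[OF bij, of "\<lambda>m. tf_op (coeff g f m) m"]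
    by (simp add: b_def)
  then have "(?R \<longlongrightarrow> pre_ip \<Lambda> g f) (finite_subsets_at_top \<Lambda>)"
    by (simp add: has_sum_def)
  ultimately have "((\<lambda>F. ?S F o\<^sub>L ?R F) \<longlongrightarrow> pre_ip \<Lambda> f g o\<^sub>L pre_ip \<Lambda> g f) (finite_subsets_at_top \<Lambda>)"
    by (intro bounded_bilinear.tendsto[OF bounded_bilinear_blinfun_compose])
  moreover have "((\<lambda>F. complex_of_real (\<Sum>l\<in>F. (cmod (a l))\<^sup>2)) \<longlongrightarrow> complex_of_real (\<Sum>\<^sub>\<infinity>l\<in>\<Lambda>. (cmod (a l))\<^sup>2)) (finite_subsets_at_top \<Lambda>)"
    unfolding a_def by (intro tendsto_of_real infsum_tendsto summable_cmod_sq_S0 assms)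
  ultimately show "((\<lambda>F. (?S F o\<^sub>L ?R F, complex_of_real (\<Sum>l\<in>F. (cmod (a l))\<^sup>2))) \<longlongrightarrow>
      (pre_ip \<Lambda> f g o\<^sub>L pre_ip \<Lambda> g f, complex_of_real (\<Sum>\<^sub>\<infinity>l\<in>\<Lambda>. (cmod (coeff f g l))\<^sup>2))) (finite_subsets_at_top \<Lambda>)"
    unfolding a_def[symmetric] by (rule tendsto_Pair)
  have "(?S F o\<^sub>L ?R F, complex_of_real (\<Sum>l\<in>F. (cmod (a l))\<^sup>2)) \<in> trace_graph" if "finite F" for F
  proof -
    have "?S F o\<^sub>L ?R F = (\<Sum>l\<in>F. \<Sum>m\<in>F. tf_op (a l * b m * twist l (- m)) (l + - m))"
      unfolding cmult_op_tf_shift_compose[symmetric]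
      by (simp only: bounded_bilinear.sum_left[OF bounded_bilinear_blinfun_compose]
          bounded_bilinear.sum_right[OF bounded_bilinear_blinfun_compose]) (rule sum.swap)
    moreover have "complex_of_real (\<Sum>l\<in>F. (cmod (a l))\<^sup>2)
        = (\<Sum>l\<in>F. \<Sum>m\<in>F. if l + - m = 0 then a l * b m * twist l (- m) else 0)"
      using that by (simp add: ab sum.delta cong: if_cong)
    ultimately show ?thesis
      by (simp only:) (intro trace_graph_sum trace_graph_base)
  qed
  then show "\<forall>\<^sub>F F in finite_subsets_at_top \<Lambda>. (?S F o\<^sub>L ?R F, complex_of_real (\<Sum>l\<in>F. (cmod (a l))\<^sup>2)) \<in> trace_graph"
    by (intro eventually_finite_subsets_at_top_weakI) auto
qed

text \<open>The trace of the product is at most its norm. This transfers the module norm to the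
  square sum of the coefficients, so module-Cauchy sequences have square-summable coefficients that
  are Cauchy in mean square.\<close>

lemma infsum_cmod_sq_le:
  assumes \<Lambda>: "lattice_subgroup \<Lambda>" and f: "f \<in> S0" and g: "g \<in> S0"
  shows "(\<Sum>\<^sub>\<infinity>l\<in>\<Lambda>. (cmod (coeff f g l))\<^sup>2) \<le> (pre_norm \<Lambda> f * pre_norm \<Lambda> g)\<^sup>2"
proof -
  have "(\<Sum>\<^sub>\<infinity>l\<in>\<Lambda>. (cmod (coeff f g l))\<^sup>2) \<le> norm (pre_ip \<Lambda> f g o\<^sub>L pre_ip \<Lambda> g f)"
    using norm_trace_le[OF trace_pre_ip_compose[OF assms]] by simp
  also have "\<dots> \<le> norm (pre_ip \<Lambda> f g) * norm (pre_ip \<Lambda> g f)"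
    by (rule norm_blinfun_compose)
  also have "\<dots> \<le> (pre_norm \<Lambda> f * pre_norm \<Lambda> g) * (pre_norm \<Lambda> g * pre_norm \<Lambda> f)"
    by (intro mult_mono norm_pre_ip_le assms mult_nonneg_nonneg pre_norm_nonneg) simp
  finally show ?thesis by (simp add: power2_eq_square mult_ac)
qed

section \<open>Module frames and Gabor frames\<close>

lemma
  fixes y :: "'i \<Rightarrow> complex"
  assumes b: "0 \<le> b" and le: "\<And>F. finite F \<Longrightarrow> F \<subseteq> A \<Longrightarrow> L2_set (\<lambda>l. cmod (y l)) F \<le> b"
  shows summable_cmod_sq_if_L2_set_le: "(\<lambda>l. (cmod (y l))\<^sup>2) summable_on A"
    and sqrt_infsum_cmod_sq_le: "sqrt (\<Sum>\<^sub>\<infinity>l\<in>A. (cmod (y l))\<^sup>2) \<le> b"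
proof -
  have le': "(\<Sum>l\<in>F. (cmod (y l))\<^sup>2) \<le> b\<^sup>2" if "finite F" "F \<subseteq> A" for F
    using le[OF that] by (simp add: L2_set_def sqrt_le_D)
  show s: "(\<lambda>l. (cmod (y l))\<^sup>2) summable_on A"
    by (intro nonneg_bdd_above_summable_on bdd_aboveI2[of _ _ "b\<^sup>2"]) (use le' in auto)
  have "(\<Sum>\<^sub>\<infinity>l\<in>A. (cmod (y l))\<^sup>2) \<le> b\<^sup>2"
    by (rule infsum_le_finite_sums[OF s le'])
  then show "sqrt (\<Sum>\<^sub>\<infinity>l\<in>A. (cmod (y l))\<^sup>2) \<le> b"
    using b by (simp add: real_le_lsqrt)
qed

lemma L2_set_le_sqrt_infsum:
  fixes y :: "'i \<Rightarrow> complex"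
  assumes "(\<lambda>l. (cmod (y l))\<^sup>2) summable_on A" "finite F" "F \<subseteq> A"
  shows "L2_set (\<lambda>l. cmod (y l)) F \<le> sqrt (\<Sum>\<^sub>\<infinity>l\<in>A. (cmod (y l))\<^sup>2)"
  unfolding L2_set_def by (intro real_sqrt_le_mono finite_sum_le_infsum assms) simp

lemma L2_set_cmod_triangle:
  "L2_set (\<lambda>l. cmod (x l)) F \<le> L2_set (\<lambda>l. cmod (y l)) F + L2_set (\<lambda>l. cmod (x l - y l)) F"
proof -
  have "L2_set (\<lambda>l. cmod (x l)) F \<le> L2_set (\<lambda>l. cmod (y l) + cmod (x l - y l)) F"
    by (intro L2_set_mono) (auto intro: order_trans[OF _ norm_triangle_ineq] simp: norm_triangle_sub)
  also have "\<dots> \<le> L2_set (\<lambda>l. cmod (y l)) F + L2_set (\<lambda>l. cmod (x l - y l)) F"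
    by (rule L2_set_triangle_ineq)
  finally show ?thesis .
qed

text \<open>Completeness of the space of square-summable families together with continuity of its
  norm. The Cauchy condition is uniform over finite sections; there the termwise limit may be taken,
  and summability of the limit is deduced from it.\<close>

lemma
  fixes x :: "nat \<Rightarrow> 'i \<Rightarrow> complex"
  assumes x: "\<And>n. (\<lambda>l. (cmod (x n l))\<^sup>2) summable_on A"
    and lim: "\<And>l. l \<in> A \<Longrightarrow> (\<lambda>n. x n l) \<longlonglongrightarrow> y l"
    and cauchy: "\<And>e. e > 0 \<Longrightarrow> \<exists>N. \<forall>m\<ge>N. \<forall>n\<ge>N. \<forall>F. finite F \<longrightarrow> F \<subseteq> A \<longrightarrow> L2_set (\<lambda>l. cmod (x m l - x n l)) F \<le> e"
  shows summable_cmod_sq_limit: "(\<lambda>l. (cmod (y l))\<^sup>2) summable_on A"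
    and tendsto_infsum_cmod_sq: "(\<lambda>n. \<Sum>\<^sub>\<infinity>l\<in>A. (cmod (x n l))\<^sup>2) \<longlonglongrightarrow> (\<Sum>\<^sub>\<infinity>l\<in>A. (cmod (y l))\<^sup>2)"
proof -
  define q where "q n = sqrt (\<Sum>\<^sub>\<infinity>l\<in>A. (cmod (x n l))\<^sup>2)" for n
  define qy where "qy = sqrt (\<Sum>\<^sub>\<infinity>l\<in>A. (cmod (y l))\<^sup>2)"
  have q0: "0 \<le> q n" "0 \<le> qy" for n by (auto simp: q_def qy_def intro!: infsum_nonneg)
  have near: "\<exists>N. \<forall>n\<ge>N. \<forall>F. finite F \<longrightarrow> F \<subseteq> A \<longrightarrow> L2_set (\<lambda>l. cmod (x n l - y l)) F \<le> e" if "e > 0" for e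
  proof -
    from cauchy[OF \<open>e > 0\<close>] obtain N where
      N: "\<forall>m\<ge>N. \<forall>n\<ge>N. \<forall>F. finite F \<longrightarrow> F \<subseteq> A \<longrightarrow> L2_set (\<lambda>l. cmod (x m l - x n l)) F \<le> e" ..
    have "L2_set (\<lambda>l. cmod (x n l - y l)) F \<le> e" if "n \<ge> N" "finite F" "F \<subseteq> A" for n F
    proof (rule LIMSEQ_le_const2)
      show "(\<lambda>m. L2_set (\<lambda>l. cmod (x n l - x m l)) F) \<longlonglongrightarrow> L2_set (\<lambda>l. cmod (x n l - y l)) F"
        unfolding L2_set_def using that(3)
        by (intro tendsto_real_sqrt tendsto_sum tendsto_power tendsto_norm tendsto_diff tendsto_const lim) auto
      show "\<exists>M. \<forall>m\<ge>M. L2_set (\<lambda>l. cmod (x n l - x m l)) F \<le> e"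
        using N that by (intro exI[of _ N]) simp
    qed
    then show ?thesis by (intro exI[of _ N]) simp
  qed
  have up: "L2_set (\<lambda>l. cmod (y l)) F \<le> q n + e"
    if "\<forall>F. finite F \<longrightarrow> F \<subseteq> A \<longrightarrow> L2_set (\<lambda>l. cmod (x n l - y l)) F \<le> e" "finite F" "F \<subseteq> A" for n e F
  proof -
    have "L2_set (\<lambda>l. cmod (y l)) F \<le> L2_set (\<lambda>l. cmod (x n l)) F + L2_set (\<lambda>l. cmod (x n l - y l)) F"
      using L2_set_cmod_triangle[of y F "x n"] by (simp add: norm_minus_commute)
    also have "\<dots> \<le> q n + e"
      unfolding q_def using that by (intro add_mono L2_set_le_sqrt_infsum x) simp_all
    finally show ?thesis .
  qed
  from near[OF zero_less_one] obtain N where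
    "\<forall>n\<ge>N. \<forall>F. finite F \<longrightarrow> F \<subseteq> A \<longrightarrow> L2_set (\<lambda>l. cmod (x n l - y l)) F \<le> 1" ..
  then have N: "\<forall>F. finite F \<longrightarrow> F \<subseteq> A \<longrightarrow> L2_set (\<lambda>l. cmod (x N l - y l)) F \<le> 1" by simp
  show s: "(\<lambda>l. (cmod (y l))\<^sup>2) summable_on A"
    by (rule summable_cmod_sq_if_L2_set_le[OF _ up[OF N]]) (use q0 in simp_all)
  have "q \<longlonglongrightarrow> qy"
  proof (rule LIMSEQ_I)
    fix e :: real assume "e > 0"
    from near[OF half_gt_zero[OF this]] obtain N where
      N': "\<forall>n\<ge>N. \<forall>F. finite F \<longrightarrow> F \<subseteq> A \<longrightarrow> L2_set (\<lambda>l. cmod (x n l - y l)) F \<le> e / 2" ..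
    have N: "\<forall>F. finite F \<longrightarrow> F \<subseteq> A \<longrightarrow> L2_set (\<lambda>l. cmod (x n l - y l)) F \<le> e / 2" if "n \<ge> N" for n
      using N' that by simp
    have "norm (q n - qy) < e" if "n \<ge> N" for n
    proof -
      have "qy \<le> q n + e / 2"
        unfolding qy_def using q0(1)[of n] \<open>e > 0\<close> by (intro sqrt_infsum_cmod_sq_le up[OF N[OF that]]) auto
      moreover have "q n \<le> qy + e / 2"
        unfolding q_def
      proof (rule sqrt_infsum_cmod_sq_le)
        fix F assume F: "finite F" "F \<subseteq> A"
        have "L2_set (\<lambda>l. cmod (x n l - y l)) F \<le> e / 2" using N[OF that] F by simp
        then show "L2_set (\<lambda>l. cmod (x n l)) F \<le> qy + e / 2"
          using L2_set_cmod_triangle[of "x n" F y] L2_set_le_sqrt_infsum[OF s F] by (simp add: qy_def)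
      qed (use q0 \<open>e > 0\<close> in simp)
      ultimately show ?thesis using \<open>e > 0\<close> by (simp add: abs_le_iff abs_less_iff)
    qed
    then show "\<exists>N. \<forall>n\<ge>N. norm (q n - qy) < e" by (intro exI[of _ N]) simp
  qed
  then have "(\<lambda>n. (q n)\<^sup>2) \<longlonglongrightarrow> qy\<^sup>2" by (intro tendsto_intros)
  then show "(\<lambda>n. \<Sum>\<^sub>\<infinity>l\<in>A. (cmod (x n l))\<^sup>2) \<longlonglongrightarrow> (\<Sum>\<^sub>\<infinity>l\<in>A. (cmod (y l))\<^sup>2)"
    by (simp add: q_def qy_def infsum_nonneg)
qed

text \<open>Convergence in \<open>l2\<close> only gives the coefficients one by one. The Cauchy
  property of \<open>G\<close> in the module norm, through \<open>infsum_cmod_sq_le\<close>,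
  supplies the uniformity needed for the square sums.\<close>

lemma
  assumes \<Lambda>: "lattice_subgroup \<Lambda>" and v: "weight v"
    and f: "f \<in> M1 v" and G: "mod_approx \<Lambda> v G g"
  shows summable_cmod_sq_mod_V: "(\<lambda>l. (cmod (coeff f g l))\<^sup>2) summable_on \<Lambda>"
    and tendsto_infsum_cmod_sq_mod_V: "(\<lambda>n. \<Sum>\<^sub>\<infinity>l\<in>\<Lambda>. (cmod (coeff f (G n) l))\<^sup>2)
      \<longlonglongrightarrow> (\<Sum>\<^sub>\<infinity>l\<in>\<Lambda>. (cmod (coeff f g l))\<^sup>2)"
proof -
  note GS = mod_approx_S0[OF v G]
  have fS: "f \<in> S0" using f M1_subset_S0[OF v] by auto
  let ?x = "\<lambda>n l. coeff f (G n) l"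
  have x: "(\<lambda>l. (cmod (?x n l))\<^sup>2) summable_on \<Lambda>" for n
    by (intro summable_cmod_sq_S0 \<Lambda> fS GS)
  have lim: "(\<lambda>n. ?x n l) \<longlonglongrightarrow> coeff f g l" for l
  proof -
    have "(\<lambda>n. tf_shift l (G n)) \<longlonglongrightarrow> tf_shift l g"
      using G by (intro blinfun.tendsto tendsto_const) (simp add: mod_approx_def)
    then show ?thesis by (intro tendsto_cinner_l2 tendsto_const) simp
  qed
  have cauchy: "\<exists>N. \<forall>m\<ge>N. \<forall>n\<ge>N. \<forall>F. finite F \<longrightarrow> F \<subseteq> \<Lambda> \<longrightarrow> L2_set (\<lambda>l. cmod (?x m l - ?x n l)) F \<le> e" if "e > 0" for e
  proof -
    \<comment> \<open>Adding 1 keeps the divisor positive when the module norm of \<open>f\<close>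
      is 0.\<close>
    define P where "P = pre_norm \<Lambda> f + 1"
    have P: "P > 0" "pre_norm \<Lambda> f \<le> P" using pre_norm_nonneg[of \<Lambda> f] by (auto simp: P_def)
    have "e / P > 0" using that P by simp
    then obtain N where N: "\<And>m n. m \<ge> N \<Longrightarrow> n \<ge> N \<Longrightarrow> pre_norm \<Lambda> (G m - G n) < e / P"
      using G unfolding mod_approx_def by meson
    have "L2_set (\<lambda>l. cmod (?x m l - ?x n l)) F \<le> e" if "m \<ge> N" "n \<ge> N" "finite F" "F \<subseteq> \<Lambda>" for m n F
    proof -
      have d: "?x m l - ?x n l = coeff f (G m - G n) l" for l
        by (simp add: tf_l2_diff cinner_l2_diff_right)
      have "L2_set (\<lambda>l. cmod (?x m l - ?x n l)) F \<le> sqrt (\<Sum>\<^sub>\<infinity>l\<in>\<Lambda>. (cmod (coeff f (G m - G n) l))\<^sup>2)"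
        unfolding d by (intro L2_set_le_sqrt_infsum summable_cmod_sq_S0 \<Lambda> fS GS S0_diff that)
      also have "\<dots> \<le> sqrt ((pre_norm \<Lambda> f * pre_norm \<Lambda> (G m - G n))\<^sup>2)"
        by (intro real_sqrt_le_mono infsum_cmod_sq_le \<Lambda> fS GS S0_diff)
      also have "\<dots> = pre_norm \<Lambda> f * pre_norm \<Lambda> (G m - G n)"
        by (simp add: pre_norm_nonneg)
      also have "\<dots> \<le> P * (e / P)"
        using N[OF that(1,2)] P by (intro mult_mono pre_norm_nonneg) auto
      finally show ?thesis using P by simp
    qed
    then show ?thesis by (intro exI[of _ N]) simp
  qed
  show "(\<lambda>l. (cmod (coeff f g l))\<^sup>2) summable_on \<Lambda>"
    by (rule summable_cmod_sq_limit[OF x lim cauchy])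
  show "(\<lambda>n. \<Sum>\<^sub>\<infinity>l\<in>\<Lambda>. (cmod (coeff f (G n) l))\<^sup>2)
      \<longlonglongrightarrow> (\<Sum>\<^sub>\<infinity>l\<in>\<Lambda>. (cmod (coeff f g l))\<^sup>2)"
    by (rule tendsto_infsum_cmod_sq[OF x lim cauchy])
qed

text \<open>The operator \<open>pre_ip \<Lambda> f f\<close> is paired with two trace values. One is
  read off directly; the other is a limit along sequences approximating the windows, whose operators
  converge by the frame identity to the same operator. The values must agree.\<close>

lemma norm_sq_eq_if_M1:
  assumes \<Lambda>: "lattice_subgroup \<Lambda>" and v: "weight v"
    and g: "standard_module_frame \<Lambda> v n g" and f: "f \<in> M1 v"
  shows "(norm f)\<^sup>2 = (\<Sum>i=1..n. \<Sum>\<^sub>\<infinity>l\<in>\<Lambda>. (cmod (coeff f (g i) l))\<^sup>2)"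
proof -
  have fS: "f \<in> S0" using f M1_subset_S0[OF v] by auto
  have "\<forall>i\<in>{1..n}. \<exists>G. mod_approx \<Lambda> v G (g i)"
    using g by (simp add: standard_module_frame_def mod_V_def)
  from bchoice[OF this] obtain G where "\<forall>i\<in>{1..n}. mod_approx \<Lambda> v (G i) (g i)" ..
  then have G: "mod_approx \<Lambda> v (G i) (g i)" if "i \<in> {1..n}" for i using that by simp
  note f_approx = mod_approx_const[OF f, of \<Lambda>]
  let ?q = "\<lambda>h. \<Sum>\<^sub>\<infinity>l\<in>\<Lambda>. (cmod (coeff f h l))\<^sup>2"
  have eq: "pre_ip \<Lambda> f f = (\<Sum>i=1..n. mod_ip \<Lambda> v f (g i) o\<^sub>L mod_ip \<Lambda> v (g i) f)"
    using g f M1_subset_mod_V[of v \<Lambda>] mod_ip_M1[OF \<Lambda> v f f] by (auto simp: standard_module_frame_def)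
  have "(\<lambda>k. (\<Sum>i=1..n. pre_ip \<Lambda> f (G i k) o\<^sub>L pre_ip \<Lambda> (G i k) f, \<Sum>i=1..n. complex_of_real (?q (G i k))))
      \<longlonglongrightarrow> (\<Sum>i=1..n. mod_ip \<Lambda> v f (g i) o\<^sub>L mod_ip \<Lambda> v (g i) f, \<Sum>i=1..n. complex_of_real (?q (g i)))"
    by (intro tendsto_Pair tendsto_sum bounded_bilinear.tendsto[OF bounded_bilinear_blinfun_compose]
        tendsto_of_real tendsto_infsum_cmod_sq_mod_V[OF \<Lambda> v f] tendsto_mod_ip[OF \<Lambda> v f_approx]
        tendsto_mod_ip[OF \<Lambda> v _ f_approx] G)
  moreover have "(\<Sum>i=1..n. pre_ip \<Lambda> f (G i k) o\<^sub>L pre_ip \<Lambda> (G i k) f, \<Sum>i=1..n. complex_of_real (?q (G i k))) \<in> trace_graph" for k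
    by (intro trace_graph_sum trace_pre_ip_compose \<Lambda> fS mod_approx_S0[OF v G])
  ultimately have "(pre_ip \<Lambda> f f, \<Sum>i=1..n. complex_of_real (?q (g i))) \<in> trace_graph"
    unfolding eq by (rule closed_sequentially[OF closed_trace_graph, rotated])
  \<comment> \<open>The difference of the two pairs has operator part 0, and the norm bound then
    forces the values to coincide.\<close>
  then have "(pre_ip \<Lambda> f f, cinner_l2 f f) - (pre_ip \<Lambda> f f, \<Sum>i=1..n. complex_of_real (?q (g i))) \<in> trace_graph"
    by (intro subspace_diff[OF subspace_trace_graph] trace_pre_ip \<Lambda> fS)
  then have "cmod (cinner_l2 f f - (\<Sum>i=1..n. complex_of_real (?q (g i)))) \<le> norm (pre_ip \<Lambda> f f - pre_ip \<Lambda> f f)"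
    by (intro norm_trace_le) simp
  then have "cinner_l2 f f = complex_of_real (\<Sum>i=1..n. ?q (g i))"
    by simp
  then show ?thesis by (simp only: cinner_l2_self of_real_eq_iff)
qed

theorem theorem4p4:
  fixes \<Lambda> :: "((real ^ 'd) \<times> (real ^ 'd)) set"
    and v :: "(real ^ 'd) \<times> (real ^ 'd) \<Rightarrow> real"
    and g :: "nat \<Rightarrow> (real ^ 'd) l2"
    and n :: nat
  assumes "lattice_subgroup \<Lambda>"
    and "GRS_weight \<Lambda> v"
    and "standard_module_frame \<Lambda> v n g"
  shows "tight_gabor_frame \<Lambda> n g"
proof -
  have v: "weight v" using assms(2) by (simp add: GRS_weight_def)
  have G: "\<exists>G. mod_approx \<Lambda> v G (g i)" if "i \<in> {1..n}" for i
    using assms(3) that by (simp add: standard_module_frame_def mod_V_def)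
  \<comment> \<open>Windows and lattice points form one index, so that a single
    \<open>L2_set\<close> with its triangle inequality treats all windows together.\<close>
  define c where "c f p = cinner_l2 f (tf_l2 (snd p) (g (fst p)))" for f and p :: "nat \<times> _"
  have L2: "(L2_set (\<lambda>p. cmod (c f p)) ({1..n} \<times> F))\<^sup>2 = (\<Sum>i=1..n. \<Sum>l\<in>F. (cmod (coeff f (g i) l))\<^sup>2)" for f F
    by (simp add: L2_set_def sum_nonneg c_def sum.cartesian_product case_prod_unfold)
  have c_diff: "c f p - c f' p = c (f - f') p" for f f' p
    by (simp add: c_def cinner_l2_diff_left)
  have approx: "\<exists>X. (\<forall>k. X k \<in> M1 v) \<and> X \<longlonglongrightarrow> f" for f
    unfolding closure_sequential[symmetric] closure_M1[OF v] by simp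
  \<comment> \<open>On finite sections both sides are continuous in \<open>f\<close>, so the upper
    bound extends from \<open>M1 v\<close> to all of \<open>l2\<close> before summability is known;
    summability is then a consequence.\<close>
  have bessel: "L2_set (\<lambda>p. cmod (c f p)) ({1..n} \<times> F) \<le> norm f" if F: "finite F" "F \<subseteq> \<Lambda>" for f F
  proof -
    obtain X where X: "\<And>k. X k \<in> M1 v" "X \<longlonglongrightarrow> f" using approx by blast
    have "L2_set (\<lambda>p. cmod (c (X k) p)) ({1..n} \<times> F) \<le> norm (X k)" for k
    proof (rule power2_le_imp_le)
      have "(\<Sum>i=1..n. \<Sum>l\<in>F. (cmod (coeff (X k) (g i) l))\<^sup>2)
          \<le> (\<Sum>i=1..n. \<Sum>\<^sub>\<infinity>l\<in>\<Lambda>. (cmod (coeff (X k) (g i) l))\<^sup>2)"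
      proof (intro sum_mono finite_sum_le_infsum F)
        fix i assume "i \<in> {1..n}"
        from G[OF this] obtain G where "mod_approx \<Lambda> v G (g i)" ..
        then show "(\<lambda>l. (cmod (coeff (X k) (g i) l))\<^sup>2) summable_on \<Lambda>"
          by (rule summable_cmod_sq_mod_V[OF assms(1) v X(1)])
      qed simp
      then show "(L2_set (\<lambda>p. cmod (c (X k) p)) ({1..n} \<times> F))\<^sup>2 \<le> (norm (X k))\<^sup>2"
        unfolding L2 norm_sq_eq_if_M1[OF assms(1) v assms(3) X(1)] .
    qed simp
    moreover have "(\<lambda>k. L2_set (\<lambda>p. cmod (c (X k) p)) ({1..n} \<times> F)) \<longlonglongrightarrow> L2_set (\<lambda>p. cmod (c f p)) ({1..n} \<times> F)"
      unfolding L2_set_def c_def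
      by (intro tendsto_real_sqrt tendsto_sum tendsto_power tendsto_norm tendsto_cinner_l2 tendsto_const X)
    ultimately show ?thesis using tendsto_norm[OF X(2)] by (intro LIMSEQ_le) auto
  qed
  have summable: "(\<lambda>l. (cmod (coeff f (g i) l))\<^sup>2) summable_on \<Lambda>" if i: "i \<in> {1..n}" for f i
  proof (rule summable_cmod_sq_if_L2_set_le)
    fix F assume F: "finite F" "F \<subseteq> \<Lambda>"
    have "(L2_set (\<lambda>l. cmod (coeff f (g i) l)) F)\<^sup>2 = (\<Sum>l\<in>F. (cmod (coeff f (g i) l))\<^sup>2)"
      by (simp add: L2_set_def sum_nonneg)
    also have "\<dots> \<le> (\<Sum>i=1..n. \<Sum>l\<in>F. (cmod (coeff f (g i) l))\<^sup>2)"
      using i by (intro member_le_sum) (auto intro: sum_nonneg)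
    also have "\<dots> \<le> (norm f)\<^sup>2"
      unfolding L2[symmetric] by (intro power_mono bessel F) simp
    finally show "L2_set (\<lambda>l. cmod (coeff f (g i) l)) F \<le> norm f"
      by (rule power2_le_imp_le) simp
  qed simp
  define Q where "Q f = (\<Sum>i=1..n. \<Sum>\<^sub>\<infinity>l\<in>\<Lambda>. (cmod (coeff f (g i) l))\<^sup>2)" for f
  have Q0: "0 \<le> Q f" for f by (auto simp: Q_def intro!: sum_nonneg infsum_nonneg)
  have Q_lim: "((\<lambda>F. (L2_set (\<lambda>p. cmod (c f p)) ({1..n} \<times> F))\<^sup>2) \<longlongrightarrow> Q f) (finite_subsets_at_top \<Lambda>)" for f
    unfolding L2 Q_def by (intro tendsto_sum infsum_tendsto summable)
  then have Q_lim': "((\<lambda>F. L2_set (\<lambda>p. cmod (c f p)) ({1..n} \<times> F)) \<longlongrightarrow> sqrt (Q f)) (finite_subsets_at_top \<Lambda>)" for f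
    using tendsto_real_sqrt[OF Q_lim[of f]] by simp
  have Q_le: "sqrt (Q f) \<le> norm f" for f
    using bessel by (intro tendsto_upperbound[OF Q_lim']) (auto intro: eventually_finite_subsets_at_top_weakI)
  \<comment> \<open>The lower bound does not pass through finite sections. It comes from the exact
    identity at an approximant \<open>X k\<close>, with the error \<open>X k - f\<close> controlled
    by the Bessel bound.\<close>
  have "norm f \<le> sqrt (Q f)" for f
  proof -
    obtain X where X: "\<And>k. X k \<in> M1 v" "X \<longlonglongrightarrow> f" using approx by blast
    have "norm (X k) \<le> sqrt (Q f) + norm (X k - f)" for k
    proof -
      have "norm (X k) = sqrt (Q (X k))"
        using norm_sq_eq_if_M1[OF assms(1) v assms(3) X(1), of k] by (simp add: Q_def real_sqrt_unique)
      also have "\<dots> \<le> sqrt (Q f) + sqrt (Q (X k - f))"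
        using L2_set_cmod_triangle[of "c (X k)" _ "c f"] unfolding c_diff
        by (intro tendsto_le[OF _ tendsto_add[OF Q_lim' Q_lim'] Q_lim']) auto
      finally show ?thesis using Q_le[of "X k - f"] by simp
    qed
    moreover have "(\<lambda>k. sqrt (Q f) + norm (X k - f)) \<longlonglongrightarrow> sqrt (Q f) + norm (f - f)"
      by (intro tendsto_intros X)
    ultimately show ?thesis using tendsto_norm[OF X(2)] by (intro LIMSEQ_le[where Y = "\<lambda>k. sqrt (Q f) + norm (X k - f)"]) auto
  qed
  then have "(norm f)\<^sup>2 = Q f" for f
    using Q_le[of f] Q0[of f] by (metis antisym real_sqrt_pow2)
  then show ?thesis
    using summable by (simp add: tight_gabor_frame_def Q_def)
qed

end
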